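(* Let $n\ge 2$ and let $\mathcal{P}$ be a regular $n$-polytope inscribed in a unit $n$-sphere. Let $E$ be the number of edges of $\mathcal{P}$, let $k$ be the number of distinct chord lengths of $\mathcal{P}$, and let $d_1,\dots,d_k$ be these distinct chord lengths. 1. If $\mathcal{P}$ is a simplex of dimension $n\ge 3$, then $\sum_{i=1}^{k}d_i^2$ is a rational number that is not an integer. 2. If $\mathcal{P}$ is not a simplex of dimension $n\ge 3$, then $\sum_{i=1}^{k}d_i^2$ is an integer. Specifically: (a) if $E$ is odd, then $\sum_{i=1}^{k}d_i^2=2k+1$; (b) if $E$ is even, then $\sum_{i=1}^{k}d_i^2=2k+2$.
   Context: An $n$-polytope is a finite convex polytope of full dimension $n$ in Euclidean space $\mathbb{R}^n$; its $0$-faces are its vertices, its $1$-faces its edges. An $n$-polytope is regular (the usual notion of regular convex polytope) if (1) whenever a $(j-2)$-face is incident with a $j$-face, exactly two $(j-1)$-faces are incident with both ($1\le j\le n$, counting the empty set as the unique $(-1)$-face), and (2) there is a point $\mathbf{O}$, the center, such that for each $j\in\{0,\dots,n\}$ the centers of all $j$-faces are at the same distance from $\mathbf{O}$. A unit $n$-sphere is a sphere of radius $1$ in $\mathbb{R}^n$ (so a "2-sphere" is a circle). A regular polytope is inscribed in it if all vertices lie on the sphere, whose center is the center of the polytope. A chord of a regular polytope is a line segment whose endpoints are two distinct vertices (so chords are all edges and all diagonals). *)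

theory Defs
  imports "HOL-Analysis.Analysis"
begin

definition vertices :: "'a::euclidean_space set \<Rightarrow> 'a set" where
  "vertices P = {v. v extreme_point_of P}"

(* Faces are those of the library relation (face_of), which counts both the empty set
   (aff_dim = -1) and P itself as faces of P; dimensions are integers for this reason. *)

definition j_faces :: "int \<Rightarrow> 'a::euclidean_space set \<Rightarrow> 'a set set" where
  "j_faces j P = {F. F face_of P \<and> aff_dim F = j}"

(* The center of a face is taken to be the barycenter of its vertices; a 0-face {v}
   thus has center v and a 1-face has its midpoint as center. *)

definition face_center :: "'a::euclidean_space set \<Rightarrow> 'a" where
  "face_center F = (\<Sum>v\<in>vertices F. v) /\<^sub>R real (card (vertices F))"

definition full_polytope :: "'a::euclidean_space set \<Rightarrow> bool" where
  "full_polytope P \<longleftrightarrow> polytope P \<and> aff_dim P = int DIM('a)"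

definition is_center :: "'a::euclidean_space set \<Rightarrow> 'a \<Rightarrow> bool" where
  "is_center P c \<longleftrightarrow>
     (\<forall>j\<in>{0..int DIM('a)}. \<exists>r. \<forall>F\<in>j_faces j P. dist c (face_center F) = r)"

definition regular_polytope :: "'a::euclidean_space set \<Rightarrow> bool" where
  "regular_polytope P \<longleftrightarrow>
     full_polytope P \<and>
     (\<forall>j\<in>{1..int DIM('a)}. \<forall>F\<in>j_faces (j - 2) P. \<forall>G\<in>j_faces j P.
        F \<subseteq> G \<longrightarrow> card {H \<in> j_faces (j - 1) P. F \<subseteq> H \<and> H \<subseteq> G} = 2) \<and>
     (\<exists>c. is_center P c)"

definition inscribed_in_unit_sphere :: "'a::euclidean_space set \<Rightarrow> bool" where
  "inscribed_in_unit_sphere P \<longleftrightarrow> (\<exists>c. is_center P c \<and> vertices P \<subseteq> sphere c 1)"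

definition chord_lengths :: "'a::euclidean_space set \<Rightarrow> real set" where
  "chord_lengths P = {dist u v |u v. u \<in> vertices P \<and> v \<in> vertices P \<and> u \<noteq> v}"

end

theory Submission
  imports Defs
begin

text \<open>
With the center at the origin the vertices form a set \<open>V\<close> of unit vectors, and a chord whose end
points have inner product \<open>t\<close> has squared length \<open>2 - 2t\<close>. Let \<open>T\<close> be the set of the inner products
of distinct vertices; it has \<open>k\<close> elements and the sum in question is \<open>2k\<close> minus twice the sum of \<open>T\<close>.
If \<open>V = -V\<close>, then \<open>T\<close> together with \<open>1\<close> is symmetric, so \<open>T\<close> sums to \<open>-1\<close>, and the edges form antipodal
pairs, so \<open>E\<close> is even. In a polygon with \<open>V \<noteq> -V\<close> every inner product with a fixed vertex belongs to
exactly two vertices; since the vertices sum to zero, \<open>T\<close> sums to \<open>-1/2\<close>, and \<open>E\<close> and the number of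
vertices equal \<open>2k + 1\<close>. In a regular simplex \<open>T\<close> consists of \<open>-1/n\<close> alone, which gives \<open>2 + 2/n\<close>,
not an integer for \<open>n \<ge> 3\<close>.

What remains is that a regular polytope of dimension at least three is a simplex or centrally symmetric.
This is proved without enumerating the regular polytopes.

The definition of regularity mentions distances only, so symmetries have to be produced first. The
center of a facet behind a given ridge has only two possible positions, and any two facets are joined
by steps across ridges (\<open>facets_connected_through_ridges\<close>). Hence polytopes with the same radii that
share a facet coincide (\<open>rigid_pair_imp_eq\<close>). It follows that the reflection that exchanges the centers
of two adjacent facets preserves the polytope, and that symmetries of a facet extend
(\<open>mirror_swaps_adjacent_facets\<close>, \<open>mirror_extends_from_facet\<close>). These reflections also force the
barycenter of each face to be the foot of the perpendicular from the center
(\<open>equiradial_perpendicular_center\<close>).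

A flag with face centers \<open>f 0, \<dots>, f (n - 1)\<close> then yields unit vectors \<open>\<alpha> 0, \<dots>, \<alpha> (n - 1)\<close> whose
reflections preserve the polytope; \<open>\<alpha> i\<close> is orthogonal to all \<open>f j\<close> with \<open>j \<noteq> i\<close>, and \<open>\<alpha> i\<close> and \<open>\<alpha> j\<close>
are orthogonal unless \<open>i\<close> and \<open>j\<close> are neighbours (\<open>equiradial_mirror_chain\<close>). The element \<open>w\<close> of the
reflection group that moves the cone over the flag to its negative permutes the \<open>\<alpha> i\<close> up to sign
(\<open>longest_element\<close>), so the permutation is the identity or the reversal of the path. The identity means
\<open>w = -1\<close>, hence \<open>V = -V\<close>. A reversal makes the sequence of angles between consecutive mirrors palindromic;
positive definiteness of the Gram matrix then leaves the angles of the simplex and, in even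
dimension, those with one middle angle \<open>\<pi>/4\<close> as in the 24-cell. The latter admit no reversal, because the
group preserves a lattice that contains \<open>\<alpha> 0\<close> but not \<open>\<alpha> (n - 1)\<close> (\<open>middle_label_not_four\<close>).
\<close>

section \<open>Connectedness of the facets of a polytope\<close>

text \<open>This provides points in general position. A line meets an affine set that does not contain it at most
once, so on the segment from a point avoiding the earlier sets to a point outside the new one only
finitely many points are forbidden.\<close>

lemma convex_avoids_finitely_many_affine_sets:
  fixes K :: "'a::euclidean_space set"
  assumes "finite \<A>" "convex K" "K \<noteq> {}"
    and "\<And>A. A \<in> \<A> \<Longrightarrow> affine A \<and> \<not> K \<subseteq> A"
  shows "\<exists>w\<in>K. \<forall>A\<in>\<A>. w \<notin> A"
  using assms(1) assms(4)
proof (induction \<A>)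
  case empty
  then show ?case using assms(3) by auto
next
  case (insert B \<A>)
  then obtain w where w: "w \<in> K" "\<forall>A\<in>\<A>. w \<notin> A" by auto
  show ?case
  proof (cases "w \<in> B")
    case False
    then show ?thesis using w by auto
  next
    case True
    obtain v where v: "v \<in> K" "v \<notin> B" using insert.prems by blast
    define p where "p t = (1 - t) *\<^sub>R w + t *\<^sub>R v" for t :: real
    have line: "p t \<in> A \<Longrightarrow> p t' \<in> A \<Longrightarrow> t \<noteq> t' \<Longrightarrow> affine A \<Longrightarrow> p s \<in> A" for A t t' s
    proof -
      assume a: "p t \<in> A" "p t' \<in> A" "t \<noteq> t'" "affine A"
      define r where "r = (s - t) / (t' - t)"
      have r: "r * (t' - t) = s - t" using a by (simp add: r_def)
      have "(1 - r) *\<^sub>R p t + r *\<^sub>R p t' \<in> A"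
        using a by (intro mem_affine) auto
      also have "(1 - r) *\<^sub>R p t + r *\<^sub>R p t' = p (t + r * (t' - t))"
        by (simp add: p_def algebra_simps)
      also have "\<dots> = p s" by (simp add: r)
      finally show ?thesis .
    qed
    have p01: "p 0 = w" "p 1 = v" by (simp_all add: p_def)
    have "finite {t. p t \<in> A}" if "A \<in> insert B \<A>" for A
    proof -
      have aff: "affine A" using insert.prems that by blast
      have "w \<notin> A \<or> v \<notin> A" using w v that by auto
      then have "t = t'" if "p t \<in> A" "p t' \<in> A" for t t'
        using line[OF that _ aff, of 0] line[OF that _ aff, of 1] p01 by auto
      then have "{t. p t \<in> A} \<subseteq> {t}" if "p t \<in> A" for t using that by blast
      then show ?thesis by (cases "\<exists>t. p t \<in> A") (auto intro: finite_subset)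
    qed
    then have "finite (\<Union>A\<in>insert B \<A>. {t. p t \<in> A})" using insert.hyps by blast
    moreover have "infinite {0<..<1::real}" by (simp add: infinite_Ioo)
    ultimately obtain t where t: "t \<in> {0<..<1}" "t \<notin> (\<Union>A\<in>insert B \<A>. {t. p t \<in> A})"
      by (meson finite_subset subsetI)
    have "p t \<in> K"
      using t(1) w(1) v(1) assms(2) unfolding p_def by (intro convexD) auto
    then show ?thesis using t(2) by blast
  qed
qed

lemma distinct_facets_Int_dim:
  fixes P :: "'a::euclidean_space set"
  assumes "polytope P" "G facet_of P" "H facet_of P" "G \<noteq> H"
  shows "aff_dim (G \<inter> H) \<le> aff_dim P - 2"
proof -
  have cG: "convex G" using assms(2) by (meson face_of_imp_convex facet_of_imp_face_of)
  have f: "(G \<inter> H) face_of G"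
    using assms by (meson face_of_Int face_of_subset facet_of_imp_face_of facet_of_imp_subset inf_le1)
  have "G \<inter> H \<noteq> G"
  proof
    assume "G \<inter> H = G"
    then have "G \<subseteq> H" by auto
    then have "G face_of H"
      using assms by (meson face_of_subset facet_of_def facet_of_imp_subset)
    moreover have "convex H" using assms(3) by (meson face_of_imp_convex facet_of_imp_face_of)
    ultimately have "aff_dim G < aff_dim H" using assms(4) face_of_aff_dim_lt by blast
    then show False using assms by (simp add: facet_of_def)
  qed
  then have "aff_dim (G \<inter> H) < aff_dim G" using f cG face_of_aff_dim_lt by blast
  then show ?thesis using assms by (simp add: facet_of_def)
qed

lemma aff_dim_insert_le: "aff_dim (insert a S) \<le> aff_dim S + 1" for S :: "'a::euclidean_space set"
  by (simp add: aff_dim_insert)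

text \<open>Radial projection from an interior point \<open>z\<close> maps a segment between points of two facets to a path in
the boundary. For a segment in general position the path avoids all faces of codimension at least
three, so it can leave the facets in \<open>\<S>\<close> only across a ridge. The projection is replaced by affine
functionals \<open>\<phi> F\<close> that vanish at \<open>z\<close> and equal \<open>1\<close> on \<open>F\<close>: the ray through \<open>y\<close> leaves \<open>P\<close> through the facets
that maximize \<open>\<phi> F y\<close>.\<close>

lemma facets_connected_through_ridges:
  fixes P :: "'a::euclidean_space set"
  assumes P: "polytope P"
    and ne: "G0 \<in> \<S>" "G0 facet_of P"
    and closed: "\<And>G H. G \<in> \<S> \<Longrightarrow> G facet_of P \<Longrightarrow> H facet_of P \<Longrightarrow>
                   aff_dim (G \<inter> H) = aff_dim P - 2 \<Longrightarrow> H \<in> \<S>"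
    and H0: "H0 facet_of P"
  shows "H0 \<in> \<S>"
proof (rule ccontr)
  assume H0S: "H0 \<notin> \<S>"
  have cP: "convex P" and bP: "bounded P" and phP: "polyhedron P"
    using P by (auto simp: polytope_imp_convex polytope_imp_bounded polytope_imp_polyhedron)
  define \<F> where "\<F> = {F. F facet_of P}"
  have fin\<F>: "finite \<F>" unfolding \<F>_def using P by (simp add: finite_polytope_facets)
  have "P \<noteq> {}" using ne by auto
  then obtain z where z: "z \<in> rel_interior P"
    using cP rel_interior_eq_empty by fastforce
  have zP: "z \<in> P" using z rel_interior_subset by blast
  have z_notin: "z \<notin> F" if "F \<in> \<F>" for F
    using face_of_disjoint_rel_interior[of F P] that z unfolding \<F>_def
    by (metis IntI empty_iff facet_of_def facet_of_irrefl mem_Collect_eq)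
  have "\<forall>F\<in>\<F>. \<exists>a b. P \<subseteq> {x. a \<bullet> x \<le> b} \<and> F = P \<inter> {x. a \<bullet> x = b}"
    unfolding \<F>_def using facet_of_polyhedron[OF phP] by (metis mem_Collect_eq)
  then obtain a b where ab: "\<And>F. F \<in> \<F> \<Longrightarrow> P \<subseteq> {x. a F \<bullet> x \<le> b F}"
      "\<And>F. F \<in> \<F> \<Longrightarrow> F = P \<inter> {x. a F \<bullet> x = b F}"
    by metis
  have pos: "a F \<bullet> z < b F" if "F \<in> \<F>" for F
    using ab[OF that] zP z_notin[OF that] by fastforce
  define \<phi> where "\<phi> F x = (a F \<bullet> (x - z)) / (b F - a F \<bullet> z)" for F x
  have \<phi>_le: "\<phi> F x \<le> 1" if "F \<in> \<F>" "x \<in> P" for F x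
    using ab(1)[OF that(1)] that(2) pos[OF that(1)]
    by (auto simp: \<phi>_def divide_simps inner_diff_right)
  have \<phi>_eq: "x \<in> F \<longleftrightarrow> \<phi> F x = 1" if "F \<in> \<F>" "x \<in> P" for F x
    using ab(2)[OF that(1)] that(2) pos[OF that(1)]
    by (auto simp: \<phi>_def divide_simps inner_diff_right)
  have \<phi>_scale: "\<phi> F (z + d *\<^sub>R (y - z)) = d * \<phi> F y" for F d y
    by (simp add: \<phi>_def)
  define \<L> where "\<L> = {L. L face_of P \<and> aff_dim L \<le> aff_dim P - 3}"
  have fin\<L>: "finite \<L>" unfolding \<L>_def using finite_polytope_faces[OF P] by simp
  have G0: "G0 \<in> \<F>" and H0: "H0 \<in> \<F>" using ne H0 by (auto simp: \<F>_def)
  have dimF: "aff_dim F = aff_dim P - 1" "F \<noteq> {}" "convex F" "F \<subseteq> P" if "F \<in> \<F>" for F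
    using that by (auto simp: \<F>_def facet_of_def face_of_imp_convex face_of_imp_subset)
  \<comment> \<open>The cone from \<open>z\<close> over a face in \<open>\<L>\<close> has codimension at least two in \<open>P\<close>, so \<open>G0\<close> contains a
    point off all these cones, and \<open>H0\<close> one such that the whole segment misses them.\<close>
  have "\<exists>u\<in>G0. \<forall>A\<in>(\<lambda>L. affine hull (insert z L)) ` \<L>. u \<notin> A"
  proof (rule convex_avoids_finitely_many_affine_sets)
    fix A assume "A \<in> (\<lambda>L. affine hull (insert z L)) ` \<L>"
    then obtain L where L: "L \<in> \<L>" "A = affine hull (insert z L)" by auto
    have "aff_dim A < aff_dim G0"
      using L dimF[OF G0] aff_dim_insert_le[of z L] by (simp add: \<L>_def)
    then have "\<not> G0 \<subseteq> A" by (meson aff_dim_subset linorder_not_less)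
    then show "affine A \<and> \<not> G0 \<subseteq> A" using L by simp
  qed (use fin\<L> dimF[OF G0] in auto)
  then obtain u where u: "u \<in> G0" "\<And>L. L \<in> \<L> \<Longrightarrow> u \<notin> affine hull (insert z L)" by auto
  have "\<exists>w\<in>H0. \<forall>A\<in>(\<lambda>L. affine hull (insert u (insert z L))) ` \<L>. w \<notin> A"
  proof (rule convex_avoids_finitely_many_affine_sets)
    fix A assume "A \<in> (\<lambda>L. affine hull (insert u (insert z L))) ` \<L>"
    then obtain L where L: "L \<in> \<L>" "A = affine hull (insert u (insert z L))" by auto
    have A: "aff_dim A \<le> aff_dim H0"
      using L dimF[OF H0] aff_dim_insert_le[of z L] aff_dim_insert_le[of u "insert z L"]
      by (simp add: \<L>_def)
    have "\<not> H0 \<subseteq> A"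
    proof
      assume sub: "H0 \<subseteq> A"
      have zA: "z \<in> A" using L by (simp add: hull_inc)
      have "z \<notin> affine hull H0"
        using affine_hull_face_of_disjoint_rel_interior[OF cP, of H0] H0 z
        by (metis \<F>_def disjoint_iff facet_of_def facet_of_irrefl mem_Collect_eq)
      then have "aff_dim (insert z H0) = aff_dim H0 + 1" by (simp add: aff_dim_insert)
      moreover have "aff_dim (insert z H0) \<le> aff_dim A" using sub zA by (intro aff_dim_subset) auto
      ultimately show False using A by simp
    qed
    then show "affine A \<and> \<not> H0 \<subseteq> A" using L by simp
  qed (use fin\<L> dimF[OF H0] in auto)
  then obtain w where w: "w \<in> H0" "\<And>L. L \<in> \<L> \<Longrightarrow> w \<notin> affine hull (insert u (insert z L))" by auto
  define seg where "seg = closed_segment u w"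
  have segP: "seg \<subseteq> P"
    using u(1) w(1) dimF[OF G0] dimF[OF H0] cP closed_segment_subset unfolding seg_def by blast
  define M where "M F = {y\<in>seg. \<forall>K\<in>\<F>. \<phi> K y \<le> \<phi> F y}" for F
  have closedM: "closed (M F)" if F: "F \<in> \<F>" for F
  proof -
    have "M F = seg \<inter> (\<Inter>K\<in>\<F>. {y. \<phi> K y \<le> \<phi> F y})" unfolding M_def by auto
    moreover have "closed {y. \<phi> K y \<le> \<phi> F y}" if "K \<in> \<F>" for K
      unfolding \<phi>_def using pos[OF F] pos[OF that]
      by (intro closed_Collect_le continuous_intros) auto
    ultimately show ?thesis by (simp add: seg_def closed_INT closed_Int)
  qed
  have cover: "\<exists>F\<in>\<F>. y \<in> M F" if "y \<in> seg" for y
  proof -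
    have "Max ((\<lambda>K. \<phi> K y) ` \<F>) \<in> (\<lambda>K. \<phi> K y) ` \<F>"
      using fin\<F> G0 by (intro Max_in) auto
    then obtain F where F: "F \<in> \<F>" "\<phi> F y = Max ((\<lambda>K. \<phi> K y) ` \<F>)" by force
    then have "\<forall>K\<in>\<F>. \<phi> K y \<le> \<phi> F y" using fin\<F> by simp
    then show ?thesis using F that unfolding M_def by blast
  qed
  \<comment> \<open>Two closed sets that cover the connected segment and both meet it have a common point on it.\<close>
  define A where "A = (\<Union>F\<in>\<F> \<inter> \<S>. M F)"
  define B where "B = (\<Union>F\<in>\<F> - \<S>. M F)"
  have "closed A" "closed B" unfolding A_def B_def using fin\<F> closedM by (auto intro!: closed_UN)
  moreover have "seg \<subseteq> A \<union> B" unfolding A_def B_def using cover by blast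
  moreover have "u \<in> A"
  proof -
    have "u \<in> P" using u(1) dimF[OF G0] by auto
    then have "u \<in> M G0"
      using \<phi>_le \<phi>_eq[OF G0] u(1) unfolding M_def seg_def by auto
    then show ?thesis unfolding A_def using G0 ne by blast
  qed
  moreover have "w \<in> B"
  proof -
    have "w \<in> P" using w(1) dimF[OF H0] by auto
    then have "w \<in> M H0"
      using \<phi>_le \<phi>_eq[OF H0] w(1) unfolding M_def seg_def by auto
    then show ?thesis unfolding B_def using H0 H0S by blast
  qed
  moreover have "connected seg" "u \<in> seg" "w \<in> seg" unfolding seg_def by auto
  ultimately have "A \<inter> B \<inter> seg \<noteq> {}"
    unfolding connected_closed by blast
  then obtain y G H where y: "y \<in> seg" and G: "G \<in> \<F>" "G \<in> \<S>" "y \<in> M G"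
    and H: "H \<in> \<F>" "H \<notin> \<S>" "y \<in> M H"
    unfolding A_def B_def by blast
  \<comment> \<open>The ray from \<open>z\<close> through \<open>y\<close> leaves \<open>P\<close> in a common point of \<open>G\<close> and \<open>H\<close>.\<close>
  have GH: "G \<inter> H \<in> \<L>"
  proof -
    have face: "(G \<inter> H) face_of P" using G H by (simp add: \<F>_def face_of_Int facet_of_imp_face_of)
    have "aff_dim (G \<inter> H) \<noteq> aff_dim P - 2"
      using closed G H by (auto simp: \<F>_def)
    then show ?thesis
      using distinct_facets_Int_dim[OF P, of G H] G H face unfolding \<L>_def \<F>_def
      by (smt (verit, best) mem_Collect_eq)
  qed
  have "y \<noteq> z"
  proof
    assume "y = z"
    have "z \<noteq> u" using u(1) z_notin[OF G0] by auto
    have "w \<in> affine hull {u, z}"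
    proof -
      obtain t where t: "z = (1 - t) *\<^sub>R u + t *\<^sub>R w" "0 \<le> t" "t \<le> 1"
        using y \<open>y = z\<close> unfolding seg_def closed_segment_def by auto
      have "t \<noteq> 0" using t \<open>z \<noteq> u\<close> by auto
      then have "w = (1 - 1/t) *\<^sub>R u + (1/t) *\<^sub>R z"
        by (simp add: t(1) algebra_simps)
      then show ?thesis
        using mem_affine[OF affine_affine_hull, of u "{u, z}" z "1 - 1/t" "1/t"]
        by (simp add: hull_inc)
    qed
    also have "affine hull {u, z} \<subseteq> affine hull (insert u (insert z (G \<inter> H)))"
      by (intro hull_mono) auto
    finally show False using w(2)[OF GH] by simp
  qed
  moreover have "z + (y - z) \<in> affine hull P"
    using y segP by (auto simp: hull_inc)
  ultimately obtain d where d: "0 < d" "z + d *\<^sub>R (y - z) \<in> rel_frontier P"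
    using ray_to_rel_frontier[OF bP z, of "y - z"] by auto
  define e where "e = z + d *\<^sub>R (y - z)"
  obtain K where K: "K \<in> \<F>" "e \<in> K"
    using d(2) rel_frontier_of_polyhedron[OF phP] unfolding \<F>_def e_def by auto
  have eP: "e \<in> P" using K dimF by blast
  have "\<phi> F e = 1" if "F \<in> \<F>" "y \<in> M F" for F
  proof -
    have "1 = \<phi> K e" using K eP \<phi>_eq by simp
    also have "\<dots> = d * \<phi> K y" by (simp add: e_def \<phi>_scale)
    also have "\<dots> \<le> d * \<phi> F y" using that K d(1) unfolding M_def by simp
    also have "\<dots> = \<phi> F e" by (simp add: e_def \<phi>_scale)
    finally show ?thesis using \<phi>_le[OF that(1) eP] by simp
  qed
  then have e: "e \<in> G \<inter> H" using G H \<phi>_eq eP by simp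
  have yeq: "y = (1 - 1/d) *\<^sub>R z + (1/d) *\<^sub>R e"
    using d(1) by (simp add: e_def algebra_simps)
  have yL: "y \<in> affine hull (insert z (G \<inter> H))"
    unfolding yeq by (intro mem_affine affine_affine_hull) (use e in \<open>auto simp: hull_inc\<close>)
  then have "y \<noteq> u" using u(2)[OF GH] by auto
  obtain t where t: "y = (1 - t) *\<^sub>R u + t *\<^sub>R w" "0 \<le> t" "t \<le> 1"
    using y unfolding seg_def closed_segment_def by auto
  have "t \<noteq> 0" using t \<open>y \<noteq> u\<close> by auto
  then have weq: "w = (1 - 1/t) *\<^sub>R u + (1/t) *\<^sub>R y"
    by (simp add: t(1) algebra_simps)
  have "y \<in> affine hull (insert u (insert z (G \<inter> H)))"
    using yL hull_mono[of "insert z (G \<inter> H)" "insert u (insert z (G \<inter> H))"] by blast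
  then have "w \<in> affine hull (insert u (insert z (G \<inter> H)))"
    unfolding weq by (intro mem_affine affine_affine_hull) (auto simp: hull_inc)
  then show False using w(2)[OF GH] by simp
qed

section \<open>Rigidity of polytopes with equidistant face centers\<close>

text \<open>The reflection in the hyperplane orthogonal to \<open>b\<close>; the value \<open>x / 0 = 0\<close> makes \<open>mirror 0\<close> the identity.\<close>

definition mirror :: "'a::euclidean_space \<Rightarrow> 'a \<Rightarrow> 'a" where
  "mirror b x = x - (2 * (x \<bullet> b) / (b \<bullet> b)) *\<^sub>R b"

lemma mirror_involution [simp]: "mirror b (mirror b x) = x"
  by (cases "b = 0") (simp_all add: mirror_def algebra_simps)

lemma orthogonal_transformation_mirror: "orthogonal_transformation (mirror b)"
  unfolding orthogonal_transformation_def
proof (intro conjI allI)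
  show "linear (mirror b)"
    by (rule linearI) (simp_all add: mirror_def algebra_simps add_divide_distrib)
  show "mirror b v \<bullet> mirror b w = v \<bullet> w" for v w
    by (cases "b = 0") (simp_all add: mirror_def algebra_simps inner_commute)
qed

lemma mirror_fixes: "x \<bullet> b = 0 \<Longrightarrow> mirror b x = x"
  by (simp add: mirror_def)

lemma mirror_eq_self_iff: "mirror b x = x \<longleftrightarrow> b = 0 \<or> x \<bullet> b = 0"
  by (auto simp: mirror_def)

lemma mirror_swaps: "x \<bullet> x = y \<bullet> y \<Longrightarrow> mirror (y - x) x = y"
proof (cases "x = y")
  case False
  assume "x \<bullet> x = y \<bullet> y"
  then have "(y - x) \<bullet> (y - x) = - 2 * (x \<bullet> (y - x))"
    by (simp add: inner_diff inner_commute)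
  moreover have "(y - x) \<bullet> (y - x) \<noteq> 0" using False by simp
  ultimately have "2 * (x \<bullet> (y - x)) / ((y - x) \<bullet> (y - x)) = -1"
    by (simp add: divide_eq_eq)
  then show ?thesis by (simp add: mirror_def)
qed (simp add: mirror_def)

lemma mirror_swaps': "x \<bullet> x = y \<bullet> y \<Longrightarrow> mirror (y - x) y = x"
proof -
  assume "x \<bullet> x = y \<bullet> y"
  then have "mirror (y - x) (mirror (y - x) x) = mirror (y - x) y" by (simp only: mirror_swaps)
  then show ?thesis by simp
qed

lemma vertices_image:
  assumes "orthogonal_transformation T"
  shows "vertices (T ` F) = T ` vertices F"
proof -
  have lin: "linear T" "inj T"
    using assms orthogonal_transformation_linear orthogonal_transformation_inj by blast+
  have *: "(T x extreme_point_of T ` F) = (x extreme_point_of F)" for x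
    using face_of_linear_image[OF lin, of "{x}" F] by (simp add: face_of_singleton)
  have "x \<in> T ` F" if "x extreme_point_of T ` F" for x
    using that by (simp add: extreme_point_of_def)
  then show ?thesis unfolding vertices_def using * by blast
qed

lemma face_center_image:
  assumes "orthogonal_transformation T"
  shows "face_center (T ` F) = T (face_center F)"
proof -
  have lin: "linear T" "inj T"
    using assms orthogonal_transformation_linear orthogonal_transformation_inj by blast+
  have "inj_on T (vertices F)" using lin(2) inj_on_subset by blast
  then show ?thesis
    unfolding face_center_def vertices_image[OF assms]
    by (simp add: sum.reindex card_image linear_sum[OF lin(1)] linear_scale[OF lin(1)])
qed

lemma face_center_in_rel_interior:
  assumes "polytope F" "F \<noteq> {}"
  shows "face_center F \<in> rel_interior F"
proof -
  have hull: "F = convex hull (vertices F)"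
    unfolding vertices_def
    using Krein_Milman_Minkowski assms polytope_imp_compact polytope_imp_convex by blast
  have fin: "finite (vertices F)"
    unfolding vertices_def
    using assms finite_polyhedron_extreme_points polytope_imp_polyhedron by blast
  have "vertices F \<noteq> {}" using hull assms(2) by auto
  then have card: "real (card (vertices F)) > 0" using fin by (simp add: card_gt_0_iff)
  have "face_center F = (\<Sum>v\<in>vertices F. (1 / real (card (vertices F))) *\<^sub>R v)"
    by (simp add: face_center_def scaleR_sum_right divide_inverse)
  then have "face_center F \<in> {y. \<exists>u. (\<forall>v\<in>vertices F. 0 < u v) \<and> sum u (vertices F) = 1 \<and>
      (\<Sum>v\<in>vertices F. u v *\<^sub>R v) = y}"
    using card by (intro CollectI exI[of _ "\<lambda>_. 1 / real (card (vertices F))"]) auto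
  then have "face_center F \<in> rel_interior (convex hull (vertices F))"
    using explicit_subset_rel_interior_convex_hull_minimal[OF fin] by blast
  then show ?thesis using hull by simp
qed

lemma face_center_in:
  assumes "polytope F" "F \<noteq> {}"
  shows "face_center F \<in> F"
  by (rule subsetD[OF rel_interior_subset face_center_in_rel_interior[OF assms]])

lemma face_center_inj:
  assumes "polytope P" "F face_of P" "G face_of P" "F \<noteq> {}" "G \<noteq> {}"
    and "face_center F = face_center G"
  shows "F = G"
proof -
  have "polytope F" "polytope G" using assms face_of_polytope_polytope by blast+
  then have "face_center F \<in> rel_interior F \<inter> rel_interior G"
    using assms face_center_in_rel_interior by (metis IntI)
  then show ?thesis using face_of_eq[OF assms(2,3)] by blast
qed

lemma face_center_notin_face:
  assumes "polytope P" "F face_of P" "F \<noteq> P" "P \<noteq> {}"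
  shows "face_center P \<notin> F"
proof
  assume "face_center P \<in> F"
  then have "face_center P \<in> F \<inter> rel_interior P"
    using face_center_in_rel_interior[OF assms(1,4)] by simp
  then show False using face_of_disjoint_rel_interior[OF assms(2,3)] by simp
qed

text \<open>The origin need not lie in the affine hull of \<open>P\<close>, where it is replaced by its foot: the squares of the
distances from the two points differ by a constant. For this reason faces inherit the notion.\<close>

definition equiradial :: "'a::euclidean_space set \<Rightarrow> bool" where
  "equiradial P \<longleftrightarrow> polytope P \<and>
     (\<forall>F G. F face_of P \<longrightarrow> G face_of P \<longrightarrow> F \<subseteq> G \<longrightarrow> aff_dim G = aff_dim F + 2 \<longrightarrow>
        card {H. H face_of P \<and> aff_dim H = aff_dim F + 1 \<and> F \<subseteq> H \<and> H \<subseteq> G} = 2) \<and>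
     (\<forall>F G. F face_of P \<longrightarrow> G face_of P \<longrightarrow> F \<noteq> {} \<longrightarrow> G \<noteq> {} \<longrightarrow> aff_dim F = aff_dim G \<longrightarrow>
        norm (face_center F) = norm (face_center G))"

lemma equiradial_polytope: "equiradial P \<Longrightarrow> polytope P"
  by (simp add: equiradial_def)

lemma equiradial_radius:
  "\<lbrakk>equiradial P; F face_of P; G face_of P; F \<noteq> {}; G \<noteq> {}; aff_dim F = aff_dim G\<rbrakk>
    \<Longrightarrow> norm (face_center F) = norm (face_center G)"
  unfolding equiradial_def by blast

lemma equiradial_diamond:
  "\<lbrakk>equiradial P; F face_of P; G face_of P; F \<subseteq> G; aff_dim G = aff_dim F + 2\<rbrakk>
    \<Longrightarrow> card {H. H face_of P \<and> aff_dim H = aff_dim F + 1 \<and> F \<subseteq> H \<and> H \<subseteq> G} = 2"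
  unfolding equiradial_def by blast

lemma equiradial_face:
  assumes P: "equiradial P" and Q: "Q face_of P"
  shows "equiradial Q"
  unfolding equiradial_def
proof (intro conjI allI impI)
  show "polytope Q" using assms face_of_polytope_polytope equiradial_polytope by blast
next
  fix F G assume FG: "F face_of Q" "G face_of Q" "F \<subseteq> G" "aff_dim G = aff_dim F + 2"
  have "{H. H face_of Q \<and> aff_dim H = aff_dim F + 1 \<and> F \<subseteq> H \<and> H \<subseteq> G}
      = {H. H face_of P \<and> aff_dim H = aff_dim F + 1 \<and> F \<subseteq> H \<and> H \<subseteq> G}"
    using face_of_face[OF Q] face_of_imp_subset[OF FG(2)] by auto
  then show "card {H. H face_of Q \<and> aff_dim H = aff_dim F + 1 \<and> F \<subseteq> H \<and> H \<subseteq> G} = 2"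
    using equiradial_diamond[OF P _ _ FG(3,4)] FG(1,2) face_of_trans[OF _ Q] by simp
next
  fix F G assume "F face_of Q" "G face_of Q" "F \<noteq> {}" "G \<noteq> {}" "aff_dim F = aff_dim G"
  then show "norm (face_center F) = norm (face_center G)"
    using equiradial_radius[OF P] face_of_trans[OF _ Q] by blast
qed

lemma other_face_in_diamond:
  assumes "equiradial P" "R face_of P" "G face_of P" "R \<subseteq> G" "aff_dim G = aff_dim R + 1"
    and "Q face_of P" "G \<subseteq> Q" "aff_dim Q = aff_dim G + 1"
  obtains H where "H face_of P" "H \<noteq> G" "R \<subseteq> H" "H \<subseteq> Q" "aff_dim H = aff_dim G"
proof -
  define X where "X = {H. H face_of P \<and> aff_dim H = aff_dim R + 1 \<and> R \<subseteq> H \<and> H \<subseteq> Q}"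
  have "R \<subseteq> Q" "aff_dim Q = aff_dim R + 2" using assms(4,5,7,8) by auto
  then have "card X = 2"
    unfolding X_def by (rule equiradial_diamond[OF assms(1,2,6)])
  moreover have "G \<in> X" unfolding X_def using assms by simp
  ultimately have "X \<noteq> {G}" by auto
  then obtain H where "H \<in> X" "H \<noteq> G" using \<open>G \<in> X\<close> by blast
  then show ?thesis using that assms unfolding X_def by auto
qed

text \<open>Equivalently, for nonempty \<open>F\<close> the barycenter is the foot of the perpendicular from the origin to the
affine hull of \<open>F\<close>.\<close>

definition perpendicular_center :: "'a::euclidean_space set \<Rightarrow> bool" where
  "perpendicular_center F \<longleftrightarrow> (\<forall>x\<in>F. x \<bullet> face_center F = face_center F \<bullet> face_center F)"

definition perpendicular_faces :: "'a::euclidean_space set \<Rightarrow> bool" where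
  "perpendicular_faces P \<longleftrightarrow> (\<forall>F. F face_of P \<longrightarrow> F \<noteq> P \<longrightarrow> perpendicular_center F)"

definition same_radii :: "'a::euclidean_space set \<Rightarrow> 'a set \<Rightarrow> bool" where
  "same_radii P Q \<longleftrightarrow> (\<forall>F G. F face_of P \<longrightarrow> G face_of Q \<longrightarrow> F \<noteq> {} \<longrightarrow> G \<noteq> {} \<longrightarrow>
     aff_dim F = aff_dim G \<longrightarrow> aff_dim F < aff_dim P \<longrightarrow> norm (face_center F) = norm (face_center G))"

definition rigid_pair :: "'a::euclidean_space set \<Rightarrow> 'a set \<Rightarrow> 'a set \<Rightarrow> bool" where
  "rigid_pair P Q F \<longleftrightarrow> equiradial P \<and> equiradial Q \<and> affine hull P = affine hull Q \<and>
     perpendicular_faces P \<and> perpendicular_faces Q \<and> same_radii P Q \<and> F facet_of P \<and> F facet_of Q"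

lemma rigid_pair_sym:
  assumes "rigid_pair P Q F"
  shows "rigid_pair Q P F"
proof -
  have "aff_dim P = aff_dim Q"
    using assms unfolding rigid_pair_def by (metis aff_dim_affine_hull)
  then have "same_radii Q P" if "same_radii P Q"
    using that unfolding same_radii_def by simp
  then show ?thesis using assms unfolding rigid_pair_def by simp
qed

lemma perpendicular_faces_face:
  assumes "polytope P" "perpendicular_faces P" "Q face_of P"
  shows "perpendicular_faces Q"
  unfolding perpendicular_faces_def
proof (intro allI impI)
  fix F assume F: "F face_of Q" "F \<noteq> Q"
  then have "F face_of P" using assms face_of_trans by blast
  moreover have "F \<noteq> P" using F assms(3) face_of_imp_subset by blast
  ultimately show "perpendicular_center F" using assms unfolding perpendicular_faces_def by blast
qed

lemma affine_hull_insert_facet: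
  assumes "polytope P" "F face_of P" "aff_dim P = aff_dim F + 1" "x \<in> P" "x \<notin> F"
  shows "affine hull (insert x F) = affine hull P"
proof -
  have "x \<notin> affine hull F"
    using face_of_imp_eq_affine_Int[OF polytope_imp_convex[OF assms(1)] assms(2)] assms(4,5) by blast
  then have "aff_dim (insert x F) = aff_dim P" using assms(3) by (simp add: aff_dim_insert)
  moreover have "insert x F \<subseteq> P" using assms(2,4) face_of_imp_subset by blast
  ultimately show ?thesis using aff_dim_eq_full_gen by blast
qed

lemma affine_hull_insert_cong:
  assumes "affine hull S = affine hull S'"
  shows "affine hull (insert x S) = affine hull (insert x S')"
proof -
  have "affine hull (insert x S) = affine hull (insert x (affine hull S))" by (rule hull_insert)
  also have "\<dots> = affine hull (insert x (affine hull S'))" by (simp only: assms)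
  also have "\<dots> = affine hull (insert x S')" by (rule hull_insert[symmetric])
  finally show ?thesis .
qed

lemma affine_hull_facet_centers:
  assumes P: "polytope P" and G: "G facet_of P" and H: "H facet_of P" "H \<noteq> G"
    and R: "R face_of P" "R \<subseteq> G" "aff_dim R = aff_dim P - 2"
  shows "affine hull (insert (face_center G) R) = affine hull G"
    and "affine hull (insert (face_center H) (insert (face_center G) R)) = affine hull P"
proof -
  have poly: "polytope G" "polytope H"
    using P G H face_of_polytope_polytope facet_of_imp_face_of by blast+
  have ne: "G \<noteq> {}" "H \<noteq> {}" using G H by (auto simp: facet_of_def)
  have RG: "R face_of G" using R G face_of_subset facet_of_imp_subset by blast
  have "R \<noteq> G" using R(3) G by (auto simp: facet_of_def)
  then have "face_center G \<notin> R" using face_center_notin_face poly RG ne by blast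
  then show 1: "affine hull (insert (face_center G) R) = affine hull G"
    using affine_hull_insert_facet[OF poly(1) RG _ face_center_in[OF poly(1) ne(1)]] R(3) G
    by (simp add: facet_of_def)
  have "face_center H \<notin> G"
  proof
    assume "face_center H \<in> G"
    then have "G \<inter> rel_interior H \<noteq> {}" using face_center_in_rel_interior poly ne by blast
    then have "H \<subseteq> G"
      using subset_of_face_of[of G P H] G H facet_of_imp_face_of facet_of_imp_subset by blast
    then have "H face_of G" using H G
      by (meson face_of_subset facet_of_def facet_of_imp_subset)
    then have "aff_dim H < aff_dim G"
      using H(2) face_of_aff_dim_lt poly polytope_imp_convex by blast
    then show False using G H by (simp add: facet_of_def)
  qed
  moreover have "face_center H \<in> P"
    using face_center_in[OF poly(2) ne(2)] facet_of_imp_subset[OF H(1)] by blast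
  moreover have "aff_dim P = aff_dim G + 1" using G by (simp add: facet_of_def)
  ultimately have "affine hull (insert (face_center H) G) = affine hull P"
    using affine_hull_insert_facet[OF P facet_of_imp_face_of[OF G]] by blast
  then show "affine hull (insert (face_center H) (insert (face_center G) R)) = affine hull P"
    using affine_hull_insert_cong[OF 1, of "face_center H"] by simp
qed

text \<open>By the first assumption \<open>h' - g\<close> is a multiple of \<open>h - g\<close> plus a vector \<open>q\<close> in the direction space of
\<open>insert g R\<close>. The assumptions on inner products make \<open>q\<close> orthogonal to that space, so \<open>q = 0\<close>, and a line
meets a sphere in at most two points.\<close>

lemma at_most_two_equidistant_points:
  fixes g h h' :: "'a::euclidean_space"
  assumes hull: "h' \<in> affine hull (insert h (insert g R))"
    and R: "\<And>x. x \<in> R \<Longrightarrow> x \<bullet> g = \<rho> \<and> x \<bullet> h = \<rho> \<and> x \<bullet> h' = \<rho>"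
    and norms: "g \<bullet> g = \<rho>" "h \<bullet> h = \<rho>" "h' \<bullet> h' = \<rho>" and "h \<noteq> g"
  shows "h' = g \<or> h' = h"
proof -
  define S where "S = span ((\<lambda>x. - g + x) ` R)"
  have "h' \<in> affine hull (insert g (insert h R))" using hull by (simp add: insert_commute)
  then have "h' - g \<in> span ((\<lambda>x. - g + x) ` insert h R)"
    unfolding affine_hull_insert_span_gen by auto
  then obtain a where a: "h' - g - a *\<^sub>R (- g + h) \<in> S"
    unfolding S_def by (auto simp: span_insert)
  define q where "q = h' - g - a *\<^sub>R (h - g)"
  have qS: "q \<in> S" using a by (simp add: q_def)
  have Sg: "g \<bullet> s = 0" if "s \<in> S" for s
  proof -
    have "orthogonal g s"
      using that unfolding S_def
    proof (rule orthogonal_to_span)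
      fix y assume "y \<in> (\<lambda>x. - g + x) ` R"
      then show "orthogonal g y" using R norms by (auto simp: orthogonal_def inner_diff_right inner_commute)
    qed
    then show ?thesis by (simp add: orthogonal_def)
  qed
  have "orthogonal q q"
    using qS unfolding S_def
  proof (rule orthogonal_to_span)
    fix y assume "y \<in> (\<lambda>x. - g + x) ` R"
    then obtain x where x: "x \<in> R" "y = x - g" by auto
    have "g \<bullet> x = \<rho>" "h \<bullet> x = \<rho>" "h' \<bullet> x = \<rho>"
      using R[OF x(1)] by (simp_all add: inner_commute)
    then have "q \<bullet> x = 0" by (simp add: q_def inner_diff_left)
    moreover have "q \<bullet> g = 0" using Sg[OF qS] by (simp add: inner_commute)
    ultimately show "orthogonal q y" by (simp add: orthogonal_def x inner_diff_right)
  qed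
  then have "q = 0" by (simp add: orthogonal_def)
  then have h': "h' = g + a *\<^sub>R (h - g)" by (simp add: q_def algebra_simps)
  define u where "u = h - g"
  have uu: "u \<bullet> u = - 2 * (g \<bullet> u)" using norms by (simp add: u_def inner_diff inner_commute)
  have "\<rho> = g \<bullet> g + 2 * a * (g \<bullet> u) + a * a * (u \<bullet> u)"
    using norms(3) unfolding h' u_def[symmetric] by (simp add: inner_add inner_commute algebra_simps)
  then have "a * (a - 1) * (u \<bullet> u) = 0" using norms(1) uu by (simp add: algebra_simps)
  moreover have "u \<bullet> u \<noteq> 0" using \<open>h \<noteq> g\<close> by (simp add: u_def)
  ultimately have "a = 0 \<or> a = 1" by simp
  then show ?thesis using h' by auto
qed

lemma norm_eq_imp_inner: "norm x = norm y \<Longrightarrow> x \<bullet> x = y \<bullet> y"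
  by (simp add: norm_eq_sqrt_inner)

text \<open>Let \<open>R\<close> be a ridge of a common facet \<open>G\<close>. Each polytope has exactly one further facet that contains \<open>R\<close>.
The centers of these two facets coincide by \<open>at_most_two_equidistant_points\<close>, so the facets have the
same affine hull and the common facet \<open>R\<close>, and they are equal by induction on the dimension.
Connectedness carries this from \<open>F\<close> to all facets of \<open>P\<close>.\<close>

lemma rigid_pair_imp_subset:
  assumes "rigid_pair P Q F"
  shows "P \<subseteq> Q"
  using assms
proof (induction "nat (aff_dim P)" arbitrary: P Q F rule: less_induct)
  case less
  note rp = less.prems[unfolded rigid_pair_def]
  have P: "equiradial P" "polytope P" "perpendicular_faces P"
    and Q: "equiradial Q" "polytope Q" "perpendicular_faces Q"
    and aff: "affine hull P = affine hull Q" and sr: "same_radii P Q"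
    and F: "F facet_of P" "F facet_of Q"
    using rp equiradial_polytope by auto
  have dim: "aff_dim P = aff_dim Q" using aff by (metis aff_dim_affine_hull)
  have dim1: "aff_dim P \<ge> 1"
    using F(1) aff_dim_negative_iff[of F] by (simp add: facet_of_def)
  define \<S> where "\<S> = {G. G facet_of Q}"
  have all: "H \<in> \<S>" if H: "H facet_of P" for H
  proof (rule facets_connected_through_ridges[OF P(2) _ F(1) _ H])
    show "F \<in> \<S>" using F by (simp add: \<S>_def)
  next
    fix G H assume GS: "G \<in> \<S>" and G: "G facet_of P" and H: "H facet_of P"
      and R: "aff_dim (G \<inter> H) = aff_dim P - 2"
    define R where "R = G \<inter> H"
    have GQ: "G facet_of Q" using GS by (simp add: \<S>_def)
    have RP: "R face_of P" using G H by (simp add: R_def face_of_Int facet_of_imp_face_of)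
    have RG: "R face_of G" using RP G face_of_subset facet_of_imp_subset unfolding R_def by blast
    have RQ: "R face_of Q" using RG GQ face_of_trans facet_of_imp_face_of by blast
    have dimR: "aff_dim R = aff_dim P - 2" using R by (simp add: R_def)
    have "H \<noteq> G" using R H by (auto simp: facet_of_def)
    have convQ: "Q face_of Q" using Q(2) by (simp add: face_of_refl polytope_imp_convex)
    obtain H' where H': "H' face_of Q" "H' \<noteq> G" "R \<subseteq> H'" "aff_dim H' = aff_dim G"
      by (rule other_face_in_diamond[OF Q(1) RQ facet_of_imp_face_of[OF GQ] face_of_imp_subset[OF RG] _
            convQ facet_of_imp_subset[OF GQ]])
        (use GQ G dimR dim in \<open>auto simp: facet_of_def\<close>)
    have H'f: "H' facet_of Q"
      using H' G dim dim1 by (auto simp: facet_of_def)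
    have ne: "G \<noteq> {}" "H \<noteq> {}" "H' \<noteq> {}" using G H H'f by (auto simp: facet_of_def)
    have poly: "polytope G" "polytope H" "polytope H'"
      using P(2) Q(2) G H H'f face_of_polytope_polytope facet_of_imp_face_of by blast+
    define g h h' where "g = face_center G" and "h = face_center H" and "h' = face_center H'"
    have perp: "perpendicular_center G" "perpendicular_center H" "perpendicular_center H'"
      using P(3) Q(3) G H H'f unfolding perpendicular_faces_def
      by (metis facet_of_imp_face_of facet_of_irrefl)+
    have n1: "norm g = norm h"
      unfolding g_def h_def using equiradial_radius[OF P(1)] G H by (auto simp: facet_of_def)
    have n2: "norm h = norm h'"
      unfolding h_def h'_def using sr H H'f dim unfolding same_radii_def by (auto simp: facet_of_def)
    have "h' = g \<or> h' = h"
    proof (rule at_most_two_equidistant_points[where \<rho>="g \<bullet> g"])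
      have "h' \<in> Q"
        unfolding h'_def using face_center_in[OF poly(3) ne(3)] facet_of_imp_subset[OF H'f] by blast
      then have "h' \<in> affine hull Q" by (rule hull_inc)
      then show "h' \<in> affine hull (insert h (insert g R))"
        using affine_hull_facet_centers(2)[OF P(2) G H \<open>H \<noteq> G\<close> RP _ dimR] aff RG
        unfolding g_def h_def by (simp add: face_of_imp_subset)
      show "x \<bullet> g = g \<bullet> g \<and> x \<bullet> h = g \<bullet> g \<and> x \<bullet> h' = g \<bullet> g" if "x \<in> R" for x
        using that perp norm_eq_imp_inner[OF n1] norm_eq_imp_inner[OF n2] H'(3)
        unfolding perpendicular_center_def g_def h_def h'_def R_def by auto
      show "h \<noteq> g"
        using face_center_inj[OF P(2), of H G] H G ne \<open>H \<noteq> G\<close> unfolding g_def h_def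
        by (auto simp: facet_of_def)
    qed (use norm_eq_imp_inner[OF n1] norm_eq_imp_inner[OF n2] in auto)
    moreover have "h' \<noteq> g"
      using face_center_inj[OF Q(2), of H' G] H'f GQ ne \<open>H' \<noteq> G\<close> unfolding g_def h'_def
      by (auto simp: facet_of_def)
    ultimately have hh': "h' = h" by simp
    have RH: "R \<subseteq> H" by (simp add: R_def)
    have affH: "affine hull H = affine hull H'"
      using affine_hull_facet_centers(1)[OF P(2) H G \<open>H \<noteq> G\<close>[symmetric] RP RH dimR]
        affine_hull_facet_centers(1)[OF Q(2) H'f GQ \<open>H' \<noteq> G\<close>[symmetric] RQ H'(3)] dimR dim hh'
      unfolding h_def h'_def by simp
    \<comment> \<open>For a segment the ridge is empty, hence not a facet of anything, and the facets are single points.\<close>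
    have "H = H'"
    proof (cases "aff_dim P = 1")
      case True
      then have "aff_dim H = 0" "aff_dim H' = 0" using H H'f dim by (auto simp: facet_of_def)
      then show ?thesis using affH by (auto simp: aff_dim_eq_0)
    next
      case False
      then have Rne: "R \<noteq> {}" using dimR dim1 by auto
      have "rigid_pair H H' R"
        unfolding rigid_pair_def
      proof (intro conjI)
        show "equiradial H" "equiradial H'"
          using equiradial_face P(1) Q(1) H H'f facet_of_imp_face_of by blast+
        show "perpendicular_faces H" "perpendicular_faces H'"
          using perpendicular_faces_face P Q H H'f facet_of_imp_face_of by blast+
        show "R facet_of H" "R facet_of H'"
          using RP RQ RH H'(3) Rne dimR H H'f dim face_of_subset[OF RP RH] face_of_subset[OF RQ H'(3)]
          by (auto simp: facet_of_def face_of_imp_subset)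
        show "same_radii H H'"
          unfolding same_radii_def
        proof (intro allI impI)
          fix A B assume AB: "A face_of H" "B face_of H'" "A \<noteq> {}" "B \<noteq> {}"
            "aff_dim A = aff_dim B" "aff_dim A < aff_dim H"
          have "A face_of P" "B face_of Q" "aff_dim A < aff_dim P"
            using AB H H'f face_of_trans facet_of_imp_face_of by (blast, blast, auto simp: facet_of_def)
          then show "norm (face_center A) = norm (face_center B)"
            using AB sr unfolding same_radii_def by blast
        qed
      qed (rule affH)
      moreover have "nat (aff_dim H) < nat (aff_dim P)" "nat (aff_dim H') < nat (aff_dim P)"
        using H H'f dim dim1 by (auto simp: facet_of_def)
      ultimately show ?thesis using less.hyps rigid_pair_sym by (metis subset_antisym)
    qed
    then show "H \<in> \<S>" using H'f by (simp add: \<S>_def)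
  qed
  have "vertices P \<subseteq> Q"
  proof
    fix v assume "v \<in> vertices P"
    then have v: "{v} face_of P" by (simp add: vertices_def face_of_singleton)
    moreover have "{v} \<noteq> P" using dim1 by auto
    ultimately obtain G where "G facet_of P" "{v} \<subseteq> G"
      using face_of_polyhedron_subset_facet[OF polytope_imp_polyhedron[OF P(2)]] by blast
    then show "v \<in> Q" using all facet_of_imp_subset unfolding \<S>_def by blast
  qed
  moreover have "P = convex hull (vertices P)"
    unfolding vertices_def
    using Krein_Milman_Minkowski P(2) polytope_imp_compact polytope_imp_convex by blast
  ultimately show "P \<subseteq> Q" using Q(2) by (metis hull_minimal polytope_imp_convex)
qed

lemma rigid_pair_imp_eq:
  assumes "rigid_pair P Q F"
  shows "P = Q"
proof
  show "P \<subseteq> Q" using assms by (rule rigid_pair_imp_subset)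
  show "Q \<subseteq> P" using rigid_pair_sym[OF assms] by (rule rigid_pair_imp_subset)
qed

section \<open>Mirror symmetries\<close>

lemma face_of_imageE:
  assumes "orthogonal_transformation T" "F face_of T ` P"
  obtains F' where "F' face_of P" "F = T ` F'"
  using faces_of_linear_image[of T P] assms orthogonal_transformation_linear
    orthogonal_transformation_inj by blast

lemma face_of_image:
  assumes "orthogonal_transformation T"
  shows "T ` F face_of T ` P \<longleftrightarrow> F face_of P"
  using face_of_linear_image assms orthogonal_transformation_linear
    orthogonal_transformation_inj by blast

lemma aff_dim_image:
  assumes "orthogonal_transformation T"
  shows "aff_dim (T ` F) = aff_dim F"
  using assms orthogonal_transformation_linear orthogonal_transformation_inj
  by (intro aff_dim_injective_linear_image) blast+

lemma facet_of_image:
  assumes "orthogonal_transformation T"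
  shows "T ` F facet_of T ` P \<longleftrightarrow> F facet_of P"
  by (simp add: facet_of_def face_of_image[OF assms] aff_dim_image[OF assms])

lemma norm_face_center_image:
  assumes "orthogonal_transformation T"
  shows "norm (face_center (T ` F)) = norm (face_center F)"
  by (simp add: face_center_image[OF assms] orthogonal_transformation_norm[OF assms])

lemma affine_hull_image:
  fixes T :: "'a::euclidean_space \<Rightarrow> 'a"
  assumes "orthogonal_transformation T"
  shows "affine hull (T ` F) = T ` (affine hull F)"
proof -
  have "bounded_linear T"
    using orthogonal_transformation_linear[OF assms] by (simp add: linear_conv_bounded_linear)
  then show ?thesis using affine_hull_linear_image[of T F] by simp
qed

lemma equiradial_image:
  assumes T: "orthogonal_transformation T" and P: "equiradial P"
  shows "equiradial (T ` P)"
  unfolding equiradial_def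
proof (intro conjI allI impI)
  show "polytope (T ` P)"
    using polytope_linear_image T P orthogonal_transformation_linear equiradial_polytope by blast
next
  fix F G assume "F face_of T ` P" "G face_of T ` P" and FG: "F \<subseteq> G" "aff_dim G = aff_dim F + 2"
  then obtain F' G' where F': "F' face_of P" "F = T ` F'" and G': "G' face_of P" "G = T ` G'"
    using face_of_imageE[OF T] by metis
  have inj: "inj T" using T orthogonal_transformation_inj by blast
  let ?X = "{H. H face_of P \<and> aff_dim H = aff_dim F' + 1 \<and> F' \<subseteq> H \<and> H \<subseteq> G'}"
  have "{H. H face_of T ` P \<and> aff_dim H = aff_dim F + 1 \<and> F \<subseteq> H \<and> H \<subseteq> G} = image T ` ?X"
    (is "?L = ?R")
  proof
    show "?L \<subseteq> ?R"
    proof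
      fix H assume H: "H \<in> ?L"
      then obtain H' where "H' face_of P" "H = T ` H'" using face_of_imageE[OF T] by blast
      then show "H \<in> ?R"
        using H F' G' inj by (auto simp: aff_dim_image[OF T] inj_image_subset_iff)
    qed
    show "?R \<subseteq> ?L"
      using F' G' inj by (auto simp: aff_dim_image[OF T] face_of_image[OF T] inj_image_subset_iff)
  qed
  moreover have "inj_on (image T) ?X" using inj by (meson inj_image_eq_iff inj_onI)
  moreover have "card ?X = 2"
    using FG F' G' inj
    by (intro equiradial_diamond[OF P]) (auto simp: aff_dim_image[OF T] inj_image_subset_iff)
  ultimately show "card {H. H face_of T ` P \<and> aff_dim H = aff_dim F + 1 \<and> F \<subseteq> H \<and> H \<subseteq> G} = 2"
    by (simp add: card_image)
next
  fix F G assume FG: "F face_of T ` P" "G face_of T ` P" "F \<noteq> {}" "G \<noteq> {}" "aff_dim F = aff_dim G"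
  then obtain F' G' where F': "F' face_of P" "F = T ` F'" and G': "G' face_of P" "G = T ` G'"
    using face_of_imageE[OF T] by metis
  then have "norm (face_center F') = norm (face_center G')"
    using FG by (intro equiradial_radius[OF P]) (auto simp: aff_dim_image[OF T])
  then show "norm (face_center F) = norm (face_center G)"
    using F' G' by (simp add: norm_face_center_image[OF T])
qed

lemma perpendicular_faces_image:
  assumes T: "orthogonal_transformation T" and P: "perpendicular_faces P"
  shows "perpendicular_faces (T ` P)"
  unfolding perpendicular_faces_def
proof (intro allI impI)
  fix F assume F: "F face_of T ` P" "F \<noteq> T ` P"
  then obtain F' where F': "F' face_of P" "F = T ` F'" using face_of_imageE[OF T] by metis
  then have "perpendicular_center F'" using P F unfolding perpendicular_faces_def by blast
  then show "perpendicular_center F"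
    using T F' by (auto simp: perpendicular_center_def face_center_image[OF T] orthogonal_transformation_def)
qed

lemma same_radii_image:
  assumes T: "orthogonal_transformation T" and P: "equiradial P" and Q: "Q face_of P" "R face_of P"
  shows "same_radii (T ` Q) R"
  unfolding same_radii_def
proof (intro allI impI)
  fix F G assume FG: "F face_of T ` Q" "G face_of R" "F \<noteq> {}" "G \<noteq> {}" "aff_dim F = aff_dim G"
  then obtain F' where F': "F' face_of Q" "F = T ` F'" using face_of_imageE[OF T] by metis
  then have "norm (face_center F') = norm (face_center G)"
    using FG face_of_trans Q
    by (intro equiradial_radius[OF P]) (auto simp: aff_dim_image[OF T])
  then show "norm (face_center F) = norm (face_center G)"
    using F' by (simp add: norm_face_center_image[OF T])
qed

lemma symmetry_if_fixes_facet:
  assumes P: "equiradial P" "perpendicular_faces P"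
    and T: "orthogonal_transformation T" "T ` G = H" "T ` (affine hull P) = affine hull P"
    and G: "G facet_of P" "H facet_of P"
  shows "T ` P = P"
proof (rule rigid_pair_imp_eq)
  have "P face_of P"
    using P equiradial_polytope face_of_refl polytope_imp_convex by blast
  moreover have "H facet_of T ` P" using G(1) facet_of_image[OF T(1)] T(2) by blast
  ultimately show "rigid_pair (T ` P) P H"
    unfolding rigid_pair_def
    using P T G equiradial_image perpendicular_faces_image same_radii_image affine_hull_image
    by (metis (no_types))
qed

text \<open>The direction space of the affine hull of \<open>P\<close>, for nonempty \<open>P\<close>.\<close>

definition dirspan :: "'a::euclidean_space set \<Rightarrow> 'a set" where
  "dirspan P = span {x - y |x y. x \<in> P \<and> y \<in> P}"

lemma dirspan_eq:
  assumes "p \<in> P"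
  shows "dirspan P = span ((\<lambda>x. - p + x) ` P)"
proof
  show "dirspan P \<subseteq> span ((\<lambda>x. - p + x) ` P)"
    unfolding dirspan_def
  proof (rule span_minimal)
    show "{x - y |x y. x \<in> P \<and> y \<in> P} \<subseteq> span ((\<lambda>x. - p + x) ` P)"
    proof clarify
      fix x y assume "x \<in> P" "y \<in> P"
      then have "(- p + x) - (- p + y) \<in> span ((\<lambda>x. - p + x) ` P)"
        by (intro span_diff span_base) auto
      then show "x - y \<in> span ((\<lambda>x. - p + x) ` P)" by simp
    qed
  qed simp
  show "span ((\<lambda>x. - p + x) ` P) \<subseteq> dirspan P"
    unfolding dirspan_def
  proof (rule span_mono)
    show "(\<lambda>x. - p + x) ` P \<subseteq> {x - y |x y. x \<in> P \<and> y \<in> P}"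
      using assms by force
  qed
qed

lemma dirspan_mono: "P \<subseteq> Q \<Longrightarrow> dirspan P \<subseteq> dirspan Q"
  unfolding dirspan_def by (rule span_mono) blast

lemma affine_hull_add_dirspan:
  assumes "P \<noteq> {}" "z \<in> affine hull P" "w \<in> dirspan P"
  shows "z + w \<in> affine hull P"
proof -
  obtain p where p: "p \<in> P" using assms by blast
  have hull: "affine hull P = (\<lambda>x. p + x) ` dirspan P"
    using affine_hull_span_gen[of p P] p dirspan_eq[OF p] by (simp add: hull_inc)
  then obtain v where v: "z = p + v" "v \<in> dirspan P" using assms by auto
  then have "v + w \<in> dirspan P" using assms unfolding dirspan_def by (simp add: span_add)
  then show ?thesis unfolding hull v(1) by (auto simp: add.assoc)
qed

lemma dirspan_insert:
  assumes "affine hull P = affine hull (insert h G)" "g \<in> G" "G \<subseteq> P"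
  shows "dirspan P \<subseteq> span (insert (h - g) (dirspan G))"
proof -
  have gP: "g \<in> P" using assms by auto
  have "(\<lambda>x. - g + x) ` P \<subseteq> span (insert (h - g) (dirspan G))"
  proof clarify
    fix x assume "x \<in> P"
    then have "x \<in> affine hull (insert g (insert h G))"
      using assms(1,2) hull_inc[of x P affine] by (simp add: insert_absorb insert_commute)
    then have "- g + x \<in> span ((\<lambda>x. - g + x) ` insert h G)"
      unfolding affine_hull_insert_span_gen by auto
    also have "\<dots> \<subseteq> span (insert (h - g) (dirspan G))"
    proof (rule span_mono)
      have "(\<lambda>x. - g + x) ` G \<subseteq> dirspan G"
        unfolding dirspan_eq[OF assms(2)] by (rule span_superset)
      then show "(\<lambda>x. - g + x) ` insert h G \<subseteq> insert (h - g) (dirspan G)" by auto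
    qed
    finally show "- g + x \<in> span (insert (h - g) (dirspan G))" .
  qed
  then show ?thesis unfolding dirspan_eq[OF gP] by (intro span_minimal) auto
qed

lemma mirror_affine_hull:
  assumes "P \<noteq> {}" "b \<in> dirspan P"
  shows "mirror b ` (affine hull P) = affine hull P"
proof -
  have sub: "mirror b ` (affine hull P) \<subseteq> affine hull P"
  proof clarify
    fix x assume x: "x \<in> affine hull P"
    have "- (2 * (x \<bullet> b) / (b \<bullet> b)) *\<^sub>R b \<in> dirspan P"
      using assms(2) unfolding dirspan_def by (rule span_scale)
    then have "x + - (2 * (x \<bullet> b) / (b \<bullet> b)) *\<^sub>R b \<in> affine hull P"
      by (rule affine_hull_add_dirspan[OF assms(1) x])
    then show "mirror b x \<in> affine hull P" by (simp add: mirror_def)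
  qed
  moreover have "x \<in> mirror b ` (affine hull P)" if "x \<in> affine hull P" for x
    using sub that mirror_involution[of b x] by (metis image_eqI image_subset_iff)
  ultimately show ?thesis by blast
qed

lemma mirror_extends_from_facet:
  assumes "equiradial P" "perpendicular_faces P" "G facet_of P"
    and "b \<in> dirspan G" "mirror b ` G = G"
  shows "mirror b ` P = P"
proof (rule symmetry_if_fixes_facet[OF assms(1,2) orthogonal_transformation_mirror assms(5) _ assms(3,3)])
  have "G \<subseteq> P" "P \<noteq> {}" using assms(3) facet_of_imp_subset by (auto simp: facet_of_def)
  then show "mirror b ` (affine hull P) = affine hull P"
    using mirror_affine_hull dirspan_mono assms(4) by blast
qed

text \<open>The reflection fixes the common ridge pointwise and exchanges the centers. Hence it carries \<open>G\<close> to a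
polytope with the affine hull of \<open>H\<close> and the common facet \<open>R\<close>, which rigidity identifies with \<open>H\<close>; then
\<open>P\<close> and its image share the facet \<open>H\<close>.\<close>

lemma mirror_swaps_adjacent_facets:
  assumes P: "equiradial P" "perpendicular_faces P"
    and G: "G facet_of P" and H: "H facet_of P" "H \<noteq> G"
    and R: "R face_of P" "R \<subseteq> G" "R \<subseteq> H" "aff_dim R = aff_dim P - 2"
  shows "mirror (face_center H - face_center G) ` P = P"
proof -
  define g h where "g = face_center G" and "h = face_center H"
  let ?T = "mirror (h - g)"
  have T: "orthogonal_transformation ?T" by (rule orthogonal_transformation_mirror)
  have pP: "polytope P" using P equiradial_polytope by blast
  have GP: "G face_of P" "H face_of P" using G H facet_of_imp_face_of by blast+
  have ne: "G \<noteq> {}" "H \<noteq> {}" using G H by (auto simp: facet_of_def)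
  have dims: "aff_dim G = aff_dim P - 1" "aff_dim H = aff_dim P - 1"
    using G H by (auto simp: facet_of_def)
  have perp: "perpendicular_center G" "perpendicular_center H"
    using P(2) G H GP unfolding perpendicular_faces_def by (metis facet_of_irrefl)+
  have n: "g \<bullet> g = h \<bullet> h"
    unfolding g_def h_def using equiradial_radius[OF P(1) GP ne] dims norm_eq_imp_inner by simp
  have Tg: "?T g = h" "?T h = g" using n by (simp_all add: mirror_swaps mirror_swaps')
  have TR: "?T x = x" if "x \<in> R" for x
  proof (rule mirror_fixes)
    have "x \<bullet> g = g \<bullet> g" "x \<bullet> h = h \<bullet> h"
      using that perp R unfolding perpendicular_center_def g_def h_def by blast+
    then show "x \<bullet> (h - g) = 0" using n by (simp add: inner_diff_right)
  qed
  have TR': "?T ` R = R" using TR by force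
  have affG: "affine hull (insert g R) = affine hull G" "affine hull (insert h R) = affine hull H"
    "affine hull (insert h (insert g R)) = affine hull P"
    unfolding g_def h_def
    using affine_hull_facet_centers[OF pP G H R(1,2,4)]
      affine_hull_facet_centers[OF pP H(1) G H(2)[symmetric] R(1,3,4)] by auto
  have affTG: "affine hull (?T ` G) = affine hull H"
    using affine_hull_image[OF T, of "insert g R"] affG Tg TR' affine_hull_image[OF T, of G]
    by simp
  have "?T ` G = H"
  proof (cases "aff_dim G = 0")
    case True
    then have "aff_dim (?T ` G) = 0" "aff_dim H = 0" using dims aff_dim_image[OF T] by auto
    then obtain a a' where "?T ` G = {a}" "H = {a'}" by (metis aff_dim_eq_0)
    then show ?thesis using affTG by simp
  next
    case False
    have "aff_dim G \<ge> 0" using ne aff_dim_negative_iff[of G] by linarith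
    then have Rne: "R \<noteq> {}" using False R(4) dims by auto
    have RG: "R facet_of G" "R facet_of H"
      using face_of_subset[OF R(1,2) face_of_imp_subset[OF GP(1)]]
        face_of_subset[OF R(1,3) face_of_imp_subset[OF GP(2)]] R(4) Rne dims by (simp_all add: facet_of_def)
    have RTG: "R facet_of ?T ` G" using RG(1) facet_of_image[OF T] TR' by metis
    show ?thesis
    proof (rule rigid_pair_imp_eq)
      show "rigid_pair (?T ` G) H R"
        unfolding rigid_pair_def
        using RTG RG affTG same_radii_image[OF T P(1) GP] equiradial_face[OF P(1)] GP
          perpendicular_faces_face[OF pP P(2)] equiradial_image[OF T] perpendicular_faces_image[OF T]
        by simp
    qed
  qed
  moreover have "?T ` (affine hull P) = affine hull P"
    using affine_hull_image[OF T, of "insert h (insert g R)"] affG Tg TR'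
    by (simp add: insert_commute)
  ultimately show ?thesis
    using symmetry_if_fixes_facet[OF P T _ _ G H(1)] unfolding g_def h_def by blast
qed

text \<open>The barycenter is fixed by every symmetry, hence orthogonal to the vectors of all mirrors.\<close>

lemma perpendicular_center_if_mirrors_span:
  assumes "polytope P" "P \<noteq> {}" and span: "dirspan P \<subseteq> span {b. mirror b ` P = P}"
  shows "perpendicular_center P"
proof -
  define c where "c = face_center P"
  have cP: "c \<in> P" unfolding c_def using face_center_in assms by blast
  have orth: "orthogonal c b" if "mirror b ` P = P" for b
  proof -
    have "mirror b c = c"
      using face_center_image[OF orthogonal_transformation_mirror, of b P] that by (simp add: c_def)
    then show ?thesis by (auto simp: mirror_eq_self_iff orthogonal_def)
  qed
  have "x \<bullet> c = c \<bullet> c" if "x \<in> P" for x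
  proof -
    have "x - c \<in> dirspan P" unfolding dirspan_def by (rule span_base) (use that cP in blast)
    then have "orthogonal c (x - c)"
      using orthogonal_to_span[of "x - c" "{b. mirror b ` P = P}" c] orth span by blast
    then show ?thesis by (simp add: orthogonal_def inner_diff_right inner_commute)
  qed
  then show ?thesis by (simp add: perpendicular_center_def c_def)
qed

text \<open>The mirrors of a facet extend to \<open>P\<close>, and the mirror between that facet and a neighbour contributes the
missing direction. Rigidity presupposes perpendicular centers of the proper faces; these come from the
induction hypothesis through \<open>perpendicular_center_if_mirrors_span\<close>.\<close>

lemma equiradial_mirrors_span:
  assumes "equiradial P" "P \<noteq> {}"
  shows "dirspan P \<subseteq> span {b \<in> dirspan P. mirror b ` P = P}"
  using assms
proof (induction "nat (aff_dim P)" arbitrary: P rule: less_induct)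
  case less
  have pP: "polytope P" using less.prems equiradial_polytope by blast
  have cP: "convex P" using pP by (rule polytope_imp_convex)
  show ?case
  proof (cases "aff_dim P = 0")
    case True
    then obtain a where "P = {a}" by (auto simp: aff_dim_eq_0)
    then have "dirspan P = {0}" by (simp add: dirspan_def)
    then show ?thesis by (simp add: span_zero)
  next
    case False
    then have d: "aff_dim P \<ge> 1" using less.prems(2) aff_dim_negative_iff[of P] by linarith
    have IH: "dirspan F \<subseteq> span {b \<in> dirspan F. mirror b ` F = F}"
      if F: "F face_of P" "F \<noteq> P" "F \<noteq> {}" for F
    proof (rule less.hyps)
      show "nat (aff_dim F) < nat (aff_dim P)"
        using face_of_aff_dim_lt[OF cP F(1,2)] d by linarith
    qed (use F equiradial_face less.prems in auto)
    have perp: "perpendicular_faces P"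
      unfolding perpendicular_faces_def
    proof (intro allI impI)
      fix F assume F: "F face_of P" "F \<noteq> P"
      show "perpendicular_center F"
      proof (cases "F = {}")
        case True
        then show ?thesis by (simp add: perpendicular_center_def)
      next
        case False
        have "dirspan F \<subseteq> span {b. mirror b ` F = F}"
          using IH[OF F False] span_mono[of "{b \<in> dirspan F. mirror b ` F = F}" "{b. mirror b ` F = F}"]
          by blast
        then show ?thesis
          using perpendicular_center_if_mirrors_span F False pP face_of_polytope_polytope by blast
      qed
    qed
    obtain G where G: "G facet_of P" using polytope_facet_exists[OF pP] d by auto
    have GP: "G face_of P" "G \<noteq> P" "G \<noteq> {}" "G \<subseteq> P"
      using G facet_of_imp_subset[OF G] by (auto simp: facet_of_def)
    have pG: "polytope G" using GP pP face_of_polytope_polytope by blast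
    obtain R where R: "R face_of G" "aff_dim R = aff_dim G - 1"
    proof (cases "aff_dim G > 0")
      case True
      then show ?thesis using that polytope_facet_exists[OF pG] by (metis facet_of_def)
    next
      case False
      have "aff_dim G \<ge> 0" using GP aff_dim_negative_iff[of G] by linarith
      then show ?thesis using False that[of "{}"] by simp
    qed
    have RP: "R face_of P" "R \<subseteq> G" using R GP face_of_trans face_of_imp_subset by blast+
    have PP: "P face_of P" using cP by (rule face_of_refl)
    obtain H where H: "H face_of P" "H \<noteq> G" "R \<subseteq> H" "H \<subseteq> P" "aff_dim H = aff_dim G"
      by (rule other_face_in_diamond[OF less.prems(1) RP(1) GP(1) RP(2) _ PP GP(4)])
        (use R(2) G in \<open>auto simp: facet_of_def\<close>)
    have "aff_dim G \<ge> 0" using GP aff_dim_negative_iff[of G] by linarith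
    then have Hf: "H facet_of P" using H G by (auto simp: facet_of_def)
    have dimR: "aff_dim R = aff_dim P - 2" using R G by (simp add: facet_of_def)
    define g h where "g = face_center G" and "h = face_center H"
    have gG: "g \<in> G" unfolding g_def using face_center_in pG GP by blast
    have hP: "h \<in> P"
      unfolding h_def using face_center_in[of H] H Hf pP face_of_polytope_polytope
      by (metis facet_of_def subsetD)
    define B where "B = {b \<in> dirspan P. mirror b ` P = P}"
    have "h - g \<in> dirspan P"
      unfolding dirspan_def by (rule span_base) (use gG hP GP in blast)
    moreover have "mirror (h - g) ` P = P"
      unfolding g_def h_def
      by (rule mirror_swaps_adjacent_facets[OF less.prems(1) perp G Hf H(2) RP H(3) dimR])
    ultimately have "h - g \<in> span B" unfolding B_def by (simp add: span_base)
    moreover have "dirspan G \<subseteq> span B"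
    proof -
      have "{b \<in> dirspan G. mirror b ` G = G} \<subseteq> B"
        unfolding B_def using mirror_extends_from_facet[OF less.prems(1) perp G] dirspan_mono[OF GP(4)]
        by blast
      then show ?thesis using IH[OF GP(1-3)] span_mono by blast
    qed
    ultimately have "span (insert (h - g) (dirspan G)) \<subseteq> span B"
      by (intro span_minimal) auto
    moreover have "affine hull P = affine hull (insert h G)"
      using affine_hull_facet_centers[OF pP G Hf H(2) RP dimR]
        affine_hull_insert_cong[of "insert g R" G h] unfolding g_def h_def by simp
    ultimately show ?thesis using dirspan_insert[OF _ gG GP(4)] unfolding B_def by blast
  qed
qed

lemma equiradial_perpendicular_center:
  assumes "equiradial P" "P \<noteq> {}"
  shows "perpendicular_center P"
  using perpendicular_center_if_mirrors_span[of P] equiradial_mirrors_span[OF assms]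
    span_mono[of "{b \<in> dirspan P. mirror b ` P = P}" "{b. mirror b ` P = P}"] equiradial_polytope assms
  by blast

lemma equiradial_perpendicular_faces:
  assumes "equiradial P"
  shows "perpendicular_faces P"
  unfolding perpendicular_faces_def
proof (intro allI impI)
  fix F assume "F face_of P" "F \<noteq> P"
  then show "perpendicular_center F"
    using equiradial_face[OF assms] equiradial_perpendicular_center
    by (cases "F = {}") (auto simp: perpendicular_center_def)
qed

text \<open>The center of a facet \<open>G\<close> defines a supporting hyperplane: its level set in the affine hull of \<open>P\<close> is the
affine hull of \<open>G\<close>, and the barycenter of \<open>P\<close> lies strictly below it, being closer to the origin.\<close>

lemma face_center_supports:
  assumes P: "equiradial P" and G: "G facet_of P" and x: "x \<in> P"
  shows "x \<bullet> face_center G \<le> face_center G \<bullet> face_center G"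
    and "x \<bullet> face_center G = face_center G \<bullet> face_center G \<longleftrightarrow> x \<in> G"
proof -
  define g c where "g = face_center G" and "c = face_center P"
  have pP: "polytope P" using P equiradial_polytope by blast
  have GP: "G face_of P" "G \<noteq> P" "G \<noteq> {}" "G \<subseteq> P"
    using G facet_of_imp_subset[OF G] by (auto simp: facet_of_def)
  have Pne: "P \<noteq> {}" using x by auto
  have pG: "polytope G" using GP pP face_of_polytope_polytope by blast
  have gG: "g \<in> G" unfolding g_def using face_center_in pG GP by blast
  have cG: "c \<notin> G" unfolding c_def using face_center_notin_face pP GP Pne by blast
  have cP: "c \<in> P" unfolding c_def using face_center_in pP Pne by blast
  have perpG: "y \<bullet> g = g \<bullet> g" if "y \<in> G" for y
    using equiradial_perpendicular_center[OF equiradial_face[OF P GP(1)] GP(3)] that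
    by (simp add: perpendicular_center_def g_def)
  have perpP: "y \<bullet> c = c \<bullet> c" if "y \<in> P" for y
    using equiradial_perpendicular_center[OF P Pne] that
    by (simp add: perpendicular_center_def c_def)
  have "(g - c) \<bullet> (g - c) > 0" using gG cG by auto
  moreover have gc: "g \<bullet> c = c \<bullet> c" using perpP gG GP by blast
  ultimately have neg: "c \<bullet> g < g \<bullet> g" by (simp add: inner_diff inner_commute)
  have hull: "affine hull G = affine hull G \<inter> {y. y \<bullet> g = g \<bullet> g}"
  proof -
    have "g \<bullet> y = g \<bullet> g" if "y \<in> G" for y using perpG[OF that] by (simp add: inner_commute)
    then have "affine hull G \<subseteq> {y. g \<bullet> y = g \<bullet> g}"
      by (intro hull_minimal affine_hyperplane) blast
    then show ?thesis by (auto simp: inner_commute)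
  qed
  have hull2: "y \<in> affine hull G" if y: "y \<in> P" "y \<bullet> g = g \<bullet> g" for y
  proof -
    have "affine hull (insert c G) = affine hull P"
      by (rule affine_hull_insert_facet[OF pP GP(1) _ cP cG]) (use G in \<open>simp add: facet_of_def\<close>)
    then have "y \<in> affine hull (insert g (insert c G))"
      using y hull_inc[of y P affine] gG by (simp add: insert_absorb insert_commute)
    then have "y - g \<in> span ((\<lambda>x. - g + x) ` insert c G)"
      unfolding affine_hull_insert_span_gen by auto
    then obtain k where k: "y - g - k *\<^sub>R (- g + c) \<in> span ((\<lambda>x. - g + x) ` G)"
      by (auto simp: span_insert)
    have aff: "affine hull G = (\<lambda>x. g + x) ` span ((\<lambda>x. - g + x) ` G)"
      using affine_hull_span_gen[of g G] gG by (simp add: hull_inc)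
    have "g + (y - g - k *\<^sub>R (- g + c)) \<in> affine hull G" unfolding aff using k by blast
    then have "(g + (y - g - k *\<^sub>R (- g + c))) \<bullet> g = g \<bullet> g" using hull by blast
    then have "k * (c \<bullet> g - g \<bullet> g) = 0" using y by (auto simp: algebra_simps)
    then have "k = 0" using neg by simp
    then show ?thesis using k aff by (auto intro!: image_eqI[of _ _ "y - g"])
  qed
  have eq: "y \<bullet> g = g \<bullet> g \<longleftrightarrow> y \<in> G" if "y \<in> P" for y
    using hull2[OF that] perpG face_of_imp_eq_affine_Int[OF polytope_imp_convex[OF pP] GP(1)] that by blast
  have "\<not> x \<bullet> g > g \<bullet> g"
  proof
    assume gt: "x \<bullet> g > g \<bullet> g"
    define t where "t = (g \<bullet> g - c \<bullet> g) / (x \<bullet> g - c \<bullet> g)"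
    have t: "0 < t" "t < 1" using gt neg by (auto simp: t_def field_simps)
    define y where "y = (1 - t) *\<^sub>R c + t *\<^sub>R x"
    have "c \<noteq> x" using gt neg by auto
    then have os: "y \<in> open_segment c x" using t unfolding y_def in_segment by auto
    then have yP: "y \<in> P"
      using cP x polytope_imp_convex[OF pP] convex_contains_open_segment by blast
    have "y \<bullet> g = c \<bullet> g + t * (x \<bullet> g - c \<bullet> g)" by (simp add: y_def inner_add_left algebra_simps)
    also have "\<dots> = g \<bullet> g" using gt neg by (simp add: t_def)
    finally have "y \<in> G" using eq yP by blast
    then have "c \<in> G" using face_ofD[OF GP(1) os cP x] by blast
    then show False using cG by blast
  qed
  then show "x \<bullet> face_center G \<le> face_center G \<bullet> face_center G" by (simp add: g_def)
  show "x \<bullet> face_center G = face_center G \<bullet> face_center G \<longleftrightarrow> x \<in> G"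
    using eq[OF x] by (simp add: g_def)
qed

section \<open>Chains of mirrors\<close>

lemma dual_family_spans:
  fixes a b :: "nat \<Rightarrow> 'a::euclidean_space"
  assumes "\<And>i j. i < DIM('a) \<Longrightarrow> j < DIM('a) \<Longrightarrow> i \<noteq> j \<Longrightarrow> a i \<bullet> b j = 0"
    and "\<And>i. i < DIM('a) \<Longrightarrow> a i \<bullet> b i \<noteq> 0"
  shows "span (b ` {..<DIM('a)}) = UNIV"
proof -
  let ?I = "{..<DIM('a)}"
  have inj: "inj_on b ?I"
    by (rule inj_onI) (metis assms lessThan_iff)
  have "independent (b ` ?I)"
    unfolding dependent_def
  proof
    assume "\<exists>y\<in>b ` ?I. y \<in> span (b ` ?I - {y})"
    then obtain i where i: "i \<in> ?I" and "b i \<in> span (b ` ?I - {b i})" by blast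
    then have "orthogonal (a i) (b i)"
      using assms(1) by (elim orthogonal_to_span) (auto simp: orthogonal_def)
    then show False using assms(2) i by (auto simp: orthogonal_def)
  qed
  then have "dim (b ` ?I) = DIM('a)"
    using dim_eq_card_independent card_image[OF inj] by fastforce
  then show ?thesis using dim_eq_full by blast
qed

lemma zero_if_orthogonal_to_spanning:
  assumes "span S = UNIV" "\<And>y. y \<in> S \<Longrightarrow> x \<bullet> y = 0"
  shows "x = (0::'a::euclidean_space)"
proof -
  have "orthogonal x x"
    using assms by (intro orthogonal_to_span[of x S x]) (auto simp: orthogonal_def)
  then show ?thesis by (simp add: orthogonal_def)
qed

text \<open>An injective walk along a path cannot turn back.\<close>

lemma path_embedding_cases:
  fixes \<tau> :: "nat \<Rightarrow> nat"
  assumes range: "\<And>i. i < n \<Longrightarrow> \<tau> i < n"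
    and inj: "\<And>i j. i < n \<Longrightarrow> j < n \<Longrightarrow> \<tau> i = \<tau> j \<Longrightarrow> i = j"
    and adj: "\<And>i. i + 1 < n \<Longrightarrow> \<tau> (i + 1) = \<tau> i + 1 \<or> \<tau> i = \<tau> (i + 1) + 1"
  shows "(\<forall>i<n. \<tau> i = i) \<or> (\<forall>i<n. \<tau> i = n - 1 - i)"
proof (cases "n \<ge> 2")
  case False
  then show ?thesis using range by (metis One_nat_def Suc_1 diff_is_0_eq less_2_cases_iff
        less_Suc_eq less_one not_less_eq_eq leD leI zero_diff)
next
  case True
  define e where "e = int (\<tau> 1) - int (\<tau> 0)"
  have step: "int (\<tau> (i + 1)) - int (\<tau> i) = e" if "i + 1 < n" for i
    using that
  proof (induction i)
    case 0
    then show ?case by (simp add: e_def)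
  next
    case (Suc i)
    have "\<tau> (i + 2) \<noteq> \<tau> i" using inj[of "i + 2" i] Suc.prems by auto
    then show ?case using Suc adj[of i] adj[of "i + 1"] by auto
  qed
  have lin: "int (\<tau> i) = int (\<tau> 0) + int i * e" if "i < n" for i
    using that
  proof (induction i)
    case (Suc i)
    then have "int (\<tau> (Suc i)) = int (\<tau> i) + e" using step[of i] by simp
    also have "\<dots> = int (\<tau> 0) + int i * e + e" using Suc by simp
    finally show ?case by (simp add: algebra_simps)
  qed simp
  have "e = 1 \<or> e = -1" using adj[of 0] True by (auto simp: e_def)
  then show ?thesis
  proof
    assume e: "e = 1"
    then have "\<tau> 0 = 0" using lin[of "n - 1"] range[of "n - 1"] True by auto
    then show ?thesis using lin e by auto
  next
    assume e: "e = -1"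
    have "\<tau> 0 = n - 1" using e lin[of "n - 1"] range[of 0] True by auto
    have "\<tau> i = n - 1 - i" if "i < n" for i
      using lin[OF that] e \<open>\<tau> 0 = n - 1\<close> that by simp
    then show ?thesis by blast
  qed
qed

text \<open>This records what a flag of a regular polytope with vertex set \<open>V\<close> provides. The \<open>\<alpha> i\<close> are the unit
normals of the walls of the cone generated by the \<open>f i\<close>. By \<open>chamber\<close> no mirror of \<open>V\<close> cuts the interior of
this cone, and by \<open>dominant\<close> the cone contains no point of \<open>V\<close> except \<open>f 0\<close>.\<close>

locale mirror_chain =
  fixes n :: nat and V :: "'a::euclidean_space set" and \<alpha> f :: "nat \<Rightarrow> 'a"
  assumes dim: "n = DIM('a)"
    and finV: "finite V" and spanV: "span V = UNIV"
    and unit: "\<And>i. i < n \<Longrightarrow> \<alpha> i \<bullet> \<alpha> i = 1"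
    and dual: "\<And>i j. i < n \<Longrightarrow> j < n \<Longrightarrow> i \<noteq> j \<Longrightarrow> \<alpha> i \<bullet> f j = 0"
    and dual_pos: "\<And>i. i < n \<Longrightarrow> 0 < \<alpha> i \<bullet> f i"
    and far: "\<And>i j. i + 1 < j \<Longrightarrow> j < n \<Longrightarrow> \<alpha> i \<bullet> \<alpha> j = 0"
    and near: "\<And>i. i + 1 < n \<Longrightarrow> \<alpha> i \<bullet> \<alpha> (i + 1) < 0"
    and sym: "\<And>i. i < n \<Longrightarrow> mirror (\<alpha> i) ` V = V"
    and chamber: "\<And>\<gamma>. mirror \<gamma> ` V = V \<Longrightarrow>
       (\<forall>i<n. 0 \<le> \<gamma> \<bullet> f i) \<or> (\<forall>i<n. \<gamma> \<bullet> f i \<le> 0)"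
    and base: "f 0 \<in> V"
    and dominant: "\<And>u. u \<in> V \<Longrightarrow> (\<And>i. i < n \<Longrightarrow> 0 \<le> u \<bullet> \<alpha> i) \<Longrightarrow> u = f 0"
begin

lemma mirror_unit: "i < n \<Longrightarrow> mirror (\<alpha> i) x = x - (2 * (x \<bullet> \<alpha> i)) *\<^sub>R \<alpha> i"
  by (simp add: mirror_def unit)

lemma span_f: "span (f ` {..<n}) = UNIV"
  unfolding dim using dual dual_pos
  by (intro dual_family_spans[of \<alpha>]) (auto simp: dim less_le)

lemma span_\<alpha>: "span (\<alpha> ` {..<n}) = UNIV"
  unfolding dim using dual dual_pos
  by (intro dual_family_spans[of f]) (auto simp: dim less_le inner_commute)

text \<open>The coordinates with respect to the basis \<open>\<alpha>\<close>, read off by means of the dual family \<open>f\<close>.\<close>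

definition co :: "nat \<Rightarrow> 'a \<Rightarrow> real" where
  "co k x = (x \<bullet> f k) / (\<alpha> k \<bullet> f k)"

lemma co_diff: "co k (x - y) = co k x - co k y"
  and co_scale: "co k (r *\<^sub>R x) = r * co k x"
  and co_minus: "co k (- x) = - co k x"
  by (simp_all add: co_def inner_diff_left diff_divide_distrib)

lemma co_\<alpha>: "i < n \<Longrightarrow> k < n \<Longrightarrow> co k (\<alpha> i) = (if k = i then 1 else 0)"
  using dual[of i k] dual_pos[of k] by (auto simp: co_def)

lemma inner_f_sum: "k < n \<Longrightarrow> (\<Sum>i<n. a i *\<^sub>R \<alpha> i) \<bullet> f k = a k * (\<alpha> k \<bullet> f k)"
proof -
  assume k: "k < n"
  have "(\<Sum>i<n. a i *\<^sub>R \<alpha> i) \<bullet> f k = (\<Sum>i<n. a i * (\<alpha> i \<bullet> f k))"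
    by (simp add: inner_sum_left)
  also have "\<dots> = (\<Sum>i<n. if i = k then a k * (\<alpha> k \<bullet> f k) else 0)"
    by (rule sum.cong) (auto simp: dual k)
  finally show ?thesis using k by simp
qed

lemma expansion: "x = (\<Sum>i<n. co i x *\<^sub>R \<alpha> i)"
proof -
  have "x - (\<Sum>i<n. co i x *\<^sub>R \<alpha> i) = 0"
  proof (rule zero_if_orthogonal_to_spanning[OF span_f])
    fix y assume "y \<in> f ` {..<n}"
    then obtain k where k: "k < n" "y = f k" by auto
    then show "(x - (\<Sum>i<n. co i x *\<^sub>R \<alpha> i)) \<bullet> y = 0"
      using dual_pos[of k] by (simp add: inner_diff_left inner_f_sum co_def)
  qed
  then show ?thesis by simp
qed

lemma linear_expansion:
  assumes "linear L"
  shows "L x = (\<Sum>i<n. co i x *\<^sub>R L (\<alpha> i))"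
proof -
  have "L x = L (\<Sum>i<n. co i x *\<^sub>R \<alpha> i)" by (rule arg_cong[OF expansion])
  then show ?thesis by (simp add: linear_sum[OF assms] linear_scale[OF assms])
qed

text \<open>The cosine of the angle between the walls \<open>i\<close> and \<open>i + 1\<close>: it is \<open>1/2\<close> for an edge of the Coxeter diagram
labelled \<open>3\<close> and \<open>1/sqrt 2\<close> for one labelled \<open>4\<close>.\<close>

definition c :: "nat \<Rightarrow> real" where "c i = - (\<alpha> i \<bullet> \<alpha> (i + 1))"

lemma c_pos: "i + 1 < n \<Longrightarrow> 0 < c i"
  using near by (simp add: c_def)

lemma gram:
  assumes "i < n" "k < n"
  shows "\<alpha> i \<bullet> \<alpha> k =
    (if i = k then 1 else 0) - (if i + 1 = k then c i else 0) - (if i = k + 1 then c k else 0)"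
proof -
  consider "i = k" | "i + 1 = k" | "i = k + 1" | "i + 1 < k" | "k + 1 < i" by linarith
  then show ?thesis
    using assms unit far[of i k] far[of k i]
    by cases (auto simp: c_def inner_commute)
qed

lemma inner_\<alpha>_sum:
  assumes k: "k < n"
  shows "(\<Sum>i<n. a i *\<^sub>R \<alpha> i) \<bullet> \<alpha> k =
    a k - (if k = 0 then 0 else c (k - 1) * a (k - 1)) - (if k + 1 < n then c k * a (k + 1) else 0)"
proof -
  have "(\<Sum>i<n. a i *\<^sub>R \<alpha> i) \<bullet> \<alpha> k = (\<Sum>i<n. a i * (\<alpha> i \<bullet> \<alpha> k))"
    by (simp add: inner_sum_left)
  also have "\<dots> = (\<Sum>i<n. (if i = k then a k else 0) - (if i + 1 = k then c (k - 1) * a (k - 1) else 0)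
      - (if i = k + 1 then c k * a (k + 1) else 0))"
    by (rule sum.cong) (auto simp: gram k)
  also have "\<dots> = a k - (\<Sum>i<n. if i + 1 = k then c (k - 1) * a (k - 1) else 0)
      - (if k + 1 < n then c k * a (k + 1) else 0)"
    using k by (simp add: sum_subtractf)
  also have "(\<Sum>i<n. if i + 1 = k then c (k - 1) * a (k - 1) else 0)
      = (if k = 0 then 0 else c (k - 1) * a (k - 1))"
    using k by (cases k) auto
  finally show ?thesis .
qed

lemma inner_\<alpha>:
  assumes k: "k < n"
  shows "x \<bullet> \<alpha> k = co k x - (if k = 0 then 0 else c (k - 1) * co (k - 1) x)
    - (if k + 1 < n then c k * co (k + 1) x else 0)"
proof -
  have "x \<bullet> \<alpha> k = (\<Sum>i<n. co i x *\<^sub>R \<alpha> i) \<bullet> \<alpha> k"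
    by (rule arg_cong[OF expansion])
  then show ?thesis by (simp only: inner_\<alpha>_sum[OF k])
qed

text \<open>The hypotheses say that \<open>x = (\<Sum>i<n. a i *\<^sub>R \<alpha> i)\<close> has nonpositive inner product with every \<open>\<alpha> k\<close> in its
support, so \<open>x \<bullet> x \<le> 0\<close>, although \<open>x\<close> is nonzero.\<close>

lemma no_subharmonic_vector:
  assumes a: "\<And>k. k < n \<Longrightarrow> 0 \<le> a k" and k0: "k0 < n" "0 < a k0"
    and sub: "\<And>k. k < n \<Longrightarrow> 0 < a k \<Longrightarrow>
      a k \<le> (if k = 0 then 0 else c (k - 1) * a (k - 1)) + (if k + 1 < n then c k * a (k + 1) else 0)"
  shows False
proof -
  define x where "x = (\<Sum>i<n. a i *\<^sub>R \<alpha> i)"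
  have "a k * (x \<bullet> \<alpha> k) \<le> 0" if k: "k < n" for k
  proof (cases "a k = 0")
    case False
    then have pos: "0 < a k" using a[OF k] by simp
    then have "x \<bullet> \<alpha> k \<le> 0" using sub[OF k pos] inner_\<alpha>_sum[OF k, of a] unfolding x_def by linarith
    then show ?thesis using pos by (simp add: mult_le_0_iff)
  qed simp
  moreover have "x \<bullet> x = (\<Sum>i<n. a i * (x \<bullet> \<alpha> i))"
    using inner_sum_right[of x "\<lambda>i. a i *\<^sub>R \<alpha> i" "{..<n}"] by (simp flip: x_def)
  ultimately have "x \<bullet> x \<le> 0" using sum_nonpos[of "{..<n}" "\<lambda>i. a i * (x \<bullet> \<alpha> i)"] by simp
  then have "x = 0" using inner_gt_zero_iff[of x] by linarith
  then show False using inner_f_sum[OF k0(1), of a] k0 dual_pos[of k0] unfolding x_def by simp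
qed

definition \<xi> :: 'a where "\<xi> = (\<Sum>i<n. f i)"

lemma \<xi>: "i < n \<Longrightarrow> 0 < \<alpha> i \<bullet> \<xi>"
proof -
  assume i: "i < n"
  have "\<alpha> i \<bullet> \<xi> = (\<Sum>j<n. if j = i then \<alpha> i \<bullet> f i else 0)"
    unfolding \<xi>_def inner_sum_right by (rule sum.cong) (use dual i in auto)
  then show ?thesis using i dual_pos by simp
qed

text \<open>A point of \<open>V\<close> outside the cone lies behind some wall. Reflecting it there increases its inner product
with the vector \<open>\<xi>\<close> interior to the cone, and the process can only stop at \<open>f 0\<close>.\<close>

lemma orbit_induct:
  assumes "f 0 \<in> X" and step: "\<And>x i. x \<in> X \<Longrightarrow> i < n \<Longrightarrow> mirror (\<alpha> i) x \<in> X"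
  shows "V \<subseteq> X"
proof (rule ccontr)
  assume "\<not> V \<subseteq> X"
  define m where "m = Max ((\<lambda>u. u \<bullet> \<xi>) ` (V - X))"
  have "m \<in> (\<lambda>u. u \<bullet> \<xi>) ` (V - X)"
    unfolding m_def using finV \<open>\<not> V \<subseteq> X\<close> by (intro Max_in) auto
  then obtain u where u: "u \<in> V" "u \<notin> X" "m = u \<bullet> \<xi>" by auto
  have max: "v \<bullet> \<xi> \<le> u \<bullet> \<xi>" if "v \<in> V" "v \<notin> X" for v
    using that u(3) finV unfolding m_def by (metis Diff_iff Max_ge finite_Diff finite_imageI imageI)
  have "u \<noteq> f 0" using u assms(1) by auto
  then obtain i where i: "i < n" "u \<bullet> \<alpha> i < 0" using dominant[OF u(1)] by fastforce
  let ?v = "mirror (\<alpha> i) u"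
  have v: "?v \<in> V" using sym[OF i(1)] u(1) by blast
  have "?v \<bullet> \<xi> = u \<bullet> \<xi> - 2 * (u \<bullet> \<alpha> i) * (\<alpha> i \<bullet> \<xi>)"
    using i(1) by (simp add: mirror_unit inner_diff_left)
  moreover have "(u \<bullet> \<alpha> i) * (\<alpha> i \<bullet> \<xi>) < 0" using i \<xi> by (simp add: mult_less_0_iff)
  ultimately have "?v \<bullet> \<xi> > u \<bullet> \<xi>" by simp
  then have "?v \<in> X" using max[OF v] by force
  then have "mirror (\<alpha> i) ?v \<in> X" using step i(1) by blast
  then show False using u(2) by simp
qed

lemma transitive:
  assumes "u \<in> V"
  obtains T where "orthogonal_transformation T" "T ` V = V" "T (f 0) = u"
proof -
  define X where "X = {u. \<exists>T. orthogonal_transformation T \<and> T ` V = V \<and> T (f 0) = u}"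
  have "V \<subseteq> X"
  proof (rule orbit_induct)
    show "f 0 \<in> X" unfolding X_def by (auto intro!: exI[of _ "\<lambda>x. x"])
  next
    fix x i assume "x \<in> X" "i < n"
    then obtain T where T: "orthogonal_transformation T" "T ` V = V" "T (f 0) = x"
      by (auto simp: X_def)
    have "orthogonal_transformation (mirror (\<alpha> i) \<circ> T)"
      using T orthogonal_transformation_mirror orthogonal_transformation_compose by blast
    moreover have "(mirror (\<alpha> i) \<circ> T) ` V = V" using T sym[OF \<open>i < n\<close>] by (metis image_comp)
    ultimately show "mirror (\<alpha> i) x \<in> X" using T unfolding X_def by (metis (mono_tags) comp_apply mem_Collect_eq)
  qed
  then show ?thesis using assms that by (auto simp: X_def)
qed

inductive_set W :: "('a \<Rightarrow> 'a) set" where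
  W_id: "(\<lambda>x. x) \<in> W"
| W_step: "w \<in> W \<Longrightarrow> i < n \<Longrightarrow> mirror (\<alpha> i) \<circ> w \<in> W"

lemma W_orthogonal: "w \<in> W \<Longrightarrow> orthogonal_transformation w"
proof (induction rule: W.induct)
  case (W_step w i)
  then show ?case
    by (intro orthogonal_transformation_compose orthogonal_transformation_mirror)
qed simp

lemma W_image: "w \<in> W \<Longrightarrow> w ` V = V"
proof (induction rule: W.induct)
  case (W_step w i)
  then show ?case by (simp only: image_comp[symmetric] sym)
qed simp

lemma mirror_conj:
  assumes T: "orthogonal_transformation T"
  shows "mirror (T \<gamma>) (T x) = T (mirror \<gamma> x)"
  using T orthogonal_transformation_linear[OF T]
  by (simp add: mirror_def orthogonal_transformation_def linear_diff linear_scale)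

lemma root_image:
  assumes T: "orthogonal_transformation T" "T ` V = V" and "mirror \<gamma> ` V = V"
  shows "mirror (T \<gamma>) ` V = V"
proof -
  have "mirror (T \<gamma>) ` V = mirror (T \<gamma>) ` T ` V" using T(2) by simp
  also have "\<dots> = T ` mirror \<gamma> ` V" by (simp add: image_image mirror_conj[OF T(1)])
  finally show ?thesis using assms by simp
qed

lemma W_orbit_finite: "finite ((\<lambda>w. w x) ` W)"
proof -
  have "x \<in> range (\<lambda>k. \<Sum>v\<in>V. k v *\<^sub>R v)" using span_finite[OF finV] spanV by simp
  then obtain k where k: "x = (\<Sum>v\<in>V. k v *\<^sub>R v)" by blast
  have "(\<lambda>w. w x) ` W \<subseteq> (\<lambda>h. \<Sum>v\<in>V. k v *\<^sub>R h v) ` (V \<rightarrow>\<^sub>E V)"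
  proof clarify
    fix w assume w: "w \<in> W"
    have "linear w" using W_orthogonal[OF w] orthogonal_transformation_linear by blast
    then have "w x = (\<Sum>v\<in>V. k v *\<^sub>R (restrict w V) v)"
      unfolding k by (simp add: linear_sum linear_scale)
    moreover have "restrict w V \<in> V \<rightarrow>\<^sub>E V" using W_image[OF w] by auto
    ultimately show "w x \<in> (\<lambda>h. \<Sum>v\<in>V. k v *\<^sub>R h v) ` (V \<rightarrow>\<^sub>E V)" by blast
  qed
  then show ?thesis using finite_PiE[OF finV] finV by (meson finite_imageI finite_subset)
qed

text \<open>Choose \<open>w\<close> such that \<open>w \<xi> \<bullet> \<xi>\<close> is least. Then the inverse \<open>u\<close> of \<open>w\<close> maps each \<open>\<alpha> i\<close> to a combination of
the \<open>\<alpha> j\<close> with nonpositive coefficients, and so does \<open>w\<close>. The matrices of \<open>-w\<close> and \<open>-u\<close> are nonnegative and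
inverse to each other, which forces them to be monomial, and the \<open>\<alpha> i\<close> have unit length.\<close>

lemma longest_element:
  obtains w \<tau> where "w \<in> W" "\<And>i. i < n \<Longrightarrow> \<tau> i < n \<and> w (\<alpha> (\<tau> i)) = - \<alpha> i"
proof -
  have "finite ((\<lambda>w. w \<xi> \<bullet> \<xi>) ` W)"
    using finite_imageI[OF W_orbit_finite[of \<xi>], of "\<lambda>x. x \<bullet> \<xi>"] by (simp add: image_image)
  moreover have "(\<lambda>w. w \<xi> \<bullet> \<xi>) ` W \<noteq> {}" using W_id by blast
  ultimately have "Min ((\<lambda>w. w \<xi> \<bullet> \<xi>) ` W) \<in> (\<lambda>w. w \<xi> \<bullet> \<xi>) ` W" (is "?m \<in> _") by (rule Min_in)
  then obtain w where w: "w \<in> W" and wm: "w \<xi> \<bullet> \<xi> = ?m" by auto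
  have min: "w \<xi> \<bullet> \<xi> \<le> w' \<xi> \<bullet> \<xi>" if "w' \<in> W" for w'
    unfolding wm using that \<open>finite ((\<lambda>w. w \<xi> \<bullet> \<xi>) ` W)\<close> by (intro Min_le) auto
  have ow: "orthogonal_transformation w" and lw: "linear w" and iw: "w ` V = V"
    using W_orthogonal[OF w] W_image[OF w] orthogonal_transformation_linear by auto
  define u where "u = inv w"
  have bw: "bij w" using ow orthogonal_transformation_bij by blast
  have uw: "u (w x) = x" "w (u x) = x" for x
    unfolding u_def using bw by (simp_all add: bij_is_inj bij_is_surj surj_f_inv_f)
  have ou: "orthogonal_transformation u" unfolding u_def using ow orthogonal_transformation_inv by blast
  have lu: "linear u" using ou orthogonal_transformation_linear by blast
  have iu: "u ` V = V" using iw uw by (metis (no_types, lifting) image_cong image_ident image_image)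
  have neg_u: "u (\<alpha> i) \<bullet> f j \<le> 0" if i: "i < n" and j: "j < n" for i j
  proof -
    have "w \<xi> \<bullet> \<xi> \<le> (mirror (\<alpha> i) \<circ> w) \<xi> \<bullet> \<xi>" by (rule min[OF W_step[OF w i]])
    also have "\<dots> = w \<xi> \<bullet> \<xi> - 2 * (w \<xi> \<bullet> \<alpha> i) * (\<alpha> i \<bullet> \<xi>)"
      using i by (simp add: mirror_unit inner_diff_left)
    finally have "w \<xi> \<bullet> \<alpha> i \<le> 0" using \<xi>[OF i] by (simp add: mult_le_0_iff)
    also have "w \<xi> \<bullet> \<alpha> i = w \<xi> \<bullet> w (u (\<alpha> i))" by (simp add: uw)
    also have "\<dots> = u (\<alpha> i) \<bullet> \<xi>" using ow by (simp add: orthogonal_transformation_def inner_commute)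
    finally have sum: "(\<Sum>k<n. u (\<alpha> i) \<bullet> f k) \<le> 0" by (simp add: \<xi>_def inner_sum_right)
    have "(\<forall>k<n. 0 \<le> u (\<alpha> i) \<bullet> f k) \<or> (\<forall>k<n. u (\<alpha> i) \<bullet> f k \<le> 0)"
      by (rule chamber[OF root_image[OF ou iu sym[OF i]]])
    then show ?thesis
    proof
      assume pos: "\<forall>k<n. 0 \<le> u (\<alpha> i) \<bullet> f k"
      then have "0 \<le> (\<Sum>k<n. u (\<alpha> i) \<bullet> f k)" by (intro sum_nonneg) auto
      then have "(\<Sum>k<n. u (\<alpha> i) \<bullet> f k) = 0" using sum by linarith
      then have "u (\<alpha> i) \<bullet> f j = 0"
        using pos j sum_nonneg_eq_0_iff[of "{..<n}" "\<lambda>k. u (\<alpha> i) \<bullet> f k"] by simp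
      then show ?thesis by simp
    qed (use j in blast)
  qed
  have neg_co_u: "co j (u (\<alpha> i)) \<le> 0" if "i < n" "j < n" for i j
    using neg_u[OF that] dual_pos[OF that(2)] by (simp add: co_def divide_le_0_iff)
  have neg_co_w: "co j (w (\<alpha> i)) \<le> 0" if i: "i < n" and j: "j < n" for i j
  proof -
    have "(\<forall>k<n. 0 \<le> w (\<alpha> i) \<bullet> f k) \<or> (\<forall>k<n. w (\<alpha> i) \<bullet> f k \<le> 0)"
      by (rule chamber[OF root_image[OF ow iw sym[OF i]]])
    then show ?thesis
    proof
      assume "\<forall>k<n. 0 \<le> w (\<alpha> i) \<bullet> f k"
      then have pos: "co k (w (\<alpha> i)) \<ge> 0" if "k < n" for k
        using that dual_pos[OF that] by (simp add: co_def)
      have "\<alpha> i = u (w (\<alpha> i))" by (simp add: uw)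
      also have "\<dots> = (\<Sum>k<n. co k (w (\<alpha> i)) *\<^sub>R u (\<alpha> k))" by (rule linear_expansion[OF lu])
      finally have "\<alpha> i \<bullet> f i = (\<Sum>k<n. co k (w (\<alpha> i)) *\<^sub>R u (\<alpha> k)) \<bullet> f i" by (rule arg_cong)
      also have "\<dots> = (\<Sum>k<n. co k (w (\<alpha> i)) * (u (\<alpha> k) \<bullet> f i))" by (simp add: inner_sum_left)
      also have "\<dots> \<le> 0" using pos neg_u i by (intro sum_nonpos mult_nonneg_nonpos) auto
      finally show ?thesis using dual_pos[OF i] by simp
    next
      assume "\<forall>k<n. w (\<alpha> i) \<bullet> f k \<le> 0"
      then show ?thesis using dual_pos[OF j] j by (simp add: co_def divide_le_0_iff)
    qed
  qed
  have "\<exists>j<n. w (\<alpha> j) = - \<alpha> i" if i: "i < n" for i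
  proof -
    have "\<exists>j<n. co j (u (\<alpha> i)) \<noteq> 0"
    proof (rule ccontr)
      assume "\<not> ?thesis"
      then have "(\<Sum>j<n. co j (u (\<alpha> i)) *\<^sub>R \<alpha> j) = 0" by simp
      then have "u (\<alpha> i) = 0" using expansion[of "u (\<alpha> i)"] by (rule trans[rotated])
      then have "w (u (\<alpha> i)) = 0" using lw by (simp add: linear_0)
      then have "\<alpha> i = 0" by (simp add: uw)
      then show False using unit[OF i] by simp
    qed
    then obtain j where j: "j < n" "co j (u (\<alpha> i)) < 0" using neg_co_u[OF i] by (metis less_le)
    have zero: "co k (w (\<alpha> j)) = 0" if k: "k < n" "k \<noteq> i" for k
    proof -
      have "\<alpha> i = w (u (\<alpha> i))" by (simp add: uw)
      also have "\<dots> = (\<Sum>l<n. co l (u (\<alpha> i)) *\<^sub>R w (\<alpha> l))" by (rule linear_expansion[OF lw])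
      finally have "\<alpha> i \<bullet> f k = (\<Sum>l<n. co l (u (\<alpha> i)) *\<^sub>R w (\<alpha> l)) \<bullet> f k" by (rule arg_cong)
      also have "\<dots> = (\<Sum>l<n. co l (u (\<alpha> i)) * (w (\<alpha> l) \<bullet> f k))" by (simp add: inner_sum_left)
      finally have "(\<Sum>l<n. co l (u (\<alpha> i)) * (w (\<alpha> l) \<bullet> f k)) = 0" using dual[OF i] k by auto
      moreover have "0 \<le> co l (u (\<alpha> i)) * (w (\<alpha> l) \<bullet> f k)" if "l < n" for l
      proof (rule mult_nonpos_nonpos[OF neg_co_u[OF i that]])
        show "w (\<alpha> l) \<bullet> f k \<le> 0"
          using neg_co_w[OF that k(1)] dual_pos[OF k(1)] by (simp add: co_def divide_le_0_iff)
      qed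
      ultimately have "co j (u (\<alpha> i)) * (w (\<alpha> j) \<bullet> f k) = 0"
        using j(1) sum_nonneg_eq_0_iff[of "{..<n}" "\<lambda>l. co l (u (\<alpha> i)) * (w (\<alpha> l) \<bullet> f k)"] by simp
      then have "w (\<alpha> j) \<bullet> f k = 0" using j(2) by simp
      then show ?thesis by (simp add: co_def)
    qed
    have "w (\<alpha> j) = (\<Sum>k<n. co k (w (\<alpha> j)) *\<^sub>R \<alpha> k)" by (rule expansion)
    also have "\<dots> = (\<Sum>k<n. if k = i then co i (w (\<alpha> j)) *\<^sub>R \<alpha> i else 0)"
      by (rule sum.cong) (use zero in auto)
    finally have eq: "w (\<alpha> j) = co i (w (\<alpha> j)) *\<^sub>R \<alpha> i" using i by simp
    define r where "r = co i (w (\<alpha> j))"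
    have "w (\<alpha> j) \<bullet> w (\<alpha> j) = 1" using ow unit[OF j(1)] by (simp add: orthogonal_transformation_def)
    then have "r * r = 1" using eq unit[OF i] unfolding r_def[symmetric] by simp
    moreover have "r \<le> 0" using neg_co_w[OF j(1) i] by (simp add: r_def)
    ultimately have "r = -1" using square_eq_1_iff[of r] by auto
    then show ?thesis using eq j(1) unfolding r_def by auto
  qed
  then obtain \<tau> where "\<And>i. i < n \<Longrightarrow> \<tau> i < n \<and> w (\<alpha> (\<tau> i)) = - \<alpha> i" by metis
  then show ?thesis using that w by blast
qed

text \<open>\<open>-w\<close> permutes the \<open>\<alpha> i\<close> and preserves inner products, so it induces an automorphism of the path on which
neighbours are the indices with nonzero inner product.\<close>

lemma minus_or_reversal:
  obtains (minus) "uminus ` V = V"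
  | (reversal) w where "w \<in> W" "\<And>i. i < n \<Longrightarrow> w (\<alpha> (n - 1 - i)) = - \<alpha> i"
proof -
  obtain w \<tau> where w: "w \<in> W" and \<tau>: "\<And>i. i < n \<Longrightarrow> \<tau> i < n \<and> w (\<alpha> (\<tau> i)) = - \<alpha> i"
    using longest_element by metis
  have ow: "orthogonal_transformation w" and lw: "linear w"
    using W_orthogonal[OF w] orthogonal_transformation_linear by auto
  have pres: "\<alpha> (\<tau> i) \<bullet> \<alpha> (\<tau> j) = \<alpha> i \<bullet> \<alpha> j" if "i < n" "j < n" for i j
  proof -
    have "\<alpha> (\<tau> i) \<bullet> \<alpha> (\<tau> j) = w (\<alpha> (\<tau> i)) \<bullet> w (\<alpha> (\<tau> j))"
      using ow by (simp add: orthogonal_transformation_def)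
    then show ?thesis using \<tau> that by simp
  qed
  have "(\<forall>i<n. \<tau> i = i) \<or> (\<forall>i<n. \<tau> i = n - 1 - i)"
  proof (rule path_embedding_cases)
    show "\<tau> i < n" if "i < n" for i using \<tau>[OF that] by blast
    show "i = j" if ij: "i < n" "j < n" "\<tau> i = \<tau> j" for i j
    proof (rule ccontr)
      assume "i \<noteq> j"
      have "\<alpha> i = \<alpha> j" using \<tau>[OF ij(1)] \<tau>[OF ij(2)] ij(3) by simp
      then show False using dual[OF ij(1,2) \<open>i \<noteq> j\<close>] dual_pos[OF ij(2)] by simp
    qed
    show "\<tau> (i + 1) = \<tau> i + 1 \<or> \<tau> i = \<tau> (i + 1) + 1" if i: "i + 1 < n" for i
    proof -
      have "\<alpha> (\<tau> i) \<bullet> \<alpha> (\<tau> (i + 1)) < 0" using pres[of i "i + 1"] near[OF i] i by simp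
      then show ?thesis
        using gram[of "\<tau> i" "\<tau> (i + 1)"] \<tau>[of i] \<tau>[of "i + 1"] i by (auto split: if_splits)
    qed
  qed
  then show ?thesis
  proof
    assume id: "\<forall>i<n. \<tau> i = i"
    have "w x = - x" for x
    proof -
      have "w x = (\<Sum>i<n. co i x *\<^sub>R w (\<alpha> i))" by (rule linear_expansion[OF lw])
      also have "\<dots> = (\<Sum>i<n. - (co i x *\<^sub>R \<alpha> i))"
        by (rule sum.cong) (use \<tau> id in auto)
      also have "\<dots> = - x" by (simp add: sum_negf expansion[symmetric])
      finally show ?thesis .
    qed
    then have "uminus ` V = w ` V" by simp
    then show ?thesis using minus W_image[OF w] by simp
  next
    assume "\<forall>i<n. \<tau> i = n - 1 - i"
    then show ?thesis using reversal[OF w] \<tau> by simp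
  qed
qed

end

section \<open>The angles of a reversible chain\<close>

context mirror_chain
begin

lemma mirror_co:
  assumes "i < n" "k < n"
  shows "co k (mirror (\<alpha> i) x) = co k x - (if k = i then 2 * (x \<bullet> \<alpha> i) else 0)"
  using assms by (simp add: mirror_unit co_diff co_scale co_\<alpha>)

text \<open>Vectors of mirrors in the plane of \<open>\<alpha> i\<close> and \<open>\<alpha> (i + 1)\<close> are carried to each other by the two reflections;
as the mirrors do not cut the cone, the two coordinates never have opposite signs.\<close>

lemma plane_mirror:
  assumes i: "i + 1 < n" and T: "mirror (x *\<^sub>R \<alpha> i + y *\<^sub>R \<alpha> (i + 1)) ` V = V"
  shows "mirror ((2 * c i * y - x) *\<^sub>R \<alpha> i + y *\<^sub>R \<alpha> (i + 1)) ` V = V"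
    and "mirror (x *\<^sub>R \<alpha> i + (2 * c i * x - y) *\<^sub>R \<alpha> (i + 1)) ` V = V"
    and "0 \<le> x * y"
proof -
  let ?v = "x *\<^sub>R \<alpha> i + y *\<^sub>R \<alpha> (i + 1)"
  have i': "i < n" using i by simp
  have ip: "\<alpha> i \<bullet> \<alpha> (i + 1) = - c i" "\<alpha> (i + 1) \<bullet> \<alpha> i = - c i"
    by (simp_all add: c_def inner_commute)
  have "x - 2 * (x * 1 + y * - c i) = 2 * c i * y - x" by simp
  moreover have "mirror (\<alpha> i) ?v = (x - 2 * (x * 1 + y * - c i)) *\<^sub>R \<alpha> i + y *\<^sub>R \<alpha> (i + 1)"
    unfolding mirror_unit[OF i'] inner_add_left inner_scaleR_left unit[OF i'] ip scaleR_diff_left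
    by (simp only: diff_add_eq)
  ultimately have "mirror (\<alpha> i) ?v = (2 * c i * y - x) *\<^sub>R \<alpha> i + y *\<^sub>R \<alpha> (i + 1)"
    by (simp only:)
  then show "mirror ((2 * c i * y - x) *\<^sub>R \<alpha> i + y *\<^sub>R \<alpha> (i + 1)) ` V = V"
    using root_image[OF orthogonal_transformation_mirror sym[OF i'] T] by simp
  have "y - 2 * (x * - c i + y * 1) = 2 * c i * x - y" by simp
  moreover have "mirror (\<alpha> (i + 1)) ?v = x *\<^sub>R \<alpha> i + (y - 2 * (x * - c i + y * 1)) *\<^sub>R \<alpha> (i + 1)"
    unfolding mirror_unit[OF i] inner_add_left inner_scaleR_left unit[OF i] ip scaleR_diff_left
    by (simp only: add_diff_eq)
  ultimately have "mirror (\<alpha> (i + 1)) ?v = x *\<^sub>R \<alpha> i + (2 * c i * x - y) *\<^sub>R \<alpha> (i + 1)"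
    by (simp only:)
  then show "mirror (x *\<^sub>R \<alpha> i + (2 * c i * x - y) *\<^sub>R \<alpha> (i + 1)) ` V = V"
    using root_image[OF orthogonal_transformation_mirror sym[OF i] T] by simp
  have "?v \<bullet> f i = x * (\<alpha> i \<bullet> f i)" "?v \<bullet> f (i + 1) = y * (\<alpha> (i + 1) \<bullet> f (i + 1))"
    using dual[of i "i + 1"] dual[of "i + 1" i] i by (simp_all add: inner_add_left)
  moreover have "(0 \<le> ?v \<bullet> f i \<and> 0 \<le> ?v \<bullet> f (i + 1)) \<or> (?v \<bullet> f i \<le> 0 \<and> ?v \<bullet> f (i + 1) \<le> 0)"
    using chamber[OF T] i i' by blast
  ultimately have "(0 \<le> x \<and> 0 \<le> y) \<or> (x \<le> 0 \<and> y \<le> 0)"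
    using dual_pos[OF i'] dual_pos[OF i]
    by (metis mult_le_0_iff not_less order_less_imp_not_less zero_le_mult_iff)
  then show "0 \<le> x * y" by (auto simp: zero_le_mult_iff)
qed

text \<open>Alternating the two reflections yields mirror vectors whose coordinates are consecutive values of the
Chebyshev polynomials of the second kind at \<open>c i\<close>. Mixed signs occur unless the angle is \<open>\<pi>/m\<close>. Four steps
suffice to separate the angles \<open>\<pi>/3\<close> and \<open>\<pi>/4\<close> from those with cosine at least \<open>3/4\<close>, which is slightly
below \<open>cos (\<pi>/5)\<close>.\<close>

lemma label_cases:
  assumes i: "i + 1 < n"
  obtains "2 * c i = 1" | "2 * (c i)\<^sup>2 = 1" | "3 / 4 \<le> c i"
proof -
  define r where "r = c i"
  have r: "0 < r" using c_pos[OF i] by (simp add: r_def)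
  note step = plane_mirror[OF i, folded r_def]
  have "mirror (1 *\<^sub>R \<alpha> i + 0 *\<^sub>R \<alpha> (i + 1)) ` V = V" using sym[of i] i by simp
  note m1 = step(2)[OF this]
  note m2 = step(1)[OF m1]
  note m3 = step(2)[OF m2]
  note m4 = step(1)[OF m3]
  have x3: "2 * r * (2 * r * 1 - 0) - 1 = 4 * r\<^sup>2 - 1" by (simp add: power2_eq_square)
  have x4: "2 * r * (4 * r\<^sup>2 - 1) - (2 * r * 1 - 0) = 4 * r * (2 * r\<^sup>2 - 1)"
    by (simp add: algebra_simps power2_eq_square)
  have x5: "2 * r * (4 * r * (2 * r\<^sup>2 - 1)) - (4 * r\<^sup>2 - 1) = 16 * (r\<^sup>2)\<^sup>2 - 12 * r\<^sup>2 + 1"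
    by (simp add: algebra_simps power2_eq_square)
  have p1: "0 \<le> 4 * r\<^sup>2 - 1"
    using step(3)[OF m2] r unfolding x3 by (simp add: zero_le_mult_iff)
  have p2: "0 \<le> (4 * r\<^sup>2 - 1) * (4 * r * (2 * r\<^sup>2 - 1))"
    using step(3)[OF m3] unfolding x3 x4 by simp
  have p3: "0 \<le> (16 * (r\<^sup>2)\<^sup>2 - 12 * r\<^sup>2 + 1) * (4 * r * (2 * r\<^sup>2 - 1))"
    using step(3)[OF m4] unfolding x3 x4 x5 by simp
  consider "4 * r\<^sup>2 = 1" | "4 * r\<^sup>2 > 1" "2 * r\<^sup>2 = 1" | "4 * r\<^sup>2 > 1" "2 * r\<^sup>2 \<noteq> 1"
    using p1 by linarith
  then show ?thesis
  proof cases
    case 1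
    then have "(2 * r)\<^sup>2 = 1" by (simp add: power2_eq_square)
    then have "2 * r = 1" using r power2_eq_1_iff[of "2 * r"] by auto
    then show ?thesis using that(1) by (simp add: r_def)
  next
    case 2
    then show ?thesis using that(2) by (simp add: r_def)
  next
    case 3
    then have big: "2 * r\<^sup>2 > 1" using p2 r by (auto simp: zero_le_mult_iff)
    have "0 < 4 * r * (2 * r\<^sup>2 - 1)" using big r by (intro mult_pos_pos) auto
    then have p5: "0 \<le> 16 * (r\<^sup>2)\<^sup>2 - 12 * r\<^sup>2 + 1"
      using p3 mult_neg_pos by (meson linorder_not_less)
    have "3 / 4 \<le> r"
    proof (rule ccontr)
      assume "\<not> ?thesis"
      then have "r\<^sup>2 < (3 / 4)\<^sup>2" using r by (intro power_strict_mono) auto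
      then have small: "r\<^sup>2 < 9 / 16" by (simp add: power2_eq_square)
      have "(t - 1 / 2) * (9 / 16 - t) = 17 / 16 * t - 9 / 32 - t\<^sup>2" for t :: real
        by (simp add: field_simps power2_eq_square)
      moreover have "(r\<^sup>2 - 1 / 2) * (9 / 16 - r\<^sup>2) > 0" using big small by (intro mult_pos_pos) auto
      ultimately have "(r\<^sup>2)\<^sup>2 < 17 / 16 * r\<^sup>2 - 9 / 32" by (metis diff_gt_0_iff_gt)
      then show False using p5 small by linarith
    qed
    then show ?thesis using that(3) by (simp add: r_def)
  qed
qed

lemma label_ge_half:
  assumes "i + 1 < n"
  shows "1 / 2 \<le> c i"
  using assms
proof (rule label_cases)
  assume *: "2 * (c i)\<^sup>2 = 1"
  show ?thesis
  proof (rule ccontr)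
    assume "\<not> ?thesis"
    then have "(c i)\<^sup>2 < (1 / 2)\<^sup>2" using c_pos[OF assms] by (intro power_strict_mono) auto
    then show False using * by (simp add: power2_eq_square)
  qed
qed auto

lemma label_large:
  assumes i: "i + 1 < n" and "2 * c i \<noteq> 1"
  shows "1 \<le> sqrt 2 * c i"
  using i
proof (rule label_cases)
  assume "2 * (c i)\<^sup>2 = 1"
  then have "(sqrt 2 * c i)\<^sup>2 = 1" by (simp add: power_mult_distrib)
  then have "sqrt 2 * c i = 1 \<or> sqrt 2 * c i = -1" by (simp only: power2_eq_1_iff)
  moreover have "0 < sqrt 2 * c i" using c_pos[OF i] by simp
  ultimately show ?thesis by linarith
next
  assume c: "3 / 4 \<le> c i"
  have "4 / 3 \<le> sqrt 2" by (rule real_le_rsqrt) (simp add: power2_eq_square)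
  then have "1 \<le> sqrt 2 * (3 / 4)" by simp
  also have "\<dots> \<le> sqrt 2 * c i" using c by simp
  finally show ?thesis .
qed (use assms in auto)

text \<open>The weights \<open>1, sqrt 2, \<dots>, sqrt 2, 1\<close> between the two positions are the null vector of the affine Coxeter
diagram with end labels \<open>4\<close>.\<close>

lemma at_most_one_large_label:
  assumes ij: "i < j" "j + 1 < n"
  shows "2 * c i = 1 \<or> 2 * c j = 1"
proof (rule ccontr)
  assume "\<not> ?thesis"
  then have large: "1 \<le> sqrt 2 * c i" "1 \<le> sqrt 2 * c j" using label_large ij by auto
  define a where "a k = (if k = i \<or> k = j + 1 then 1 else if i < k \<and> k \<le> j then sqrt 2 else 0)" for k
  have half: "1 / sqrt 2 \<le> c k * a k' " if "i \<le> k" "k \<le> j" "(k = i \<and> k' = i) \<or> (k = j \<and> k' = j + 1) \<or> (i < k' \<and> k' \<le> j)" for k k'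
    using that(3)
  proof (elim disjE conjE)
    assume "k = i" "k' = i"
    then show ?thesis using large ij by (simp add: a_def field_simps)
  next
    assume "k = j" "k' = j + 1"
    then show ?thesis using large ij by (simp add: a_def field_simps)
  next
    assume "i < k'" "k' \<le> j"
    then have "c k * a k' = c k * sqrt 2" by (simp add: a_def)
    also have "\<dots> \<ge> 1 / 2 * sqrt 2" using label_ge_half[of k] that ij by (intro mult_right_mono) auto
    also have "1 / 2 * sqrt 2 = 1 / sqrt 2" by (simp add: real_div_sqrt field_simps)
    finally show ?thesis .
  qed
  have two: "1 / sqrt 2 + 1 / sqrt 2 = sqrt 2" by (simp add: field_simps)
  show False
  proof (rule no_subharmonic_vector[of a i])
    show nonneg: "0 \<le> a k" for k by (simp add: a_def)
    show "i < n" "0 < a i" using ij by (auto simp: a_def)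
    fix k assume k: "k < n" "0 < a k"
    then consider "k = i" | "k = j + 1" | "i < k" "k \<le> j" by (auto simp: a_def split: if_splits)
    then show "a k \<le> (if k = 0 then 0 else c (k - 1) * a (k - 1))
        + (if k + 1 < n then c k * a (k + 1) else 0)"
    proof cases
      case 1
      have "0 \<le> (if k = 0 then 0 else c (k - 1) * a (k - 1))"
        using c_pos[of "k - 1"] k nonneg[of "k - 1"] by (cases k) auto
      moreover have "1 \<le> c k * a (k + 1)" using 1 large ij by (simp add: a_def mult.commute)
      ultimately show ?thesis using 1 ij by (simp add: a_def)
    next
      case 2
      have "0 \<le> (if k + 1 < n then c k * a (k + 1) else 0)"
        using c_pos[of k] nonneg[of "k + 1"] by (auto intro: mult_nonneg_nonneg)
      moreover have "1 \<le> c (k - 1) * a (k - 1)" using 2 large ij by (simp add: a_def mult.commute)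
      ultimately show ?thesis using 2 ij by (simp add: a_def)
    next
      case 3
      have "1 / sqrt 2 \<le> c (k - 1) * a (k - 1)" using 3 by (intro half) auto
      moreover have "1 / sqrt 2 \<le> c k * a (k + 1)" using 3 by (intro half) auto
      ultimately have "sqrt 2 \<le> c (k - 1) * a (k - 1) + c k * a (k + 1)" using two by linarith
      then show ?thesis using 3 ij by (simp add: a_def)
    qed
  qed
qed

text \<open>Here the weights are \<open>1, 2, 2, 1\<close>, with the twos at the ends of the edge \<open>i\<close>.\<close>

lemma middle_label_small:
  assumes i: "0 < i" "i + 2 < n"
  shows "c i < 3 / 4"
proof (rule ccontr)
  assume "\<not> ?thesis"
  then have c: "3 / 4 \<le> c i" by simp
  have h: "1 / 2 \<le> c (i - 1)" "1 / 2 \<le> c (i + 1)" using label_ge_half[of "i - 1"] label_ge_half[of "i + 1"] i by auto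
  define a :: "nat \<Rightarrow> real" where
    "a k = (if k + 1 = i \<or> k = i + 2 then 1 else if k = i \<or> k = i + 1 then 2 else 0)" for k
  show False
  proof (rule no_subharmonic_vector[of a i])
    show nonneg: "0 \<le> a k" for k by (simp add: a_def)
    show "i < n" "0 < a i" using i by (auto simp: a_def)
    fix k assume k: "k < n" "0 < a k"
    then consider "k = i - 1" | "k = i" | "k = i + 1" | "k = i + 2" by (auto simp: a_def split: if_splits)
    then show "a k \<le> (if k = 0 then 0 else c (k - 1) * a (k - 1))
        + (if k + 1 < n then c k * a (k + 1) else 0)"
    proof cases
      case 1
      have "0 \<le> (if k = 0 then 0 else c (k - 1) * a (k - 1))"
        using c_pos[of "k - 1"] k nonneg[of "k - 1"] by (cases k) auto
      moreover have "1 \<le> c k * a (k + 1)" using 1 h i by (simp add: a_def)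
      moreover have "a k = 1" using 1 i by (simp add: a_def)
      ultimately show ?thesis using 1 i by simp
    next
      case 2
      have "1 / 2 \<le> c (k - 1) * a (k - 1)" "3 / 2 \<le> c k * a (k + 1)"
        using 2 h c i by (auto simp: a_def)
      then show ?thesis using 2 i by (simp add: a_def)
    next
      case 3
      have "3 / 2 \<le> c (k - 1) * a (k - 1)" "1 / 2 \<le> c k * a (k + 1)"
        using 3 h c i by (auto simp: a_def)
      then show ?thesis using 3 i by (simp add: a_def)
    next
      case 4
      have "0 \<le> (if k + 1 < n then c k * a (k + 1) else 0)"
        using c_pos[of k] nonneg[of "k + 1"] by (auto intro: mult_nonneg_nonneg)
      moreover have "1 \<le> c (k - 1) * a (k - 1)" using 4 h i by (simp add: a_def)
      ultimately show ?thesis using 4 i by (simp add: a_def)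
    qed
  qed
qed

text \<open>The group preserves the lattice generated by \<open>\<alpha> k\<close> for \<open>k \<le> i\<close> and \<open>sqrt 2 *\<^sub>R \<alpha> k\<close> for \<open>k > i\<close>. It contains
\<open>\<alpha> 0\<close> but not \<open>\<alpha> (n - 1)\<close>, so no element of the group exchanges the two up to sign.\<close>

lemma middle_label_not_four:
  assumes i: "i + 1 < n" and half: "\<And>k. k + 1 < n \<Longrightarrow> k \<noteq> i \<Longrightarrow> 2 * c k = 1"
    and four: "2 * (c i)\<^sup>2 = 1"
    and w: "w \<in> W" "w (\<alpha> 0) = - \<alpha> (n - 1)"
  shows False
proof -
  have "(sqrt 2 * c i)\<^sup>2 = 1" using four by (simp add: power_mult_distrib)
  then have "sqrt 2 * c i = 1 \<or> sqrt 2 * c i = -1" by (simp only: power2_eq_1_iff)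
  moreover have "0 < sqrt 2 * c i" using c_pos[OF i] by simp
  ultimately have "sqrt 2 * c i = 1" by linarith
  then have ci: "c i * sqrt 2 = 1" by (simp add: mult.commute)
  have "2 * c i = sqrt 2 * (sqrt 2 * c i)" by (simp add: mult.assoc[symmetric])
  then have ci2: "2 * c i = sqrt 2" using \<open>sqrt 2 * c i = 1\<close> by simp
  define wt :: "nat \<Rightarrow> real" where "wt k = (if k \<le> i then 1 else sqrt 2)" for k
  define L where "L = {x. \<forall>k<n. \<exists>z::int. co k x = z * wt k}"
  have up: "\<exists>z'::int. 2 * c k * (z * wt (k + 1)) = z' * wt k" if "k + 1 < n" for k and z :: int
  proof (cases "k = i")
    case True
    then have "2 * c k * (z * wt (k + 1)) = (2 * z) * wt k" using ci by (simp add: wt_def algebra_simps)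
    then show ?thesis by (metis of_int_mult of_int_numeral)
  next
    case False
    then show ?thesis using half[OF that False] by (auto simp: wt_def)
  qed
  have down: "\<exists>z'::int. 2 * c k * (z * wt k) = z' * wt (k + 1)" if "k + 1 < n" for k and z :: int
  proof (cases "k = i")
    case True
    then show ?thesis using ci2 by (auto simp: wt_def algebra_simps)
  next
    case False
    then show ?thesis using half[OF that False] by (auto simp: wt_def)
  qed
  have closed: "mirror (\<alpha> j) x \<in> L" if x: "x \<in> L" and j: "j < n" for x j
  proof -
    have "\<exists>z::int. co k (mirror (\<alpha> j) x) = z * wt k" if k: "k < n" for k
    proof (cases "k = j")
      case False
      then show ?thesis using x k j unfolding L_def by (simp add: mirror_co)
    next
      case True
      obtain z0 :: int where z0: "co k x = z0 * wt k" using x k unfolding L_def by blast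
      have "\<exists>z1::int. (if k = 0 then 0 else 2 * c (k - 1) * co (k - 1) x) = z1 * wt k"
      proof (cases "k = 0")
        case True
        then show ?thesis by (auto intro: exI[of _ 0])
      next
        case False
        then obtain z :: int where "co (k - 1) x = z * wt (k - 1)" using x k unfolding L_def by fastforce
        then show ?thesis using down[of "k - 1" z] False k by simp
      qed
      then obtain z1 :: int where z1: "(if k = 0 then 0 else 2 * c (k - 1) * co (k - 1) x) = z1 * wt k" ..
      have "\<exists>z2::int. (if k + 1 < n then 2 * c k * co (k + 1) x else 0) = z2 * wt k"
      proof (cases "k + 1 < n")
        case False
        then show ?thesis by (auto intro: exI[of _ 0])
      next
        case True
        then obtain z :: int where "co (k + 1) x = z * wt (k + 1)" using x unfolding L_def by blast
        then show ?thesis using up[OF True, of z] True by simp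
      qed
      then obtain z2 :: int where z2: "(if k + 1 < n then 2 * c k * co (k + 1) x else 0) = z2 * wt k" ..
      have "co k (mirror (\<alpha> j) x) = - co k x + (if k = 0 then 0 else 2 * c (k - 1) * co (k - 1) x)
          + (if k + 1 < n then 2 * c k * co (k + 1) x else 0)"
        using True k j by (simp add: mirror_co inner_\<alpha>)
      also have "\<dots> = of_int (- z0 + z1 + z2) * wt k"
        unfolding z0 z1 z2 by (simp add: algebra_simps)
      finally show ?thesis by blast
    qed
    then show ?thesis by (simp add: L_def)
  qed
  have "w' x \<in> L" if "w' \<in> W" "x \<in> L" for w' x
    using that by (induction rule: W.induct) (auto intro: closed)
  moreover have "\<alpha> 0 \<in> L"
  proof -
    have "co k (\<alpha> 0) = of_int (if k = 0 then 1 else 0) * wt k" if "k < n" for k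
      using that i by (simp add: co_\<alpha> wt_def)
    then show ?thesis unfolding L_def by blast
  qed
  ultimately have "- \<alpha> (n - 1) \<in> L" using w by metis
  then obtain z :: int where "co (n - 1) (- \<alpha> (n - 1)) = z * wt (n - 1)"
    using i unfolding L_def by fastforce
  then have "-1 = z * sqrt 2" using i by (simp add: co_minus co_\<alpha> wt_def)
  then have "(z * sqrt 2)\<^sup>2 = 1" by (metis power2_eq_1_iff)
  then have "real_of_int (2 * z\<^sup>2) = 1" by (simp add: power_mult_distrib mult.commute)
  then have "2 * z\<^sup>2 = 1" by linarith
  then show False by presburger
qed

text \<open>The reversal makes the sequence of the \<open>c i\<close> palindromic, so a value other than \<open>1/2\<close> would occur twice or
sit in the middle of the chain.\<close>

lemma all_labels_three:
  assumes n: "3 \<le> n" and w: "w \<in> W" "\<And>i. i < n \<Longrightarrow> w (\<alpha> (n - 1 - i)) = - \<alpha> i"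
    and k: "k + 1 < n"
  shows "2 * c k = 1"
proof -
  have pal: "c (n - 2 - i) = c i" if i: "i + 1 < n" for i
  proof -
    have "\<alpha> i \<bullet> \<alpha> (i + 1) = w (\<alpha> (n - 1 - i)) \<bullet> w (\<alpha> (n - 1 - (i + 1)))"
      using w(2)[of i] w(2)[of "i + 1"] i by simp
    also have "\<dots> = \<alpha> (n - 1 - i) \<bullet> \<alpha> (n - 1 - (i + 1))"
      using W_orthogonal[OF w(1)] by (simp add: orthogonal_transformation_def)
    also have "\<dots> = \<alpha> (n - 2 - i) \<bullet> \<alpha> (n - 2 - i + 1)"
      using i by (simp add: inner_commute numeral_2_eq_2 Suc_diff_Suc)
    finally show ?thesis by (simp add: c_def)
  qed
  have only_middle: "2 * c j = 1" if j: "j + 1 < n" "n - 2 - j \<noteq> j" for j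
  proof (cases "j < n - 2 - j")
    case True
    then show ?thesis using at_most_one_large_label[of j "n - 2 - j"] pal[OF j(1)] by auto
  next
    case False
    then show ?thesis using at_most_one_large_label[of "n - 2 - j" j] pal[OF j(1)] j by auto
  qed
  show ?thesis
  proof (cases "n - 2 - k = k")
    case False
    then show ?thesis using only_middle k by blast
  next
    case True
    show ?thesis using k
    proof (rule label_cases)
      assume four: "2 * (c k)\<^sup>2 = 1"
      have "w (\<alpha> 0) = - \<alpha> (n - 1)" using w(2)[of "n - 1"] n by simp
      then have False
        using middle_label_not_four[OF k _ four w(1)] only_middle True k by auto
      then show ?thesis ..
    next
      assume "3 / 4 \<le> c k"
      moreover have "n = 2 * k + 2" using True k by linarith
      ultimately show ?thesis using middle_label_small[of k] n by auto
    qed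
  qed
qed

text \<open>The points \<open>v k\<close> below are the vertices of a simplex: the mirror of \<open>\<alpha> i\<close> exchanges \<open>v i\<close> and \<open>v (i + 1)\<close> and
fixes the others. So they exhaust the orbit of \<open>f 0 = v 0\<close>.\<close>

lemma card_if_all_labels_three:
  assumes half: "\<And>k. k + 1 < n \<Longrightarrow> 2 * c k = 1"
  shows "card V \<le> n + 1"
proof -
  have n: "0 < n" by (simp add: dim)
  define \<mu> where "\<mu> = 2 * (f 0 \<bullet> \<alpha> 0)"
  define v where "v k = f 0 - \<mu> *\<^sub>R (\<Sum>j<k. \<alpha> j)" for k
  have f0: "f 0 \<bullet> \<alpha> i = (if i = 0 then \<mu> / 2 else 0)" if "i < n" for i
    using dual[OF that n] by (auto simp: \<mu>_def inner_commute)
  have prod: "v k \<bullet> \<alpha> i = (if i = k then \<mu> / 2 else if i + 1 = k then - \<mu> / 2 else 0)"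
    if i: "i < n" and k: "k \<le> n" for i k
  proof -
    define a :: "nat \<Rightarrow> real" where "a j = (if j < k then 1 else 0)" for j
    have "(\<Sum>j<k. \<alpha> j) = (\<Sum>j\<in>{..<n} \<inter> {j. j < k}. \<alpha> j)"
      by (rule sum.cong) (use k in auto)
    also have "\<dots> = (\<Sum>j<n. a j *\<^sub>R \<alpha> j)"
      by (subst sum.inter_restrict) (auto simp: a_def intro!: sum.cong)
    finally have "(\<Sum>j<k. \<alpha> j) \<bullet> \<alpha> i = a i - (if i = 0 then 0 else c (i - 1) * a (i - 1))
        - (if i + 1 < n then c i * a (i + 1) else 0)"
      by (simp add: inner_\<alpha>_sum[OF i])
    moreover have "(if i + 1 < n then c i * a (i + 1) else 0) = (if i + 1 < n then a (i + 1) / 2 else 0)"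
    proof (cases "i + 1 < n")
      case True
      have "c i * a (i + 1) = 2 * c i * a (i + 1) / 2" by simp
      also have "\<dots> = a (i + 1) / 2" by (simp only: half[OF True] mult_1_left)
      finally show ?thesis by simp
    qed simp
    moreover have "(if i = 0 then 0 else c (i - 1) * a (i - 1)) = (if i = 0 then 0 else a (i - 1) / 2)"
    proof (cases "i = 0")
      case False
      then have one: "2 * c (i - 1) = 1" using half[of "i - 1"] i by simp
      have "c (i - 1) * a (i - 1) = 2 * c (i - 1) * a (i - 1) / 2" by simp
      also have "\<dots> = a (i - 1) / 2" by (simp only: one mult_1_left)
      finally show ?thesis by simp
    qed simp
    ultimately have "(\<Sum>j<k. \<alpha> j) \<bullet> \<alpha> i = a i - (if i = 0 then 0 else a (i - 1) / 2)
        - (if i + 1 < n then a (i + 1) / 2 else 0)" by (simp only:)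
    moreover have "v k \<bullet> \<alpha> i = (if i = 0 then \<mu> / 2 else 0) - \<mu> * ((\<Sum>j<k. \<alpha> j) \<bullet> \<alpha> i)"
      by (simp add: v_def inner_diff_left f0[OF i])
    ultimately show ?thesis using k i by (auto simp: a_def)
  qed
  have "V \<subseteq> v ` {..n}"
  proof (rule orbit_induct)
    show "f 0 \<in> v ` {..n}" by (intro image_eqI[of _ _ 0]) (auto simp: v_def)
  next
    fix x i assume "x \<in> v ` {..n}" and i: "i < n"
    then obtain k where k: "k \<le> n" "x = v k" by auto
    consider "i = k" | "i + 1 = k" | "i \<noteq> k" "i + 1 \<noteq> k" by blast
    then show "mirror (\<alpha> i) x \<in> v ` {..n}"
    proof cases
      case 1
      then have "mirror (\<alpha> i) x = v (k + 1)"
        using prod[OF i k(1)] k i by (simp add: mirror_unit v_def scaleR_add_right)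
      then show ?thesis using 1 i by auto
    next
      case 2
      have "(\<Sum>j<k. \<alpha> j) = (\<Sum>j<i. \<alpha> j) + \<alpha> i" unfolding 2[symmetric] by simp
      then have "v k = v i - \<mu> *\<^sub>R \<alpha> i" by (simp add: v_def scaleR_add_right)
      moreover have "v k \<bullet> \<alpha> i = - \<mu> / 2" using prod[OF i k(1)] 2 by simp
      ultimately have "mirror (\<alpha> i) x = v i"
        using k i by (simp add: mirror_unit)
      then show ?thesis using i by auto
    next
      case 3
      then have "mirror (\<alpha> i) x = x" using prod[OF i k(1)] k i by (simp add: mirror_unit)
      then show ?thesis using k by auto
    qed
  qed
  then have "card V \<le> card (v ` {..n})" by (intro card_mono) auto
  also have "\<dots> \<le> card {..n}" by (rule card_image_le) simp
  finally show ?thesis by simp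
qed

theorem centrally_symmetric_or_few_vertices:
  assumes "3 \<le> n"
  shows "uminus ` V = V \<or> card V \<le> n + 1"
proof (rule minus_or_reversal)
  fix w assume "w \<in> W" "\<And>i. i < n \<Longrightarrow> w (\<alpha> (n - 1 - i)) = - \<alpha> i"
  then show ?thesis using all_labels_three[OF assms] card_if_all_labels_three by blast
qed simp

end

section \<open>The mirrors of a flag\<close>

lemma mirror_scale: "r \<noteq> 0 \<Longrightarrow> mirror (r *\<^sub>R b) = mirror b"
  by (rule ext) (simp add: mirror_def)

lemma mirror_minus_commute: "mirror (x - y) = mirror (y - x)"
  using mirror_scale[of "-1" "x - y"] by simp

lemma polytope_eq_hull_vertices:
  assumes "polytope P"
  shows "P = convex hull (vertices P)"
  unfolding vertices_def
  using Krein_Milman_Minkowski assms polytope_imp_compact polytope_imp_convex by blast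

lemma finite_vertices: "polytope P \<Longrightarrow> finite (vertices P)"
  unfolding vertices_def using finite_polyhedron_extreme_points polytope_imp_polyhedron by blast

lemma symmetry_of_vertices:
  assumes "polytope P" "orthogonal_transformation T"
  shows "T ` vertices P = vertices P \<longleftrightarrow> T ` P = P"
proof
  assume "T ` vertices P = vertices P"
  then have "T ` (convex hull (vertices P)) = convex hull (vertices P)"
    using convex_hull_linear_image[of T "vertices P"] assms(2) orthogonal_transformation_linear by metis
  then show "T ` P = P" using polytope_eq_hull_vertices[OF assms(1)] by simp
next
  assume "T ` P = P"
  then show "T ` vertices P = vertices P" using vertices_image[OF assms(2), of P] by simp
qed

lemma full_dim_center_zero:
  fixes P :: "'a::euclidean_space set"
  assumes "equiradial P" "aff_dim P = int DIM('a)"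
  shows "face_center P = 0"
proof (rule ccontr)
  assume ne: "face_center P \<noteq> 0"
  have "P \<noteq> {}" using assms(2) by auto
  then have "perpendicular_center P" using assms(1) equiradial_perpendicular_center by blast
  then have "P \<subseteq> {x. face_center P \<bullet> x = face_center P \<bullet> face_center P}"
    by (auto simp: perpendicular_center_def inner_commute)
  then have "aff_dim P \<le> aff_dim {x. face_center P \<bullet> x = face_center P \<bullet> face_center P}"
    by (rule aff_dim_subset)
  also have "\<dots> = int DIM('a) - 1" using aff_dim_hyperplane[OF ne] by simp
  finally show False using assms(2) by simp
qed

lemma full_dim_vertices_span:
  fixes P :: "'a::euclidean_space set"
  assumes "polytope P" "aff_dim P = int DIM('a)"
  shows "span (vertices P) = UNIV"
proof -
  have "affine hull P = UNIV" using assms(2) aff_dim_eq_full by blast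
  moreover have "affine hull P = affine hull (vertices P)"
    using polytope_eq_hull_vertices[OF assms(1)] affine_hull_convex_hull by metis
  ultimately show ?thesis using affine_hull_subset_span[of "vertices P"] by auto
qed

text \<open>The indices are shifted by one, \<open>G i\<close> having dimension \<open>i - 1\<close>, so that the empty face starts the flag and
the diamond condition at a vertex needs no separate treatment.\<close>

lemma full_flag_exists:
  fixes P :: "'a::euclidean_space set"
  assumes "polytope P" "aff_dim P = int d"
  shows "\<exists>G. G (d + 1) = P \<and> (\<forall>i\<le>d + 1. G i face_of P \<and> aff_dim (G i) = int i - 1) \<and>
    (\<forall>i\<le>d. G i \<subseteq> G (i + 1))"
  using assms
proof (induction d arbitrary: P)
  case 0
  have "P face_of P" using 0 by (simp add: face_of_refl polytope_imp_convex)
  then show ?case using 0 by (intro exI[of _ "\<lambda>i. if i = 0 then {} else P"]) auto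
next
  case (Suc d)
  obtain F where F: "F facet_of P" using polytope_facet_exists[OF Suc.prems(1)] Suc.prems(2) by auto
  then have FP: "F face_of P" "aff_dim F = int d" "polytope F"
    using Suc.prems face_of_polytope_polytope by (auto simp: facet_of_def)
  obtain G where G: "G (d + 1) = F" "\<forall>i\<le>d + 1. G i face_of F \<and> aff_dim (G i) = int i - 1"
    "\<forall>i\<le>d. G i \<subseteq> G (i + 1)"
    using Suc.IH[OF FP(3,2)] by blast
  have PP: "P face_of P" using Suc.prems by (simp add: face_of_refl polytope_imp_convex)
  define G' where "G' = G(d + 2 := P)"
  have "G' (Suc d + 1) = P" by (simp add: G'_def)
  moreover have "\<forall>i\<le>Suc d + 1. G' i face_of P \<and> aff_dim (G' i) = int i - 1"
    using G(2) face_of_trans[OF _ FP(1)] PP Suc.prems(2) by (auto simp: G'_def le_Suc_eq)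
  moreover have "\<forall>i\<le>Suc d. G' i \<subseteq> G' (i + 1)"
    using G(1,3) face_of_imp_subset[OF FP(1)] by (auto simp: G'_def le_Suc_eq)
  ultimately show ?case by blast
qed

lemma flag_mono:
  fixes G :: "nat \<Rightarrow> 'a set"
  assumes "i \<le> j" "j \<le> d + 1" "\<And>i. i \<le> d \<Longrightarrow> G i \<subseteq> G (i + 1)"
  shows "G i \<subseteq> G j"
  using assms(1,2)
proof (induction j rule: nat_induct_at_least)
  case (Suc j)
  then show ?case using assms(3)[of j] by auto
qed simp

lemma face_of_if_center_in:
  assumes "polytope P" "F face_of P" "H face_of P" "H \<noteq> {}" "face_center H \<in> F"
  shows "H \<subseteq> F"
proof -
  have "polytope H" using assms face_of_polytope_polytope by blast
  then have "F \<inter> rel_interior H \<noteq> {}" using face_center_in_rel_interior assms by blast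
  then show ?thesis using subset_of_face_of[OF assms(2)] assms(3) face_of_imp_subset by blast
qed

lemma subface_eq_if_dim_ge:
  assumes "polytope P" "F face_of P" "H face_of P" "F \<subseteq> H" "aff_dim H \<le> aff_dim F"
  shows "F = H"
proof (rule ccontr)
  assume "F \<noteq> H"
  have "F face_of H" using face_of_subset[OF assms(2,4)] assms(3) face_of_imp_subset by blast
  moreover have "convex H" using assms(3) face_of_imp_convex by blast
  ultimately have "aff_dim F < aff_dim H" using face_of_aff_dim_lt \<open>F \<noteq> H\<close> by blast
  then show False using assms(5) by simp
qed

lemma face_of_larger_face: "F face_of P \<Longrightarrow> H face_of P \<Longrightarrow> F \<subseteq> H \<Longrightarrow> F face_of H"
  by (meson face_of_imp_subset face_of_subset)

text \<open>For a point \<open>x\<close> inside the cone over a flag, the inner product of \<open>x\<close> with the center of a facet is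
largest at the facet of the flag and at no other. Hence a symmetry that fixes \<open>x\<close> preserves this facet
and its center; removing the center from \<open>x\<close> leaves a point inside the cone over the flag of the facet.\<close>

lemma flag_fixed_by_symmetry:
  fixes P :: "'a::euclidean_space set"
  assumes P: "equiradial P" and GP: "G (d + 1) = P"
    and G: "\<And>i. i \<le> d + 1 \<Longrightarrow> G i face_of P" "\<And>i. i \<le> d + 1 \<Longrightarrow> aff_dim (G i) = int i - 1"
      "\<And>i. i \<le> d \<Longrightarrow> G i \<subseteq> G (i + 1)"
    and T: "orthogonal_transformation T" "T ` P = P"
    and t: "\<And>i. i < d \<Longrightarrow> 0 < t i"
    and fixed: "T (\<Sum>i<d. t i *\<^sub>R face_center (G (i + 1))) = (\<Sum>i<d. t i *\<^sub>R face_center (G (i + 1)))"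
    and k: "k < d"
  shows "T (face_center (G (k + 1))) = face_center (G (k + 1))"
proof -
  define f where "f i = face_center (G (i + 1))" for i
  have pP: "polytope P" using P equiradial_polytope by blast
  have lT: "linear T" using T orthogonal_transformation_linear by blast
  have mono: "G i \<subseteq> G j" if "i \<le> j" "j \<le> d + 1" for i j
    using flag_mono[of i j d G] G(3) that by blast
  have ne: "G (i + 1) \<noteq> {}" if "i \<le> d" for i using G(2)[of "i + 1"] that by auto
  have poly: "polytope (G i)" if "i \<le> d + 1" for i
    using G(1)[OF that] pP face_of_polytope_polytope by blast
  have f_in: "f i \<in> G j" if "i < j" "j \<le> d + 1" for i j
    using face_center_in[OF poly ne, of i] mono[of "i + 1" j] that unfolding f_def by auto
  have step: "T (f k) = f k" if k: "k < d" and inv: "T ` G (k + 2) = G (k + 2)"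
      "T (\<Sum>i<k + 1. t i *\<^sub>R f i) = (\<Sum>i<k + 1. t i *\<^sub>R f i)" for k
  proof -
    define \<rho> where "\<rho> = f k \<bullet> f k"
    have eF: "equiradial (G (k + 2))" using equiradial_face[OF P G(1)] k by simp
    have "G (k + 1) face_of G (k + 2)"
      by (rule face_of_larger_face[where P=P]) (use G(1)[of "k + 1"] G(3)[of "k + 1"] G(1)[of "k + 2"] k in auto)
    then have facet: "G (k + 1) facet_of G (k + 2)"
      using ne[of k] G(2)[of "k + 1"] G(2)[of "k + 2"] k by (simp add: facet_of_def)
    then have facetT: "T ` G (k + 1) facet_of G (k + 2)"
      using facet_of_image[OF T(1), of "G (k + 1)" "G (k + 2)"] inv(1) by simp
    have center: "face_center (T ` G (k + 1)) = T (f k)" by (simp add: face_center_image[OF T(1)] f_def)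
    have TT: "T (f k) \<bullet> T (f k) = \<rho>" using T(1) by (simp add: orthogonal_transformation_def \<rho>_def)
    have le: "f i \<bullet> T (f k) \<le> \<rho>" if "i < k + 1" for i
      using face_center_supports(1)[OF eF facetT, of "f i"] f_in[of i "k + 2"] that k center TT by simp
    have eq: "f i \<bullet> f k = \<rho>" if "i < k + 1" for i
      using face_center_supports(2)[OF eF facet, of "f i"] f_in[of i "k + 1"] f_in[of i "k + 2"] that k
      by (simp add: f_def \<rho>_def)
    have "(\<Sum>i<k + 1. t i * (f i \<bullet> f k)) = (\<Sum>i<k + 1. t i *\<^sub>R f i) \<bullet> f k"
      by (simp add: inner_sum_left inner_add_left)
    also have "\<dots> = T (\<Sum>i<k + 1. t i *\<^sub>R f i) \<bullet> T (f k)"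
      using T(1) by (simp only: orthogonal_transformation_def)
    also have "\<dots> = (\<Sum>i<k + 1. t i * (f i \<bullet> T (f k)))"
      unfolding inv(2) by (simp add: inner_sum_left inner_add_left)
    finally have "(\<Sum>i<k + 1. t i * (f i \<bullet> f k)) = (\<Sum>i<k + 1. t i * (f i \<bullet> T (f k)))" .
    then have "(\<Sum>i<k + 1. t i * (\<rho> - f i \<bullet> T (f k))) = 0"
      using eq by (simp add: right_diff_distrib sum_subtractf)
    moreover have "0 \<le> t i * (\<rho> - f i \<bullet> T (f k))" if "i \<in> {..<k + 1}" for i
      using le[of i] t[of i] that k by simp
    ultimately have "t k * (\<rho> - f k \<bullet> T (f k)) = 0"
      using sum_nonneg_eq_0_iff[of "{..<k + 1}" "\<lambda>i. t i * (\<rho> - f i \<bullet> T (f k))"] by simp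
    then have "f k \<bullet> T (f k) = \<rho>" using t[OF k] by simp
    then have "(T (f k) - f k) \<bullet> (T (f k) - f k) = 0"
      using TT by (simp add: inner_diff inner_commute \<rho>_def)
    then show ?thesis by simp
  qed
  have all: "T ` G (d - m + 1) = G (d - m + 1) \<and> T (\<Sum>i<d - m. t i *\<^sub>R f i) = (\<Sum>i<d - m. t i *\<^sub>R f i)"
    if "m \<le> d" for m
    using that
  proof (induction m)
    case 0
    then show ?case using T(2) GP fixed by (simp add: f_def)
  next
    case (Suc m)
    define k where "k = d - Suc m"
    have k: "k < d" "d - m = k + 1" using Suc.prems by (auto simp: k_def)
    have IH: "T ` G (k + 2) = G (k + 2)" "T (\<Sum>i<k + 1. t i *\<^sub>R f i) = (\<Sum>i<k + 1. t i *\<^sub>R f i)"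
      using Suc k by auto
    have Tf: "T (f k) = f k" by (rule step[OF k(1) IH])
    have faces: "G (k + 1) face_of P" "T ` G (k + 1) face_of P"
      using G(1)[of "k + 1"] k face_of_image[OF T(1), of "G (k + 1)" P] T(2) by auto
    have "T ` G (k + 1) = G (k + 1)"
      by (rule face_center_inj[OF pP faces(2,1)])
        (use ne[of k] k Tf in \<open>auto simp: face_center_image[OF T(1)] f_def\<close>)
    moreover have "T (\<Sum>i<k. t i *\<^sub>R f i) = (\<Sum>i<k. t i *\<^sub>R f i)"
      using IH(2) Tf by (simp add: linear_add[OF lT] linear_scale[OF lT])
    ultimately show ?case by (simp add: k_def)
  qed
  have "T (f k) = f k"
    using all[of "d - (k + 1)"] step[OF k] k by simp
  then show ?thesis by (simp add: f_def)
qed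

text \<open>The vector \<open>b i\<close> joins the center of the other \<open>i\<close>-face \<open>H i\<close> between \<open>G i\<close> and \<open>G (i + 2)\<close> to the center \<open>f i\<close>
of the \<open>i\<close>-face of the flag. Its mirror preserves \<open>G (i + 2)\<close> and extends step by step to \<open>P\<close>.\<close>

lemma equiradial_mirror_chain:
  fixes P :: "'a::euclidean_space set"
  assumes P: "equiradial P" and full: "aff_dim P = int DIM('a)" and V: "vertices P \<subseteq> sphere 0 1"
  obtains \<alpha> f where "mirror_chain DIM('a) (vertices P) \<alpha> f"
proof -
  define n where "n = DIM('a)"
  have pP: "polytope P" using P equiradial_polytope by blast
  obtain G where GP: "G (n + 1) = P" and
    G0: "\<forall>i\<le>n + 1. G i face_of P \<and> aff_dim (G i) = int i - 1" "\<forall>i\<le>n. G i \<subseteq> G (i + 1)"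
    using full_flag_exists[OF pP full] unfolding n_def by blast
  have G: "\<And>i. i \<le> n + 1 \<Longrightarrow> G i face_of P" "\<And>i. i \<le> n + 1 \<Longrightarrow> aff_dim (G i) = int i - 1"
      "\<And>i. i \<le> n \<Longrightarrow> G i \<subseteq> G (i + 1)"
    using G0 by auto
  have mono: "G i \<subseteq> G j" if "i \<le> j" "j \<le> n + 1" for i j
    using flag_mono[of i j n G] G(3) that by blast
  have ne: "G (i + 1) \<noteq> {}" if "i \<le> n" for i using G(2)[of "i + 1"] that by auto
  have poly: "polytope (G i)" if "i \<le> n + 1" for i
    using G(1)[OF that] pP face_of_polytope_polytope by blast
  have eq: "equiradial (G i)" if "i \<le> n + 1" for i
    using equiradial_face[OF P G(1)[OF that]] .
  have facetG: "G i facet_of G (i + 1)" if "0 < i" "i \<le> n" for i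
  proof -
    have "G i face_of G (i + 1)"
      by (rule face_of_larger_face[where P=P]) (use G(1)[of i] G(3)[of i] G(1)[of "i + 1"] that in auto)
    then show ?thesis using ne[of "i - 1"] that G(2)[of i] G(2)[of "i + 1"] by (simp add: facet_of_def)
  qed
  have "\<exists>H. H face_of P \<and> H \<noteq> G (i + 1) \<and> G i \<subseteq> H \<and> H \<subseteq> G (i + 2) \<and> aff_dim H = aff_dim (G (i + 1))"
    if i: "i < n" for i
    by (rule other_face_in_diamond[OF P, of "G i" "G (i + 1)" "G (i + 2)"])
      (use G(1)[of i] G(1)[of "i + 1"] G(1)[of "i + 2"] G(3)[of i] G(3)[of "i + 1"]
         G(2)[of i] G(2)[of "i + 1"] G(2)[of "i + 2"] i in auto)
  then obtain H where H: "\<And>i. i < n \<Longrightarrow> H i face_of P" "\<And>i. i < n \<Longrightarrow> H i \<noteq> G (i + 1)"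
     "\<And>i. i < n \<Longrightarrow> G i \<subseteq> H i" "\<And>i. i < n \<Longrightarrow> H i \<subseteq> G (i + 2)"
     "\<And>i. i < n \<Longrightarrow> aff_dim (H i) = aff_dim (G (i + 1))" by metis
  have dimH: "aff_dim (H i) = int i" if "i < n" for i using H(5)[OF that] G(2)[of "i + 1"] that by simp
  have neH: "H i \<noteq> {}" if "i < n" for i using dimH[OF that] by auto
  have facetH: "H i facet_of G (i + 2)" if i: "i < n" for i
  proof -
    have "H i face_of G (i + 2)"
      by (rule face_of_larger_face[where P=P]) (use H(1)[OF i] H(4)[OF i] G(1)[of "i + 2"] i in auto)
    then show ?thesis using neH[OF i] dimH[OF i] G(2)[of "i + 2"] i by (simp add: facet_of_def)
  qed
  define f where "f i = face_center (G (i + 1))" for i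
  define h where "h i = face_center (H i)" for i
  have f_in: "f i \<in> G j" if "i < j" "j \<le> n + 1" for i j
    using face_center_in[OF poly ne, of i] mono[of "i + 1" j] that unfolding f_def by auto
  have h_inH: "h i \<in> H i" if "i < n" for i
    unfolding h_def using face_center_in face_of_polytope_polytope[OF pP H(1)] neH that by blast
  have h_in: "h i \<in> G j" if "i + 1 < j" "j \<le> n + 1" for i j
    using h_inH[of i] H(4)[of i] mono[of "i + 2" j] that by auto
  have perpG: "x \<bullet> f i = f i \<bullet> f i" if "x \<in> G (i + 1)" "i \<le> n" for x i
    using equiradial_perpendicular_center[OF eq ne] that unfolding perpendicular_center_def f_def by simp
  have perpH: "x \<bullet> h i = h i \<bullet> h i" if "x \<in> H i" "i < n" for x i
    using equiradial_perpendicular_center[OF equiradial_face[OF P H(1)] neH] that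
    unfolding perpendicular_center_def h_def by simp
  have hh: "h i \<bullet> h i = f i \<bullet> f i" if i: "i < n" for i
    using equiradial_radius[OF P H(1)[OF i] G(1)[of "i + 1"] neH[OF i] ne[of i] H(5)[OF i]] i norm_eq_imp_inner
    unfolding h_def f_def by simp
  have hf_ne: "h i \<noteq> f i" if i: "i < n" for i
    using face_center_inj[OF pP H(1)[OF i] G(1)[of "i + 1"] neH[OF i] ne[of i]] H(2)[OF i] i
    unfolding h_def f_def by auto
  define b where "b i = f i - h i" for i
  have b_perp: "b i \<bullet> x = 0" if "x \<in> G i" "i < n" for i x
  proof -
    have "x \<bullet> f i = f i \<bullet> f i" "x \<bullet> h i = h i \<bullet> h i"
      using perpG[of x i] perpH[of x i] that G(3)[of i] H(3)[of i] by auto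
    then show ?thesis using hh[OF that(2)] by (simp add: b_def inner_diff_right inner_commute)
  qed
  have b_f: "b i \<bullet> f j = 0" if "i < n" "j < n" "i \<noteq> j" for i j
  proof (cases "j < i")
    case True
    then show ?thesis using b_perp f_in that by simp
  next
    case False
    then have "f i \<in> G (j + 1)" "h i \<in> G (j + 1)" using f_in[of i "j + 1"] h_in[of i "j + 1"] that by auto
    then show ?thesis using perpG[of _ j] that by (simp add: b_def inner_diff_left)
  qed
  have b_fi: "0 < b i \<bullet> f i" and b_ne: "b i \<noteq> 0" if i: "i < n" for i
  proof -
    show ne0: "b i \<noteq> 0" using hf_ne[OF i] by (simp add: b_def)
    have "b i \<bullet> b i = 2 * (b i \<bullet> f i)" using hh[OF i] by (simp add: b_def inner_diff inner_commute)
    moreover have "0 < b i \<bullet> b i" using ne0 by simp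
    ultimately show "0 < b i \<bullet> f i" by simp
  qed
  have b_far: "b i \<bullet> b j = 0" if "i + 1 < j" "j < n" for i j
    using b_perp[OF f_in[of i j] that(2)] b_perp[OF h_in[of i j] that(2)] that
    by (simp add: b_def[of i] inner_diff_right inner_commute)
  have b_near: "b i \<bullet> b (i + 1) < 0" if i: "i + 1 < n" for i
  proof -
    \<comment> \<open>Otherwise \<open>G (i + 1)\<close> and \<open>H i\<close> would both be the intersection of the distinct facets \<open>G (i + 2)\<close> and
      \<open>H (i + 1)\<close> of \<open>G (i + 3)\<close>.\<close>
    have "h i \<notin> H (i + 1)"
    proof
      assume "h i \<in> H (i + 1)"
      then have sub: "H i \<subseteq> G (i + 2) \<inter> H (i + 1)"
        using face_of_if_center_in[OF pP H(1) H(1) neH] i H(4)[of i] unfolding h_def by auto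
      let ?X = "G (i + 2) \<inter> H (i + 1)"
      have X: "?X face_of P" using G(1)[of "i + 2"] H(1)[of "i + 1"] i by (simp add: face_of_Int)
      have "aff_dim ?X \<le> aff_dim (G (i + 3)) - 2"
        using distinct_facets_Int_dim[of "G (i + 3)" "G (i + 2)" "H (i + 1)"]
          facetG[of "i + 2"] facetH[of "i + 1"] H(2)[of "i + 1"] poly[of "i + 3"] i
        by (simp add: numeral_3_eq_3)
      then have dX: "aff_dim ?X \<le> int i" using G(2)[of "i + 3"] i by simp
      have "H i = ?X"
        by (rule subface_eq_if_dim_ge[OF pP H(1) X sub]) (use dX dimH[of i] i in auto)
      moreover have "G (i + 1) = ?X"
        by (rule subface_eq_if_dim_ge[OF pP G(1) X])
          (use dX G(2)[of "i + 1"] G(3)[of "i + 1"] H(3)[of "i + 1"] i in auto)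
      ultimately show False using H(2)[of i] i by simp
    qed
    then have "h i \<bullet> h (i + 1) \<noteq> h (i + 1) \<bullet> h (i + 1)" "h i \<bullet> h (i + 1) \<le> h (i + 1) \<bullet> h (i + 1)"
      using face_center_supports[OF eq[of "i + 3"], of "H (i + 1)" "h i"]
        facetH[of "i + 1"] h_in[of i "i + 3"] i unfolding h_def
      by (simp_all add: numeral_3_eq_3)
    then have lt: "h i \<bullet> h (i + 1) < f (i + 1) \<bullet> f (i + 1)" using hh[OF i] by simp
    have "h i \<bullet> f (i + 1) = f (i + 1) \<bullet> f (i + 1)" using perpG[of "h i" "i + 1"] h_in[of i "i + 2"] i by simp
    moreover have "b (i + 1) \<bullet> f i = 0" using b_perp[OF f_in[of i "i + 1"] i] i by simp
    moreover have "b i \<bullet> b (i + 1) = b (i + 1) \<bullet> f i - (h i \<bullet> f (i + 1) - h i \<bullet> h (i + 1))"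
      by (simp add: b_def inner_diff inner_commute)
    ultimately have "b i \<bullet> b (i + 1) = h i \<bullet> h (i + 1) - f (i + 1) \<bullet> f (i + 1)" by linarith
    then show ?thesis using lt by simp
  qed
  have b_sym: "mirror (b i) ` P = P" if i: "i < n" for i
  proof -
    have "mirror (b i) ` G j = G j" if "i + 2 \<le> j" "j \<le> n + 1" for j
      using that
    proof (induction j rule: nat_induct_at_least)
      case base
      have "G i face_of G (i + 2)"
        by (rule face_of_larger_face[where P=P]) (use G(1)[of i] mono[of i "i + 2"] G(1)[of "i + 2"] i in auto)
      then have "mirror (h i - f i) ` G (i + 2) = G (i + 2)"
        unfolding h_def f_def
        using mirror_swaps_adjacent_facets[OF eq equiradial_perpendicular_faces[OF eq], of "i + 2" "G (i + 1)" "H i" "G i"]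
          facetG[of "i + 1"] facetH[OF i] H(2,3)[OF i] G(3)[of i] G(2)[of i] G(2)[of "i + 2"] i by simp
      then show ?case by (simp add: b_def mirror_minus_commute[of "f i"])
    next
      case (Suc j)
      have "f i \<in> G j" "h i \<in> G j" using f_in[of i j] h_in[of i j] Suc by auto
      then have "b i \<in> dirspan (G j)" unfolding dirspan_def b_def by (intro span_base) blast
      then show ?case
        using mirror_extends_from_facet[OF eq equiradial_perpendicular_faces[OF eq], of "Suc j" "G j"]
          facetG[of j] Suc by simp
    qed
    from this[of "n + 1"] show ?thesis using GP i by simp
  qed
  define \<alpha> where "\<alpha> i = (1 / norm (b i)) *\<^sub>R b i" for i
  have mirror_\<alpha>: "mirror (\<alpha> i) = mirror (b i)" if "i < n" for i
    unfolding \<alpha>_def using b_ne[OF that] by (intro mirror_scale) simp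
  have \<alpha>_sym: "mirror (\<alpha> i) ` vertices P = vertices P" if "i < n" for i
    using symmetry_of_vertices[OF pP orthogonal_transformation_mirror] b_sym[OF that] mirror_\<alpha>[OF that] by simp
  have \<alpha>_f: "\<alpha> i \<bullet> f j = 0" if "i < n" "j < n" "i \<noteq> j" for i j using b_f[OF that] by (simp add: \<alpha>_def)
  have \<alpha>_fi: "0 < \<alpha> i \<bullet> f i" if "i < n" for i using b_fi[OF that] b_ne[OF that] by (simp add: \<alpha>_def)
  have "0 < n" by (simp add: n_def)
  have center0: "f n = 0" unfolding f_def GP using full_dim_center_zero[OF P full] .
  have f0V: "f 0 \<in> vertices P"
  proof -
    have "aff_dim (G 1) = 0" using G(2)[of 1] \<open>0 < n\<close> by simp
    then obtain v where v: "G 1 = {v}" by (metis aff_dim_eq_0)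
    then have "{v} face_of P" using G(1)[of 1] by simp
    moreover have "f 0 = v" using f_in[of 0 1] v \<open>0 < n\<close> by simp
    ultimately show ?thesis by (simp add: vertices_def face_of_singleton)
  qed
  have norm_f0: "norm (f 0) = 1" using f0V V by auto
  have f_step: "f i \<notin> G i" if "i \<le> n" for i
  proof -
    have "G i face_of G (i + 1)"
      by (rule face_of_larger_face[where P=P]) (use G(1)[of i] G(3)[of i] G(1)[of "i + 1"] that in auto)
    moreover have "G i \<noteq> G (i + 1)" using G(2)[of i] G(2)[of "i + 1"] that by auto
    ultimately show ?thesis unfolding f_def using face_center_notin_face[OF poly[of "i + 1"]] ne[of i] that by simp
  qed
  have norm_f: "norm (f i) < 1" if i: "0 < i" "i < n" for i
  proof -
    have "f 0 \<noteq> f i" using f_in[of 0 i] f_step[of i] i by auto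
    then have "0 < (f 0 - f i) \<bullet> (f 0 - f i)" by simp
    moreover have "f 0 \<bullet> f i = f i \<bullet> f i" using perpG[OF f_in[of 0 "i + 1"]] i by simp
    moreover have "f 0 \<bullet> f 0 = 1" using norm_f0 by (simp add: norm_eq_1)
    ultimately have "f i \<bullet> f i < 1" by (simp add: inner_diff inner_commute)
    then show ?thesis by (simp add: norm_eq_sqrt_inner)
  qed
  have span_\<alpha>: "span (\<alpha> ` {..<n}) = UNIV"
    unfolding n_def using \<alpha>_f \<alpha>_fi
    by (intro dual_family_spans[of f]) (auto simp: n_def less_le inner_commute)
  have dominant: "u = f 0" if u: "u \<in> vertices P" "\<And>i. i < n \<Longrightarrow> 0 \<le> u \<bullet> \<alpha> i" for u
  proof -
    define a where "a i = (u \<bullet> \<alpha> i) / (\<alpha> i \<bullet> f i)" for i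
    have a: "0 \<le> a i" if "i < n" for i using u(2)[OF that] \<alpha>_fi[OF that] by (simp add: a_def)
    have "u - (\<Sum>i<n. a i *\<^sub>R f i) = 0"
    proof (rule zero_if_orthogonal_to_spanning[OF span_\<alpha>])
      fix y assume "y \<in> \<alpha> ` {..<n}"
      then obtain k where k: "k < n" "y = \<alpha> k" by auto
      have "(\<Sum>i<n. a i *\<^sub>R f i) \<bullet> \<alpha> k = (\<Sum>i<n. if i = k then a k * (\<alpha> k \<bullet> f k) else 0)"
        unfolding inner_sum_left by (rule sum.cong) (use \<alpha>_f k in \<open>auto simp: inner_commute\<close>)
      also have "\<dots> = u \<bullet> \<alpha> k" using \<alpha>_fi[OF k(1)] k by (simp add: a_def)
      finally show "(u - (\<Sum>i<n. a i *\<^sub>R f i)) \<bullet> y = 0" by (simp add: inner_diff_left k)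
    qed
    then have u_eq: "u = (\<Sum>i<n. a i *\<^sub>R f i)" by simp
    \<comment> \<open>The facet center \<open>f (n - 1)\<close> bounds the sum of the coordinates of \<open>u\<close> by \<open>1\<close>. Since \<open>u\<close> is a unit vector
      and all \<open>f i\<close> except \<open>f 0\<close> are shorter, only the coordinate of \<open>f 0\<close> survives.\<close>
    define \<rho> where "\<rho> = f (n - 1) \<bullet> f (n - 1)"
    have "f n \<notin> G n" using f_step by simp
    then have "f (n - 1) \<noteq> 0" using center0 f_in[of "n - 1" n] \<open>0 < n\<close> by auto
    then have \<rho>: "0 < \<rho>" by (simp add: \<rho>_def)
    have "f i \<bullet> f (n - 1) = \<rho>" if "i < n" for i
      unfolding \<rho>_def using perpG[of "f i" "n - 1"] f_in[of i n] that \<open>0 < n\<close> by simp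
    then have "u \<bullet> f (n - 1) = (\<Sum>i<n. a i) * \<rho>"
      by (simp add: u_eq inner_sum_left sum_distrib_right)
    moreover have "u \<bullet> f (n - 1) \<le> \<rho>"
    proof -
      have "u \<in> P" using u(1) by (simp add: vertices_def extreme_point_of_def)
      then show ?thesis
        using face_center_supports(1)[OF P, of "G n" u] facetG[of n] GP \<open>0 < n\<close> by (simp add: \<rho>_def f_def)
    qed
    ultimately have sum_a: "(\<Sum>i<n. a i) \<le> 1" using \<rho> by simp
    have "norm u = 1" using u(1) V by auto
    then have "1 \<le> (\<Sum>i<n. a i * norm (f i))"
      using norm_sum[of "\<lambda>i. a i *\<^sub>R f i" "{..<n}"] a unfolding u_eq by simp
    then have "(\<Sum>i<n. a i * (1 - norm (f i))) \<le> 0"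
      using sum_a by (simp add: right_diff_distrib sum_subtractf)
    moreover have nn: "0 \<le> a i * (1 - norm (f i))" if "i \<in> {..<n}" for i
      using a[of i] norm_f[of i] norm_f0 that by (cases "i = 0") auto
    moreover have "0 \<le> (\<Sum>i<n. a i * (1 - norm (f i)))" using nn by (rule sum_nonneg)
    ultimately have "(\<Sum>i<n. a i * (1 - norm (f i))) = 0" by linarith
    then have zero: "a i * (1 - norm (f i)) = 0" if "i < n" for i
      using sum_nonneg_eq_0_iff[of "{..<n}" "\<lambda>i. a i * (1 - norm (f i))"] nn that by simp
    have "a i = 0" if "0 < i" "i < n" for i using zero[OF that(2)] norm_f[OF that] by simp
    then have "u = (\<Sum>i<n. if i = 0 then a 0 *\<^sub>R f 0 else 0)"
      by (subst u_eq, intro sum.cong) auto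
    then have u0: "u = a 0 *\<^sub>R f 0" using \<open>0 < n\<close> by simp
    then have "norm (a 0 *\<^sub>R f 0) = 1" using \<open>norm u = 1\<close> by (simp only:)
    then have "a 0 = 1" using norm_f0 a[OF \<open>0 < n\<close>] by simp
    then show ?thesis using u0 by simp
  qed
  have chamber: "(\<forall>i<n. 0 \<le> \<gamma> \<bullet> f i) \<or> (\<forall>i<n. \<gamma> \<bullet> f i \<le> 0)"
    if \<gamma>: "mirror \<gamma> ` vertices P = vertices P" for \<gamma>
  proof (rule ccontr)
    assume "\<not> ?thesis"
    then obtain p q where p: "p < n" "0 < \<gamma> \<bullet> f p" and q: "q < n" "\<gamma> \<bullet> f q < 0" by (auto simp: not_le)
    \<comment> \<open>A mirror with centers on both sides contains a point inside the cone: increase the weight of a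
      center on the lighter side.\<close>
    define S where "S = (\<Sum>i<n. \<gamma> \<bullet> f i)"
    have "\<exists>m<n. \<exists>r\<ge>0. S + r * (\<gamma> \<bullet> f m) = 0"
    proof (cases "S \<le> 0")
      case True
      then have "S + (- S / (\<gamma> \<bullet> f p)) * (\<gamma> \<bullet> f p) = 0" "0 \<le> - S / (\<gamma> \<bullet> f p)"
        using p by (auto simp: divide_le_0_iff)
      then show ?thesis using p(1) by blast
    next
      case False
      then have "S + (- S / (\<gamma> \<bullet> f q)) * (\<gamma> \<bullet> f q) = 0" "0 \<le> - S / (\<gamma> \<bullet> f q)"
        using q by (auto simp: divide_le_0_iff)
      then show ?thesis using q(1) by blast
    qed
    then obtain m r where mr: "m < n" "0 \<le> r" "S + r * (\<gamma> \<bullet> f m) = 0" by auto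
    define t where "t i = 1 + (if i = m then r else 0)" for i
    have "(\<Sum>i<n. t i *\<^sub>R f i) \<bullet> \<gamma> = (\<Sum>i<n. (\<gamma> \<bullet> f i) + (if i = m then r * (\<gamma> \<bullet> f m) else 0))"
      unfolding inner_sum_left by (rule sum.cong) (auto simp: t_def inner_commute algebra_simps)
    also have "\<dots> = 0" using mr by (simp add: sum.distrib S_def)
    finally have fixed: "mirror \<gamma> (\<Sum>i<n. t i *\<^sub>R f i) = (\<Sum>i<n. t i *\<^sub>R f i)" by (rule mirror_fixes)
    have "mirror \<gamma> ` P = P"
      using symmetry_of_vertices[OF pP orthogonal_transformation_mirror] \<gamma> by blast
    then have "mirror \<gamma> (f p) = f p"
      using flag_fixed_by_symmetry[OF P GP G orthogonal_transformation_mirror _ _ _ p(1), of \<gamma> t]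
        fixed mr(2) unfolding f_def t_def by simp
    then show False using p by (auto simp: mirror_eq_self_iff inner_commute)
  qed
  have "mirror_chain n (vertices P) \<alpha> f"
  proof
    show "n = DIM('a)" by (simp add: n_def)
    show "finite (vertices P)" using pP by (rule finite_vertices)
    show "span (vertices P) = UNIV" using full_dim_vertices_span[OF pP full] .
    show "\<alpha> i \<bullet> \<alpha> i = 1" if "i < n" for i
      using b_ne[OF that] by (simp add: \<alpha>_def dot_square_norm power2_eq_square)
    show "\<alpha> i \<bullet> \<alpha> j = 0" if "i + 1 < j" "j < n" for i j using b_far[OF that] by (simp add: \<alpha>_def)
    show "\<alpha> i \<bullet> \<alpha> (i + 1) < 0" if "i + 1 < n" for i
      using b_near[OF that] b_ne[of i] b_ne[of "i + 1"] that
      by (simp add: \<alpha>_def divide_less_0_iff zero_less_mult_iff)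
  qed (use \<alpha>_f \<alpha>_fi \<alpha>_sym chamber f0V dominant in blast)+
  then show ?thesis using that unfolding n_def by blast
qed

section \<open>Polygons\<close>

context mirror_chain
begin

lemma uminus_image_if_antipode:
  assumes "- f 0 \<in> V"
  shows "uminus ` V = V"
proof -
  have "- u \<in> V" if u: "u \<in> V" for u
  proof -
    obtain T where T: "orthogonal_transformation T" "T ` V = V" "T (f 0) = u" by (rule transitive[OF u])
    have "T (- f 0) = - u" using T linear_neg orthogonal_transformation_linear by metis
    then show ?thesis using T(2) assms by (metis imageI)
  qed
  then show ?thesis by (metis (no_types, lifting) image_iff minus_minus subsetI subset_antisym image_subset_iff)
qed

lemma inner_products_at_base:
  "{u \<bullet> v |u v. u \<in> V \<and> v \<in> V \<and> u \<noteq> v} = (\<lambda>u. u \<bullet> f 0) ` (V - {f 0})"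
proof
  show "(\<lambda>u. u \<bullet> f 0) ` (V - {f 0}) \<subseteq> {u \<bullet> v |u v. u \<in> V \<and> v \<in> V \<and> u \<noteq> v}"
    using base by blast
  show "{u \<bullet> v |u v. u \<in> V \<and> v \<in> V \<and> u \<noteq> v} \<subseteq> (\<lambda>u. u \<bullet> f 0) ` (V - {f 0})"
  proof clarify
    fix u v assume uv: "u \<in> V" "v \<in> V" "u \<noteq> v"
    obtain T where T: "orthogonal_transformation T" "T ` V = V" "T (f 0) = v" by (rule transitive[OF uv(2)])
    obtain u' where u': "u' \<in> V" "u = T u'" using T(2) uv(1) by blast
    have "u \<bullet> v = u' \<bullet> f 0" using T u' by (simp add: orthogonal_transformation_def flip: T(3))
    moreover have "u' \<noteq> f 0" using uv(3) u' T(3) by auto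
    ultimately show "u \<bullet> v \<in> (\<lambda>u. u \<bullet> f 0) ` (V - {f 0})" using u' by blast
  qed
qed

text \<open>The only unit vectors on the mirror of \<open>\<alpha> 1\<close> are \<open>f 0\<close> and \<open>- f 0\<close>. So every inner product of \<open>f 0\<close> with
another vertex is attained at exactly two vertices, which this mirror exchanges.\<close>

lemma polygon_inner_products:
  assumes n: "n = 2" and sphere: "V \<subseteq> sphere 0 1" and sum: "(\<Sum>u\<in>V. u) = 0"
    and antipode: "- f 0 \<notin> V"
  defines "T \<equiv> {u \<bullet> v |u v. u \<in> V \<and> v \<in> V \<and> u \<noteq> v}"
  shows "sum (\<lambda>t. t) T = - 1 / 2" and "card V = 2 * card T + 1"
proof -
  define v s where "v = f 0" and "s = mirror (\<alpha> 1)"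
  have vV: "v \<in> V" using base by (simp add: v_def)
  have sq: "u \<bullet> u = 1" if "u \<in> V" for u using sphere that by (auto simp: norm_eq_1)
  have \<alpha>v: "\<alpha> 1 \<bullet> v = 0" using dual[of 1 0] n by (simp add: v_def)
  have \<alpha>1: "\<alpha> 1 \<bullet> \<alpha> 1 = 1" using unit[of 1] n by simp
  have decomp: "u = (u \<bullet> v) *\<^sub>R v + (u \<bullet> \<alpha> 1) *\<^sub>R \<alpha> 1" for u
  proof -
    define x where "x = u - ((u \<bullet> v) *\<^sub>R v + (u \<bullet> \<alpha> 1) *\<^sub>R \<alpha> 1)"
    have "x \<bullet> v = 0" using sq[OF vV] \<alpha>v by (simp add: x_def inner_diff_left inner_add_left)
    then have "co 0 x = 0" by (simp add: co_def v_def)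
    then have "x = co 1 x *\<^sub>R \<alpha> 1" using expansion[of x] by (simp add: n numeral_2_eq_2)
    moreover have "x \<bullet> \<alpha> 1 = 0"
      using \<alpha>1 \<alpha>v by (simp add: x_def inner_diff inner_add inner_commute)
    ultimately have "x = 0" using \<alpha>1 by (metis inner_scaleR_left mult.right_neutral scaleR_zero_left)
    then show ?thesis by (simp add: x_def)
  qed
  have s: "s u = u - (2 * (u \<bullet> \<alpha> 1)) *\<^sub>R \<alpha> 1" for u unfolding s_def using n by (simp add: mirror_unit)
  have sV: "s u \<in> V" if "u \<in> V" for u using sym[of 1] n that unfolding s_def by auto
  have sv: "s u \<bullet> v = u \<bullet> v" for u using \<alpha>v by (simp add: s inner_diff_left)
  have coord: "(u \<bullet> \<alpha> 1)\<^sup>2 = 1 - (u \<bullet> v)\<^sup>2" if "u \<in> V" for u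
  proof -
    have "u \<bullet> u = (u \<bullet> v) * (u \<bullet> v) + (u \<bullet> \<alpha> 1) * (u \<bullet> \<alpha> 1)"
      by (subst (2) decomp) (simp add: inner_add_right)
    then show ?thesis using sq[OF that] by (simp add: power2_eq_square)
  qed
  have fiber: "{u' \<in> V - {v}. u' \<bullet> v = u \<bullet> v} = {u, s u} \<and> u \<noteq> s u" if u: "u \<in> V - {v}" for u
  proof -
    have \<alpha>ne: "\<alpha> 1 \<noteq> 0" using \<alpha>1 by auto
    have "u \<bullet> \<alpha> 1 \<noteq> 0"
    proof
      assume "u \<bullet> \<alpha> 1 = 0"
      then have "(u \<bullet> v)\<^sup>2 = 1" "u = (u \<bullet> v) *\<^sub>R v" using coord[of u] u decomp[of u] by auto
      then have "u = v \<or> u = - v" by (metis power2_eq_1_iff scaleR_minus1_left scaleR_one)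
      then show False using u antipode by (auto simp: v_def)
    qed
    then have ne: "u \<noteq> s u" using \<alpha>ne by (auto simp: s)
    have "s v = v" using \<alpha>v by (simp add: s inner_commute)
    then have "s u \<noteq> v" using u by (metis DiffD2 insertI1 mirror_involution s_def)
    then have sub: "{u, s u} \<subseteq> {u' \<in> V - {v}. u' \<bullet> v = u \<bullet> v}" using u sV sv by auto
    have "u' = u \<or> u' = s u" if u': "u' \<in> V" "u' \<bullet> v = u \<bullet> v" for u'
    proof -
      have "(u' \<bullet> \<alpha> 1)\<^sup>2 = (u \<bullet> \<alpha> 1)\<^sup>2" using coord[OF u'(1)] coord[of u] u u'(2) by simp
      then have "u' \<bullet> \<alpha> 1 = u \<bullet> \<alpha> 1 \<or> u' \<bullet> \<alpha> 1 = - (u \<bullet> \<alpha> 1)" by (simp add: power2_eq_iff)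
      then show ?thesis
      proof
        assume "u' \<bullet> \<alpha> 1 = u \<bullet> \<alpha> 1"
        then show ?thesis using decomp[of u] decomp[of u'] u'(2) by simp
      next
        assume neg: "u' \<bullet> \<alpha> 1 = - (u \<bullet> \<alpha> 1)"
        have "s u \<bullet> \<alpha> 1 = - (u \<bullet> \<alpha> 1)" using \<alpha>1 by (simp add: s inner_diff_left)
        then have "u' = s u" using decomp[of "s u"] decomp[of u'] u'(2) sv[of u] neg by simp
        then show ?thesis ..
      qed
    qed
    then show ?thesis using sub ne by blast
  qed
  have T: "T = (\<lambda>u. u \<bullet> v) ` (V - {v})"
    unfolding T_def v_def by (rule inner_products_at_base)
  have fin: "finite (V - {v})" using finV by simp
  have two: "card {u \<in> V - {v}. u \<bullet> v = t} = 2" if "t \<in> T" for t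
  proof -
    obtain u where u: "u \<in> V - {v}" "t = u \<bullet> v" using \<open>t \<in> T\<close> T by blast
    then show ?thesis using fiber[OF u(1)] by simp
  qed
  have "(\<Sum>u\<in>V - {v}. u \<bullet> v) = (\<Sum>t\<in>T. \<Sum>u\<in>{u \<in> V - {v}. u \<bullet> v = t}. u \<bullet> v)"
    unfolding T using sum.image_gen[OF fin, of "\<lambda>u. u \<bullet> v" "\<lambda>u. u \<bullet> v"] by simp
  also have "\<dots> = (\<Sum>t\<in>T. 2 * t)" using two by (intro sum.cong) auto
  finally have s1: "(\<Sum>u\<in>V - {v}. u \<bullet> v) = 2 * sum (\<lambda>t. t) T" by (simp add: sum_distrib_left)
  have "0 = (\<Sum>u\<in>V. u \<bullet> v)" using inner_sum_left[of "\<lambda>u. u" V v] sum by simp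
  also have "\<dots> = v \<bullet> v + (\<Sum>u\<in>V - {v}. u \<bullet> v)" using finV vV by (rule sum.remove)
  finally show "sum (\<lambda>t. t) T = - 1 / 2" using s1 sq[OF vV] by simp
  have "card (V - {v}) = (\<Sum>t\<in>T. \<Sum>u\<in>{u \<in> V - {v}. u \<bullet> v = t}. 1)"
    unfolding T using sum.image_gen[OF fin, of "\<lambda>u. 1::nat" "\<lambda>u. u \<bullet> v"] by simp
  also have "\<dots> = (\<Sum>t\<in>T. 2)" using two by (intro sum.cong) auto
  finally have "card (V - {v}) = 2 * card T" by simp
  then show "card V = 2 * card T + 1" using card_Suc_Diff1[OF finV vV] by simp
qed

end

section \<open>Chord lengths and inner products\<close>

definition inner_products :: "'a::euclidean_space set \<Rightarrow> real set" where
  "inner_products V = {u \<bullet> v |u v. u \<in> V \<and> v \<in> V \<and> u \<noteq> v}"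

lemma finite_inner_products: "finite V \<Longrightarrow> finite (inner_products V)"
proof -
  assume "finite V"
  then have "finite ((\<lambda>(u, v). u \<bullet> v) ` (V \<times> V))" by simp
  then show ?thesis by (rule rev_finite_subset) (auto simp: inner_products_def)
qed

lemma chord_lengths_unit_sphere:
  assumes V: "vertices P \<subseteq> sphere 0 1"
  shows "card (chord_lengths P) = card (inner_products (vertices P))"
    and "(\<Sum>l\<in>chord_lengths P. l\<^sup>2) = 2 * real (card (inner_products (vertices P)))
           - 2 * (\<Sum>t\<in>inner_products (vertices P). t)"
proof -
  define T where "T = inner_products (vertices P)"
  have dist: "dist u v = sqrt (2 - 2 * (u \<bullet> v))" "2 - 2 * (u \<bullet> v) \<ge> 0" if "u \<in> vertices P" "v \<in> vertices P" for u v
  proof -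
    have "u \<bullet> u = 1" "v \<bullet> v = 1" using V that by (auto simp: norm_eq_1)
    then have "(u - v) \<bullet> (u - v) = 2 - 2 * (u \<bullet> v)" by (simp add: inner_diff inner_commute)
    then show "dist u v = sqrt (2 - 2 * (u \<bullet> v))" "2 - 2 * (u \<bullet> v) \<ge> 0"
      by (simp add: dist_norm norm_eq_sqrt_inner, metis inner_ge_zero)
  qed
  have T: "t \<in> T \<Longrightarrow> 2 - 2 * t \<ge> 0" for t using dist(2) by (auto simp: T_def inner_products_def)
  have img: "chord_lengths P = (\<lambda>t. sqrt (2 - 2 * t)) ` T"
  proof (intro equalityI subsetI)
    fix l assume "l \<in> chord_lengths P"
    then obtain u v where "u \<in> vertices P" "v \<in> vertices P" "u \<noteq> v" "l = dist u v"
      unfolding chord_lengths_def by blast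
    then show "l \<in> (\<lambda>t. sqrt (2 - 2 * t)) ` T"
      using dist(1) unfolding T_def inner_products_def by blast
  next
    fix l assume "l \<in> (\<lambda>t. sqrt (2 - 2 * t)) ` T"
    then obtain u v where "u \<in> vertices P" "v \<in> vertices P" "u \<noteq> v" "l = sqrt (2 - 2 * (u \<bullet> v))"
      unfolding T_def inner_products_def by blast
    then show "l \<in> chord_lengths P"
      using dist(1)[of u v] unfolding chord_lengths_def by force
  qed
  have inj: "inj_on (\<lambda>t. sqrt (2 - 2 * t)) T" by (rule inj_onI) simp
  show "card (chord_lengths P) = card (inner_products (vertices P))"
    using img card_image[OF inj] by (simp add: T_def)
  have "(\<Sum>l\<in>chord_lengths P. l\<^sup>2) = (\<Sum>t\<in>T. 2 - 2 * t)"
    unfolding img sum.reindex[OF inj] by (rule sum.cong) (use T in auto)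
  then show "(\<Sum>l\<in>chord_lengths P. l\<^sup>2) = 2 * real (card (inner_products (vertices P)))
           - 2 * (\<Sum>t\<in>inner_products (vertices P). t)"
    by (simp add: T_def sum_subtractf sum_distrib_left)
qed

text \<open>Together with \<open>1\<close>, the inner product of a vertex with itself, the inner products are closed under
negation.\<close>

lemma sum_inner_products_symmetric:
  assumes fin: "finite V" and ne: "V \<noteq> {}" and sphere: "V \<subseteq> sphere 0 1" and sym: "uminus ` V = V"
  shows "(\<Sum>t\<in>inner_products V. t) = - 1"
proof -
  define T where "T = insert 1 (inner_products V)"
  have sq: "u \<bullet> u = 1" if "u \<in> V" for u using sphere that by (auto simp: norm_eq_1)
  have "1 \<notin> inner_products V"
  proof
    assume "1 \<in> inner_products V"
    then obtain u v where uv: "u \<in> V" "v \<in> V" "u \<noteq> v" "u \<bullet> v = 1" by (auto simp: inner_products_def)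
    then have "(u - v) \<bullet> (u - v) = 0" using sq by (simp add: inner_diff inner_commute)
    then show False using uv(3) by simp
  qed
  then have sumT: "(\<Sum>t\<in>T. t) = 1 + (\<Sum>t\<in>inner_products V. t)"
    using finite_inner_products[OF fin] by (simp add: T_def)
  have T_iff: "t \<in> T \<longleftrightarrow> (\<exists>u\<in>V. \<exists>v\<in>V. t = u \<bullet> v)" for t
    using ne sq unfolding T_def inner_products_def by fastforce
  have "- t \<in> T" if "t \<in> T" for t
  proof -
    obtain u v where uv: "u \<in> V" "v \<in> V" "t = u \<bullet> v" using \<open>t \<in> T\<close> T_iff by blast
    then have "- v \<in> V" "- t = u \<bullet> (- v)" using sym by auto
    then show ?thesis using T_iff uv(1) by blast
  qed
  then have "uminus ` T = T" by (force simp: image_iff)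
  then have "(\<Sum>t\<in>T. t) = (\<Sum>t\<in>uminus ` T. t)" by simp
  also have "\<dots> = - (\<Sum>t\<in>T. t)" by (subst sum.reindex) (auto simp: sum_negf)
  finally have "(\<Sum>t\<in>T. t) = 0" by simp
  then show ?thesis using sumT by simp
qed

section \<open>Counting edges\<close>

lemma even_card_fixpoint_free_involution:
  assumes "finite X" "\<And>x. x \<in> X \<Longrightarrow> g x \<in> X \<and> g (g x) = x \<and> g x \<noteq> x"
  shows "even (card X)"
  using assms
proof (induction "card X" arbitrary: X rule: less_induct)
  case less
  show ?case
  proof (cases "X = {}")
    case False
    then obtain x where x: "x \<in> X" by blast
    define Y where "Y = X - {x, g x}"
    have gx: "g x \<in> X" "g (g x) = x" "g x \<noteq> x" using less.prems(2)[OF x] by auto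
    have card: "card X = card Y + 2"
    proof -
      have "card Y = card X - card {x, g x}" unfolding Y_def using x gx by (intro card_Diff_subset) auto
      moreover have "card {x, g x} \<le> card X" using x gx less.prems(1) by (intro card_mono) auto
      ultimately show ?thesis using gx by simp
    qed
    have "even (card Y)"
    proof (rule less.hyps)
      show "card Y < card X" using card by simp
      show "finite Y" using less.prems(1) by (simp add: Y_def)
      show "g y \<in> Y \<and> g (g y) = y \<and> g y \<noteq> y" if "y \<in> Y" for y
        using less.prems(2)[of y] that gx unfolding Y_def by auto
    qed
    then show ?thesis using card by simp
  qed simp
qed

lemma orthogonal_transformation_uminus: "orthogonal_transformation (uminus :: 'a::euclidean_space \<Rightarrow> 'a)"
  by (simp add: orthogonal_transformation_def linear_iff)

text \<open>An edge equal to its own antipode would contain the center.\<close>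

lemma even_edges_if_centrally_symmetric:
  fixes P :: "'a::euclidean_space set"
  assumes P: "equiradial P" and full: "aff_dim P = int DIM('a)" and dim: "2 \<le> DIM('a)"
    and sym: "uminus ` P = P"
  shows "even (card {e. e edge_of P})"
proof (rule even_card_fixpoint_free_involution[where g = "image uminus"])
  have pP: "polytope P" using P equiradial_polytope by blast
  show "finite {e. e edge_of P}"
    by (rule finite_subset[OF _ finite_polytope_faces[OF pP]]) (auto simp: edge_of_def)
  fix e assume "e \<in> {e. e edge_of P}"
  then have e: "e face_of P" "aff_dim e = 1" by (auto simp: edge_of_def)
  have "uminus ` e face_of uminus ` P" using face_of_image[OF orthogonal_transformation_uminus] e(1) by blast
  then have "uminus ` e edge_of P"
    using e(2) sym aff_dim_image[OF orthogonal_transformation_uminus, of e] by (simp add: edge_of_def)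
  moreover have "uminus ` e \<noteq> e"
  proof
    assume eq: "uminus ` e = e"
    have "e \<noteq> {}" using e(2) by auto
    then obtain x where x: "x \<in> e" by blast
    then have "- x \<in> e" using eq by blast
    then have "(1 / 2) *\<^sub>R x + (1 / 2) *\<^sub>R (- x) \<in> e"
      using x face_of_imp_convex[OF e(1)] by (intro convexD) auto
    then have "face_center P \<in> e" using full_dim_center_zero[OF P full] by simp
    moreover have "e \<noteq> P" using e(2) full dim by auto
    moreover have "P \<noteq> {}" using full by auto
    ultimately show False using face_center_notin_face[OF pP e(1)] by blast
  qed
  ultimately show "uminus ` e \<in> {e. e edge_of P} \<and> uminus ` uminus ` e = e \<and> uminus ` e \<noteq> e"
    by (simp add: image_image)
qed

text \<open>Incident pairs of a vertex and an edge are counted in two ways; both diamond conditions give the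
factor \<open>2\<close>.\<close>

lemma polygon_edges_eq_vertices:
  fixes P :: "'a::euclidean_space set"
  assumes P: "equiradial P" and dim: "aff_dim P = 2"
  shows "card {e. e edge_of P} = card (vertices P)"
proof -
  have pP: "polytope P" using P equiradial_polytope by blast
  have PP: "P face_of P" using pP by (simp add: face_of_refl polytope_imp_convex)
  let ?E = "{e. e edge_of P}"
  have finE: "finite ?E"
    by (rule finite_subset[OF _ finite_polytope_faces[OF pP]]) (auto simp: edge_of_def)
  have "card {e \<in> ?E. v \<in> e} = 2" if "v \<in> vertices P" for v
  proof -
    have v: "{v} face_of P" using that by (simp add: vertices_def face_of_singleton)
    have "card {H. H face_of P \<and> aff_dim H = aff_dim {v} + 1 \<and> {v} \<subseteq> H \<and> H \<subseteq> P} = 2"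
      by (rule equiradial_diamond[OF P v PP]) (use dim face_of_imp_subset[OF v] in auto)
    moreover have "{H. H face_of P \<and> aff_dim H = aff_dim {v} + 1 \<and> {v} \<subseteq> H \<and> H \<subseteq> P} = {e \<in> ?E. v \<in> e}"
      by (auto simp: edge_of_def dest: subsetD[OF face_of_imp_subset])
    ultimately show ?thesis by simp
  qed
  moreover have "card {v \<in> vertices P. v \<in> e} = 2" if "e \<in> ?E" for e
  proof -
    have e: "e face_of P" "aff_dim e = 1" using that by (auto simp: edge_of_def)
    let ?H = "{H. H face_of P \<and> aff_dim H = aff_dim ({} :: 'a set) + 1 \<and> {} \<subseteq> H \<and> H \<subseteq> e}"
    have "card ?H = 2"
      by (rule equiradial_diamond[OF P empty_face_of e(1)]) (use e(2) in auto)
    moreover have "?H = (\<lambda>v. {v}) ` {v \<in> vertices P. v \<in> e}"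
      by (auto simp: aff_dim_eq_0 vertices_def face_of_singleton image_iff)
    ultimately show ?thesis by (simp add: card_image)
  qed
  ultimately have "(\<Sum>v\<in>vertices P. 2) = (\<Sum>e\<in>?E. 2::nat)"
    using sum_multicount_gen[OF finite_vertices[OF pP] finE, of "\<lambda>v e. v \<in> e" "\<lambda>_. 2"] by simp
  then show ?thesis by simp
qed

section \<open>Simplices\<close>

lemma simplex_if_few_vertices:
  fixes P :: "'a::euclidean_space set"
  assumes "polytope P" "aff_dim P = int DIM('a)" "card (vertices P) \<le> DIM('a) + 1"
  shows "int DIM('a) simplex P"
proof -
  have hull: "P = convex hull (vertices P)" by (rule polytope_eq_hull_vertices[OF assms(1)])
  have dim: "aff_dim (vertices P) = int DIM('a)"
    using assms(2) hull aff_dim_convex_hull by metis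
  have fin: "finite (vertices P)" by (rule finite_vertices[OF assms(1)])
  have "aff_dim (vertices P) \<le> int (card (vertices P)) - 1" by (rule aff_dim_le_card[OF fin])
  then have card: "int (card (vertices P)) = int DIM('a) + 1" using dim assms(3) by linarith
  then have "\<not> affine_dependent (vertices P)" unfolding affine_independent_iff_card using dim fin by simp
  then have "int DIM('a) simplex (convex hull (vertices P))" using card by (intro simplex_convex_hull) simp
  then show ?thesis using hull by simp
qed

lemma sum_vertices_zero:
  fixes P :: "'a::euclidean_space set"
  assumes P: "equiradial P" and full: "aff_dim P = int DIM('a)"
  shows "(\<Sum>v\<in>vertices P. v) = 0"
proof -
  have "P \<noteq> {}" using full by auto
  moreover have "polytope P" using P equiradial_polytope by blast
  ultimately have "vertices P \<noteq> {}" "finite (vertices P)"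
    using polytope_eq_hull_vertices[of P] finite_vertices[of P] by auto
  then show ?thesis using full_dim_center_zero[OF P full] by (simp add: face_center_def)
qed

text \<open>Any two vertices span an edge, and the midpoints of the edges are equidistant from the origin, so all
inner products agree. Their common value follows from the vanishing sum of the vertices.\<close>

lemma simplex_inner_products:
  fixes P :: "'a::euclidean_space set"
  assumes P: "equiradial P" and full: "aff_dim P = int DIM('a)" and V: "vertices P \<subseteq> sphere 0 1"
    and simplex: "int DIM('a) simplex P"
  shows "inner_products (vertices P) = {- 1 / real DIM('a)}"
proof -
  let ?n = "DIM('a)"
  obtain C where C: "finite C" "\<not> affine_dependent C" "int (card C) = int ?n + 1" "P = convex hull C"
    using simplex unfolding Polytope.simplex by blast
  have VC: "vertices P = C"
    unfolding vertices_def C(4) using extreme_point_of_convex_hull_affine_independent[OF C(2)] by auto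
  have sq: "u \<bullet> u = 1" if "u \<in> C" for u using V VC that by (auto simp: norm_eq_1)
  have center: "face_center (convex hull {u, v}) = (u + v) /\<^sub>R 2" if "u \<noteq> v" for u v :: 'a
  proof -
    have "vertices (convex hull {u, v}) = {u, v}"
      unfolding vertices_def using extreme_point_of_convex_hull_2[of _ u v] by auto
    then show ?thesis using that by (simp add: face_center_def)
  qed
  have const: "u \<bullet> v = u' \<bullet> v'" if "u \<in> C" "v \<in> C" "u \<noteq> v" "u' \<in> C" "v' \<in> C" "u' \<noteq> v'" for u v u' v'
  proof -
    let ?e = "convex hull {u, v}" and ?e' = "convex hull {u', v'}"
    have face: "convex hull {x, y} face_of P" if "x \<in> C" "y \<in> C" for x y
      unfolding C(4) face_of_convex_hull_affine_independent[OF C(2)]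
      using that by (intro exI[of _ "{x, y}"]) simp
    have faces: "?e face_of P" "?e' face_of P" using face that by simp_all
    have "norm (face_center ?e) = norm (face_center ?e')"
      using that by (intro equiradial_radius[OF P faces]) (auto simp: aff_dim_convex_hull aff_dim_2)
    then have "norm (u + v) = norm (u' + v')" using that by (simp add: center)
    then have "(u + v) \<bullet> (u + v) = (u' + v') \<bullet> (u' + v')" by (rule norm_eq_imp_inner)
    then show ?thesis using that sq by (simp add: inner_add inner_commute)
  qed
  have cC: "card C = ?n + 1" using C(3) by linarith
  have prod: "u \<bullet> v = - 1 / real ?n" if "u \<in> C" "v \<in> C" "u \<noteq> v" for u v
  proof -
    have "0 = (\<Sum>w\<in>C. w \<bullet> v)"
      using inner_sum_left[of "\<lambda>w. w" C v] sum_vertices_zero[OF P full] VC by simp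
    also have "\<dots> = v \<bullet> v + (\<Sum>w\<in>C - {v}. w \<bullet> v)" using C(1) that(2) by (rule sum.remove)
    also have "(\<Sum>w\<in>C - {v}. w \<bullet> v) = (\<Sum>w\<in>C - {v}. u \<bullet> v)"
    proof (rule sum.cong)
      fix w assume "w \<in> C - {v}"
      then show "w \<bullet> v = u \<bullet> v" using const[of w v u v] that by blast
    qed simp
    finally have "0 = 1 + real ?n * (u \<bullet> v)" using sq that C(1) cC by simp
    then show ?thesis by (simp add: field_simps)
  qed
  have "\<not> C \<subseteq> {w}" for w using card_mono[of "{w}" C] cC by auto
  then obtain u v where uv: "u \<in> C" "v \<in> C" "u \<noteq> v" by (metis insertI1 singletonD subsetI)
  show ?thesis unfolding inner_products_def VC
  proof (intro equalityI subsetI)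
    show "x \<in> {- 1 / real ?n}" if "x \<in> {u \<bullet> v |u v. u \<in> C \<and> v \<in> C \<and> u \<noteq> v}" for x
      using that prod by blast
    show "x \<in> {u \<bullet> v |u v. u \<in> C \<and> v \<in> C \<and> u \<noteq> v}" if "x \<in> {- 1 / real ?n}" for x
    proof -
      have "x = u \<bullet> v" using that prod[OF uv] by simp
      then show ?thesis using uv by blast
    qed
  qed
qed

section \<open>Moving the center to the origin\<close>

lemma vertices_translation: "vertices ((+) a ` F) = (+) a ` vertices F"
  unfolding vertices_def by (rule extreme_points_of_translation)

lemma face_center_translation:
  assumes "polytope F" "F \<noteq> {}"
  shows "face_center ((+) a ` F) = a + face_center F"
proof -
  have "vertices F \<noteq> {}" using polytope_eq_hull_vertices[OF assms(1)] assms(2) by auto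
  then have "card (vertices F) \<noteq> 0" using finite_vertices[OF assms(1)] by simp
  then show ?thesis
    unfolding face_center_def vertices_translation
    by (simp add: card_image sum.reindex sum.distrib scaleR_right_distrib sum_constant_scaleR)
qed

lemma equiradial_if_regular:
  fixes P :: "'a::euclidean_space set"
  assumes P: "regular_polytope P" and c: "is_center P (- a)"
  shows "equiradial ((+) a ` P)"
proof -
  have pP: "polytope P" using P by (simp add: regular_polytope_def full_polytope_def)
  have face: "\<exists>F'. F' face_of P \<and> F = (+) a ` F'" if "F face_of (+) a ` P" for F
    using that faces_of_translation[of a P] by blast
  show ?thesis
    unfolding equiradial_def
  proof (intro conjI allI impI)
    show "polytope ((+) a ` P)" using pP by (simp add: polytope_translation_eq)
  next
    fix F G assume FG: "F face_of (+) a ` P" "G face_of (+) a ` P" "F \<subseteq> G" "aff_dim G = aff_dim F + 2"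
    obtain F' where F': "F' face_of P" "F = (+) a ` F'" using face[OF FG(1)] by blast
    obtain G' where G': "G' face_of P" "G = (+) a ` G'" using face[OF FG(2)] by blast
    have dims: "aff_dim G' = aff_dim F' + 2" using FG(4) F' G' by (simp add: aff_dim_translation_eq)
    let ?j = "aff_dim G'"
    let ?X = "{H \<in> j_faces (?j - 1) P. F' \<subseteq> H \<and> H \<subseteq> G'}"
    have "?j \<in> {1..int DIM('a)}" using dims aff_dim_geq[of F'] aff_dim_le_DIM[of G'] by simp
    moreover have "F' \<in> j_faces (?j - 2) P" "G' \<in> j_faces ?j P" using F' G' dims by (auto simp: j_faces_def)
    moreover have "F' \<subseteq> G'" using FG(3) F' G' by (simp add: inj_image_subset_iff)
    ultimately have "card ?X = 2" using P unfolding regular_polytope_def by blast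
    moreover have "{H. H face_of (+) a ` P \<and> aff_dim H = aff_dim F + 1 \<and> F \<subseteq> H \<and> H \<subseteq> G}
        = image ((+) a) ` ?X" (is "?L = ?R")
    proof
      show "?L \<subseteq> ?R"
      proof
        fix H assume H: "H \<in> ?L"
        then obtain H' where H': "H' face_of P" "H = (+) a ` H'" using face by blast
        then have "H' \<in> ?X"
          using H F' G' dims by (auto simp: j_faces_def aff_dim_translation_eq inj_image_subset_iff)
        then show "H \<in> ?R" using H' by blast
      qed
      show "?R \<subseteq> ?L"
        using F' G' dims by (auto simp: j_faces_def aff_dim_translation_eq inj_image_subset_iff)
    qed
    moreover have "inj_on (image ((+) a)) ?X" 
      by (rule inj_onI) (simp add: inj_image_eq_iff)
    ultimately show "card {H. H face_of (+) a ` P \<and> aff_dim H = aff_dim F + 1 \<and> F \<subseteq> H \<and> H \<subseteq> G} = 2"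
      by (simp add: card_image)
  next
    fix F G assume FG: "F face_of (+) a ` P" "G face_of (+) a ` P" "F \<noteq> {}" "G \<noteq> {}" "aff_dim F = aff_dim G"
    obtain F' where F': "F' face_of P" "F = (+) a ` F'" using face[OF FG(1)] by blast
    obtain G' where G': "G' face_of P" "G = (+) a ` G'" using face[OF FG(2)] by blast
    have "F' \<noteq> {}" using FG(3) F'(2) by blast
    then have "aff_dim F' \<noteq> -1" using aff_dim_empty[of F'] by simp
    then have dims: "aff_dim G' = aff_dim F'" "0 \<le> aff_dim F'"
      using FG(5) F'(2) G'(2) aff_dim_geq[of F'] by (simp_all add: aff_dim_translation_eq)
    have "aff_dim F' \<in> {0..int DIM('a)}" using dims aff_dim_le_DIM[of F'] by simp
    then obtain r where "\<And>H. H \<in> j_faces (aff_dim F') P \<Longrightarrow> dist (- a) (face_center H) = r"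
      using c unfolding is_center_def by blast
    then have "dist (- a) (face_center F') = dist (- a) (face_center G')" using F' G' dims by (simp add: j_faces_def)
    moreover have "face_center F = a + face_center F'" "face_center G = a + face_center G'"
      using F' G' FG face_of_polytope_polytope[OF pP] by (auto simp: face_center_translation)
    moreover have "dist (- a) x = norm (a + x)" for x
      using norm_minus_cancel[of "a + x"] by (simp add: dist_norm)
    ultimately show "norm (face_center F) = norm (face_center G)" by simp
  qed
qed

lemma chord_lengths_translation: "chord_lengths ((+) a ` P) = chord_lengths P"
  unfolding chord_lengths_def vertices_translation
proof (intro equalityI subsetI)
  fix l assume "l \<in> {dist u v |u v. u \<in> vertices P \<and> v \<in> vertices P \<and> u \<noteq> v}"
  then obtain u v where uv: "u \<in> vertices P" "v \<in> vertices P" "u \<noteq> v" "l = dist u v" by blast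
  then have "l = dist (a + u) (a + v)" "a + u \<noteq> a + v" by simp_all
  then show "l \<in> {dist u v |u v. u \<in> (+) a ` vertices P \<and> v \<in> (+) a ` vertices P \<and> u \<noteq> v}"
    using uv(1,2) by blast
next
  fix l assume "l \<in> {dist u v |u v. u \<in> (+) a ` vertices P \<and> v \<in> (+) a ` vertices P \<and> u \<noteq> v}"
  then obtain u v where uv: "u \<in> vertices P" "v \<in> vertices P" "a + u \<noteq> a + v" "l = dist (a + u) (a + v)"
    by blast
  then have "l = dist u v" "u \<noteq> v" by auto
  then show "l \<in> {dist u v |u v. u \<in> vertices P \<and> v \<in> vertices P \<and> u \<noteq> v}"
    using uv(1,2) by blast
qed

lemma card_edges_translation: "card {e. e edge_of (+) a ` P} = card {e. e edge_of P}"
proof -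
  have "{e. e edge_of (+) a ` P} = image ((+) a) ` {e. e edge_of P}"
  proof (intro equalityI subsetI)
    fix e assume "e \<in> {e. e edge_of (+) a ` P}"
    then have e: "e \<in> {F. F face_of (+) a ` P}" "aff_dim e = 1" by (auto simp: edge_of_def)
    then obtain e' where "e' face_of P" "e = (+) a ` e'" unfolding faces_of_translation by blast
    then show "e \<in> image ((+) a) ` {e. e edge_of P}"
      using e(2) by (auto simp: edge_of_def aff_dim_translation_eq)
  qed (auto simp: edge_of_def aff_dim_translation_eq)
  moreover have "inj_on (image ((+) a)) {e. e edge_of P}" 
      by (rule inj_onI) (simp add: inj_image_eq_iff)
  ultimately show ?thesis by (simp add: card_image)
qed

lemma simplex_translation:
  fixes P :: "'a::euclidean_space set"
  shows "m simplex P \<Longrightarrow> m simplex ((+) a ` P)"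
  unfolding simplex_def
proof clarify
  fix C :: "'a set" assume C: "\<not> affine_dependent C" "int (card C) = m + 1"
  show "\<exists>D. \<not> affine_dependent D \<and> int (card D) = m + 1 \<and> (+) a ` (convex hull C) = convex hull D"
    using C affine_dependent_translation_eq[of C a]
    by (intro exI[of _ "(+) a ` C"]) (simp add: card_image convex_hull_translation)
qed

section \<open>The sum of the squared chord lengths\<close>

lemma centered_sum_of_squares:
  fixes Q :: "'a::euclidean_space set"
  assumes n: "2 \<le> DIM('a)" and Q: "equiradial Q" and full: "aff_dim Q = int DIM('a)"
    and V: "vertices Q \<subseteq> sphere 0 1"
  defines "S \<equiv> \<Sum>l\<in>chord_lengths Q. l\<^sup>2" and "k \<equiv> card (chord_lengths Q)"
    and "E \<equiv> card {e. e edge_of Q}"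
  shows "3 \<le> DIM('a) \<Longrightarrow> int DIM('a) simplex Q \<Longrightarrow> S = 2 + 2 / real DIM('a)"
    and "\<not> (3 \<le> DIM('a) \<and> int DIM('a) simplex Q) \<Longrightarrow>
           (odd E \<and> S = 2 * real k + 1) \<or> (even E \<and> S = 2 * real k + 2)"
proof -
  let ?n = "DIM('a)" and ?V = "vertices Q"
  have pQ: "polytope Q" using Q equiradial_polytope by blast
  have S: "S = 2 * real k - 2 * (\<Sum>t\<in>inner_products ?V. t)" and k: "k = card (inner_products ?V)"
    using chord_lengths_unit_sphere[OF V] unfolding S_def k_def by simp_all
  have finV: "finite ?V" by (rule finite_vertices[OF pQ])
  show "S = 2 + 2 / real ?n" if "3 \<le> ?n" "int ?n simplex Q"
    using S k simplex_inner_products[OF Q full V that(2)] by simp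
  assume not: "\<not> (3 \<le> ?n \<and> int ?n simplex Q)"
  obtain \<alpha> f where "mirror_chain ?n ?V \<alpha> f" by (rule equiradial_mirror_chain[OF Q full V])
  then interpret mirror_chain ?n ?V \<alpha> f .
  show "(odd E \<and> S = 2 * real k + 1) \<or> (even E \<and> S = 2 * real k + 2)"
  proof (cases "uminus ` ?V = ?V")
    case True
    then have "uminus ` Q = Q" using symmetry_of_vertices[OF pQ orthogonal_transformation_uminus] by blast
    then have "even E" unfolding E_def by (rule even_edges_if_centrally_symmetric[OF Q full n])
    moreover have "S = 2 * real k + 2"
    proof -
      have "?V \<noteq> {}" using base by blast
      then show ?thesis using S sum_inner_products_symmetric[OF finV _ V True] by simp
    qed
    ultimately show ?thesis by blast
  next
    case False
    have n2: "?n = 2"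
    proof (rule ccontr)
      assume "?n \<noteq> 2"
      then have "3 \<le> ?n" using n by simp
      then have "card ?V \<le> ?n + 1" using centrally_symmetric_or_few_vertices False by blast
      then show False using simplex_if_few_vertices[OF pQ full] not \<open>3 \<le> ?n\<close> by blast
    qed
    have anti: "- f 0 \<notin> ?V" using uminus_image_if_antipode False by blast
    have "(\<Sum>t\<in>inner_products ?V. t) = - 1 / 2" "card ?V = 2 * card (inner_products ?V) + 1"
      using polygon_inner_products[OF n2 V sum_vertices_zero[OF Q full] anti]
      unfolding inner_products_def by simp_all
    moreover have "E = card ?V" unfolding E_def using polygon_edges_eq_vertices[OF Q] full n2 by simp
    ultimately show ?thesis using S by simp
  qed
qed

theorem theorem4p3:
  fixes P :: "(real ^ 'n) set" and E k :: nat and d :: "nat \<Rightarrow> real"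
  assumes "CARD('n) \<ge> 2"
    and "regular_polytope P"
    and "inscribed_in_unit_sphere P"
    and "E = card {e. e edge_of P}"
    and "k = card (chord_lengths P)"
    and "bij_betw d {1..k} (chord_lengths P)"
  shows "(CARD('n) \<ge> 3 \<and> int CARD('n) simplex P \<longrightarrow>
            (\<Sum>i=1..k. (d i)\<^sup>2) \<in> \<rat> \<and> (\<Sum>i=1..k. (d i)\<^sup>2) \<notin> \<int>) \<and>
         (\<not> (CARD('n) \<ge> 3 \<and> int CARD('n) simplex P) \<longrightarrow>
            (\<Sum>i=1..k. (d i)\<^sup>2) \<in> \<int> \<and>
            (odd E \<longrightarrow> (\<Sum>i=1..k. (d i)\<^sup>2) = 2 * real k + 1) \<and>
            (even E \<longrightarrow> (\<Sum>i=1..k. (d i)\<^sup>2) = 2 * real k + 2))"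
proof -
  obtain a where a: "is_center P (- a)" "vertices P \<subseteq> sphere (- a) 1"
    using assms(3) unfolding inscribed_in_unit_sphere_def by (metis minus_minus)
  define Q where "Q = (+) a ` P"
  have Q: "equiradial Q" unfolding Q_def by (rule equiradial_if_regular[OF assms(2) a(1)])
  have full: "aff_dim Q = int DIM(real ^ 'n)"
    using assms(2) by (simp add: Q_def regular_polytope_def full_polytope_def aff_dim_translation_eq)
  have V: "vertices Q \<subseteq> sphere 0 1"
  proof -
    have "norm (a + x) = 1" if "x \<in> vertices P" for x
      using that a(2) norm_minus_cancel[of "a + x"] by (auto simp: dist_norm)
    then show ?thesis by (auto simp: Q_def vertices_translation)
  qed
  have chords: "chord_lengths Q = chord_lengths P" unfolding Q_def by (rule chord_lengths_translation)
  have edges: "card {e. e edge_of Q} = E" unfolding Q_def assms(4) by (rule card_edges_translation)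
  have "P = (+) (- a) ` Q" by (simp add: Q_def image_image)
  then have simp: "int CARD('n) simplex Q \<longleftrightarrow> int CARD('n) simplex P"
    using simplex_translation[of _ Q "- a"] simplex_translation[of _ P a] unfolding Q_def by metis
  define S where "S = (\<Sum>i=1..k. (d i)\<^sup>2)"
  have S: "S = (\<Sum>l\<in>chord_lengths Q. l\<^sup>2)"
    unfolding S_def chords by (rule sum.reindex_bij_betw[OF assms(6)])
  have main: "3 \<le> CARD('n) \<Longrightarrow> int CARD('n) simplex P \<Longrightarrow> S = 2 + 2 / real CARD('n)"
    "\<not> (3 \<le> CARD('n) \<and> int CARD('n) simplex P) \<Longrightarrow>
      (odd E \<and> S = 2 * real k + 1) \<or> (even E \<and> S = 2 * real k + 2)"
    using centered_sum_of_squares[OF _ Q full V] assms(1,5) chords edges simp S by simp_all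
  have "S \<in> \<rat> \<and> S \<notin> \<int>" if n: "3 \<le> CARD('n)" "int CARD('n) simplex P"
  proof
    show "S \<in> \<rat>" unfolding main(1)[OF n] by simp
    show "S \<notin> \<int>"
    proof
      assume "S \<in> \<int>"
      then have "S - 2 \<in> \<int>" by simp
      then obtain z :: int where z: "2 / real CARD('n) = of_int z"
        unfolding main(1)[OF n] by (auto elim: Ints_cases)
      have "0 < 2 / real CARD('n)" "2 / real CARD('n) < 1" using n(1) by auto
      then show False unfolding z by simp
    qed
  qed
  moreover have "S \<in> \<int> \<and> (odd E \<longrightarrow> S = 2 * real k + 1) \<and> (even E \<longrightarrow> S = 2 * real k + 2)"
    if "\<not> (3 \<le> CARD('n) \<and> int CARD('n) simplex P)"
    using main(2)[OF that] by auto
  ultimately show ?thesis unfolding S_def by blast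
qed

end
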